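(* Let $n=2$ and let $u$ be a variational solution in $\Omega\subset\mathbb{R}^2$. Then the set $\Sigma^u$ is locally finite in $\Omega$, i.e. every compact subset of $\Omega$ contains only finitely many points of $\Sigma^u$.
   Context: $\Omega\subset\mathbb{R}^2$ is a bounded domain meeting $\{x_2=0\}$; $a^+=\max(a,0)$; $\chi_A$ characteristic function. Variational solution (with $n=2$): $u\in W^{1,2}_{\mathrm{loc}}(\Omega)\cap C^0(\Omega)\cap C^2(\Omega\cap\{u>0\})$, $u\ge0$, $u\equiv0$ in $\Omega\cap\{x_n\le0\}$, and $\int_\Omega(|\nabla u|^2\mathrm{div}\phi-2\nabla u D\phi\nabla u+x_n\chi_{\{u>0\}}\mathrm{div}\phi+\chi_{\{u>0\}}\phi_n)=0$ for all $\phi\in C^1_0(\Omega;\mathbb{R}^n)$. $S^u:=\{x\in\Omega:x_n=0,\ x\in\partial\{u>0\}\}$; for $x^0_n=0$ and $0<r<\mathrm{dist}(x^0,\partial\Omega)/2$, $\Phi^{\mathrm{bound}}_{x^0,u}(r):=r^{-n-1}\int_{B_r(x^0)}(|\nabla u|^2+x_n\chi_{\{u>0\}})-\tfrac32r^{-n-2}\int_{\partial B_r(x^0)}u^2d\mathcal H^{n-1}$, with limit $\Phi^{\mathrm{bound}}_{x^0,u}(0+)$ as $r\searrow0$ (which exists); $\Sigma^u:=\{x^0\in S^u:\Phi^{\mathrm{bound}}_{x^0,u}(0+)=\int_{B_1}x_n^+\}$. *)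

theory Defs
  imports "HOL-Analysis.Analysis"
begin

type_synonym pt = "real ^ 2"

fun Ck_on :: "nat \<Rightarrow> pt set \<Rightarrow> (pt \<Rightarrow> real) \<Rightarrow> bool" where
  "Ck_on 0 S f = continuous_on S f"
| "Ck_on (Suc k) S f =
     (\<exists>G :: pt \<Rightarrow> pt. (\<forall>x\<in>S. (f has_derivative (\<lambda>h. G x \<bullet> h)) (at x))
        \<and> (\<forall>i. Ck_on k S (\<lambda>x. G x $ i)))"

definition Cinf_on :: "pt set \<Rightarrow> (pt \<Rightarrow> real) \<Rightarrow> bool" where
  "Cinf_on S f \<longleftrightarrow> (\<forall>k. Ck_on k S f)"

definition compact_supp_in :: "pt set \<Rightarrow> (pt \<Rightarrow> 'b::zero) \<Rightarrow> bool" where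
  "compact_supp_in \<Omega> f \<longleftrightarrow>
     compact (closure {x. f x \<noteq> 0}) \<and> closure {x. f x \<noteq> 0} \<subseteq> \<Omega>"

definition test_fun :: "pt set \<Rightarrow> (pt \<Rightarrow> real) \<Rightarrow> bool" where
  "test_fun \<Omega> \<psi> \<longleftrightarrow> Cinf_on UNIV \<psi> \<and> compact_supp_in \<Omega> \<psi>"

definition C1_0_field :: "pt set \<Rightarrow> (pt \<Rightarrow> pt) \<Rightarrow> bool" where
  "C1_0_field \<Omega> \<phi> \<longleftrightarrow> (\<forall>i. Ck_on 1 UNIV (\<lambda>x. \<phi> x $ i)) \<and> compact_supp_in \<Omega> \<phi>"

definition Dfield :: "(pt \<Rightarrow> pt) \<Rightarrow> pt \<Rightarrow> pt \<Rightarrow> pt" where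
  "Dfield \<phi> x = frechet_derivative \<phi> (at x)"

definition divg :: "(pt \<Rightarrow> pt) \<Rightarrow> pt \<Rightarrow> real" where
  "divg \<phi> x = (\<Sum>i\<in>UNIV. Dfield \<phi> x (axis i 1) $ i)"

definition weak_gradient :: "pt set \<Rightarrow> (pt \<Rightarrow> real) \<Rightarrow> (pt \<Rightarrow> pt) \<Rightarrow> bool" where
  "weak_gradient \<Omega> u g \<longleftrightarrow>
     (\<forall>\<psi>. test_fun \<Omega> \<psi> \<longrightarrow> (\<forall>i.
        (LINT x:\<Omega>|lebesgue. u x * frechet_derivative \<psi> (at x) (axis i 1))
          = - (LINT x:\<Omega>|lebesgue. g x $ i * \<psi> x)))"

definition W12_loc :: "pt set \<Rightarrow> (pt \<Rightarrow> real) \<Rightarrow> (pt \<Rightarrow> pt) \<Rightarrow> bool" where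
  "W12_loc \<Omega> u g \<longleftrightarrow>
     (\<forall>K. compact K \<and> K \<subseteq> \<Omega> \<longrightarrow>
        set_integrable lebesgue K (\<lambda>x. (u x)\<^sup>2) \<and>
        set_integrable lebesgue K (\<lambda>x. (norm (g x))\<^sup>2) \<and>
        set_integrable lebesgue K u \<and> (\<forall>i. set_integrable lebesgue K (\<lambda>x. g x $ i)))
     \<and> weak_gradient \<Omega> u g"

definition chi_pos :: "(pt \<Rightarrow> real) \<Rightarrow> pt \<Rightarrow> real" where
  "chi_pos u x = (if u x > 0 then 1 else 0)"

definition variational_solution :: "pt set \<Rightarrow> (pt \<Rightarrow> real) \<Rightarrow> (pt \<Rightarrow> pt) \<Rightarrow> bool" where
  "variational_solution \<Omega> u g \<longleftrightarrow>
     W12_loc \<Omega> u g \<and> continuous_on \<Omega> u \<and> Ck_on 2 (\<Omega> \<inter> {x. u x > 0}) u \<and>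
     (\<forall>x\<in>\<Omega>. u x \<ge> 0) \<and> (\<forall>x\<in>\<Omega>. x $ 2 \<le> 0 \<longrightarrow> u x = 0) \<and>
     (\<forall>\<phi>. C1_0_field \<Omega> \<phi> \<longrightarrow>
        (LINT x:\<Omega>|lebesgue.
            (norm (g x))\<^sup>2 * divg \<phi> x - 2 * (g x \<bullet> Dfield \<phi> x (g x))
          + x $ 2 * chi_pos u x * divg \<phi> x + chi_pos u x * \<phi> x $ 2) = 0)"

definition S_set :: "pt set \<Rightarrow> (pt \<Rightarrow> real) \<Rightarrow> pt set" where
  "S_set \<Omega> u = {x\<in>\<Omega>. x $ 2 = 0 \<and> x \<in> frontier {y\<in>\<Omega>. u y > 0}}"

text \<open>Boundary-adjusted monotonicity quantity, n = 2; the H^1 integral over the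
  circle \<partial>B_r(x0) is written via the arc-length parametrization.\<close>
definition Phi_bound :: "(pt \<Rightarrow> real) \<Rightarrow> (pt \<Rightarrow> pt) \<Rightarrow> pt \<Rightarrow> real \<Rightarrow> real" where
  "Phi_bound u g x0 r =
     (LINT x:ball x0 r|lebesgue. (norm (g x))\<^sup>2 + x $ 2 * chi_pos u x) / r ^ 3
   - 3 / 2 * (LBINT t=0..2 * pi. (u (x0 + r *\<^sub>R vector [cos t, sin t]))\<^sup>2 * r) / r ^ 4"

definition Sigma_set :: "pt set \<Rightarrow> (pt \<Rightarrow> real) \<Rightarrow> (pt \<Rightarrow> pt) \<Rightarrow> pt set" where
  "Sigma_set \<Omega> u g = {x0 \<in> S_set \<Omega> u.
      ((\<lambda>r. Phi_bound u g x0 r) \<longlongrightarrow>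
          (LINT x:ball (0::pt) 1|lebesgue. max (x $ 2) 0)) (at_right 0)}"

end

theory Submission
  imports Defs
begin

text \<open>
  Write \<open>grad\<close> for the gradient of \<open>u\<close> on \<open>{u > 0}\<close>, extended by zero. The variational equation makes \<open>u\<close>
  harmonic on \<open>{u > 0}\<close> and gives a stress identity whose right-hand side lives on the air phase, the part of the
  upper half-plane where \<open>u = 0\<close>. At a point \<open>c\<close> of \<open>\<Sigma>\<close> the monotonicity formula makes the frequency, the
  quotient of energy minus air volume by the mass of \<open>u\<^sup>2\<close>, at least \<open>3/2\<close> and nondecreasing in the squared
  radius \<open>\<tau>\<close>; both properties pass to limits of points of \<open>\<Sigma>\<close>.

  Suppose \<open>c\<close> is an accumulation point of \<open>\<Sigma>\<close>, and let \<open>z \<in> \<Sigma>\<close> have distance \<open>d\<close> to \<open>c\<close>.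
  Since the frequency converges as \<open>\<tau>\<close> decreases to 0, at scale \<open>d\<close> the function \<open>u\<close> is almost homogeneous about
  \<open>c\<close> and the air phase is almost negligible. Testing the stress identity with a rotation field about \<open>c\<close>
  that is supported in the annulus \<open>|x - c| \<approx> d\<close> of relative width \<open>s\<close> and vanishes near \<open>z\<close>
  bounds the energy in the annulus by \<open>1/s\<close> times the energy in a ball of radius \<open>4 s d\<close> about \<open>z\<close>, up to
  small errors. As the frequency at \<open>z\<close> is at least \<open>3/2\<close>, the latter is of order \<open>s\<^sup>3\<close>, so the annulus
  carries at most order \<open>s\<^sup>2\<close> of the energy; almost homogeneity and the doubling property at \<open>c\<close>
  force it to carry at least order \<open>s\<close>. For small \<open>s\<close> this is a contradiction.
\<close>

subsection \<open>Gradients and functions of class \<open>C\<^sup>k\<close>\<close>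

lemma GDERIV_iff_has_derivative: "GDERIV f x :> D \<longleftrightarrow> (f has_derivative (\<lambda>h. D \<bullet> h)) (at x)"
  by (simp add: gderiv_def inner_commute)

lemma GDERIV_unique: "GDERIV f x :> D \<Longrightarrow> GDERIV f x :> D' \<Longrightarrow> D = D'"
proof -
  assume "GDERIV f x :> D" "GDERIV f x :> D'"
  then have "(\<lambda>h. h \<bullet> D) = (\<lambda>h. h \<bullet> D')" unfolding gderiv_def by (rule has_derivative_unique)
  then have "h \<bullet> D = h \<bullet> D'" for h by meson
  then show "D = D'" using vector_eq_ldot by blast
qed

lemma GDERIV_transform_open:
  assumes "GDERIV f x :> D" "open S" "x \<in> S" "\<And>y. y \<in> S \<Longrightarrow> f y = g y"
  shows "GDERIV g x :> D"
  using assms unfolding gderiv_def by (rule has_derivative_transform_within_open)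

lemma GDERIV_zero_outside_closed:
  assumes "closed K" "\<And>y. y \<notin> K \<Longrightarrow> f y = 0" "x \<notin> K"
  shows "GDERIV f x :> 0"
  by (rule GDERIV_transform_open[OF GDERIV_const[of 0], of "- K"]) (use assms in auto)

lemma GDERIV_continuous_on:
  assumes "\<And>x. x \<in> S \<Longrightarrow> GDERIV f x :> G x"
  shows "continuous_on S f"
  by (rule has_derivative_continuous_on[OF has_derivative_at_withinI])
    (use assms in \<open>simp add: gderiv_def\<close>)

lemma GDERIV_component: "GDERIV (\<lambda>x. x $ i) x :> axis i 1"
  by (simp add: gderiv_def inner_axis bounded_linear_imp_has_derivative bounded_linear_vec_nth)

lemma GDERIV_diff_component: "GDERIV (\<lambda>x. (x - c) $ i) x :> axis i 1"
  using GDERIV_diff[OF GDERIV_component GDERIV_const[of "c $ i"]] by simp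

lemma GDERIV_power2_norm_diff: "GDERIV (\<lambda>x. (norm (x - c))\<^sup>2) x :> 2 *\<^sub>R (x - c)"
  unfolding gderiv_def power2_norm_eq_inner
  by (auto intro!: derivative_eq_intros simp: inner_commute)

lemma GDERIV_rescale:
  assumes "GDERIV f (r *\<^sub>R (x - c)) :> D"
  shows "GDERIV (\<lambda>x. f (r *\<^sub>R (x - c))) x :> r *\<^sub>R D"
proof -
  have "((\<lambda>x. r *\<^sub>R (x - c)) has_derivative (\<lambda>h. r *\<^sub>R h)) (at x)"
    by (auto intro!: derivative_eq_intros)
  from has_derivative_compose[OF this assms[unfolded gderiv_def]] show ?thesis
    by (simp add: gderiv_def)
qed

lemma GDERIV_imp_DERIV_line:
  assumes "GDERIV f (a + t *\<^sub>R e) :> D"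
  shows "((\<lambda>t. f (a + t *\<^sub>R e)) has_real_derivative D \<bullet> e) (at t)"
proof -
  have "((\<lambda>t. a + t *\<^sub>R e) has_derivative (\<lambda>h. h *\<^sub>R e)) (at t)"
    by (auto intro!: derivative_eq_intros)
  from has_derivative_compose[OF this assms[unfolded gderiv_def]] show ?thesis
    by (rule has_derivative_imp_has_field_derivative) (simp add: inner_commute)
qed

lemma continuous_on_componentwise:
  fixes G :: "'a::topological_space \<Rightarrow> real ^ 'n"
  assumes "\<And>i. continuous_on S (\<lambda>x. G x $ i)"
  shows "continuous_on S G"
  using continuous_on_vec_lambda[of S "\<lambda>i x. G x $ i"] assms by simp

definition gradient :: "('a::real_inner \<Rightarrow> real) \<Rightarrow> 'a \<Rightarrow> 'a" where
  "gradient f x = (THE D. GDERIV f x :> D)"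

lemma gradient_eqI: "GDERIV f x :> D \<Longrightarrow> gradient f x = D"
  unfolding gradient_def by (blast intro: GDERIV_unique)

declare Ck_on.simps(2) [simp del]

lemma Ck_on_SucI:
  assumes "\<And>x. x \<in> S \<Longrightarrow> GDERIV f x :> G x" "\<And>i. Ck_on k S (\<lambda>x. G x $ i)"
  shows "Ck_on (Suc k) S f"
  using assms by (auto simp: Ck_on.simps(2) GDERIV_iff_has_derivative)

lemma Ck_on_SucE:
  assumes "Ck_on (Suc k) S f"
  obtains G where "\<And>x. x \<in> S \<Longrightarrow> GDERIV f x :> G x" "\<And>i. Ck_on k S (\<lambda>x. G x $ i)"
  using assms by (auto simp: Ck_on.simps(2) GDERIV_iff_has_derivative)

lemma Ck_on_cong_open:
  assumes "Ck_on k S f" "open S" "\<And>x. x \<in> S \<Longrightarrow> f x = g x"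
  shows "Ck_on k S g"
proof (cases k)
  case 0
  then show ?thesis using assms continuous_on_eq by (metis Ck_on.simps(1))
next
  case (Suc m)
  then obtain G where "\<And>x. x \<in> S \<Longrightarrow> GDERIV f x :> G x" "\<And>i. Ck_on m S (\<lambda>x. G x $ i)"
    using assms(1) Ck_on_SucE by blast
  then show ?thesis
    unfolding Suc by (intro Ck_on_SucI[of S g G]) (use assms GDERIV_transform_open in blast)+
qed

lemma Ck_on_gradient:
  assumes "Ck_on (Suc k) S f" "open S"
  shows "x \<in> S \<Longrightarrow> GDERIV f x :> gradient f x" "Ck_on k S (\<lambda>x. gradient f x $ i)"
proof -
  obtain G where G: "\<And>x. x \<in> S \<Longrightarrow> GDERIV f x :> G x" "\<And>i. Ck_on k S (\<lambda>x. G x $ i)"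
    using assms(1) by (rule Ck_on_SucE) blast
  have eq: "gradient f x = G x" if "x \<in> S" for x using gradient_eqI[OF G(1)[OF that]] .
  show "x \<in> S \<Longrightarrow> GDERIV f x :> gradient f x" using G(1) eq by simp
  show "Ck_on k S (\<lambda>x. gradient f x $ i)"
    by (rule Ck_on_cong_open[OF G(2) assms(2)]) (simp add: eq)
qed

lemma Ck_on_Suc_imp: "Ck_on (Suc k) S f \<Longrightarrow> Ck_on k S f"
proof (induction k arbitrary: f)
  case 0
  then show ?case by (auto elim!: Ck_on_SucE intro: GDERIV_continuous_on)
next
  case (Suc k)
  from Suc.prems obtain G where
    "\<And>x. x \<in> S \<Longrightarrow> GDERIV f x :> G x" "\<And>i. Ck_on (Suc k) S (\<lambda>x. G x $ i)"
    by (rule Ck_on_SucE) blast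
  then show ?case using Suc.IH by (blast intro: Ck_on_SucI)
qed

lemma Ck_on_const: "Ck_on k S (\<lambda>x. c)"
proof (induction k arbitrary: c)
  case (Suc k)
  show ?case by (rule Ck_on_SucI[where G="\<lambda>x. 0"]) (use Suc[of 0] in \<open>simp_all add: GDERIV_const\<close>)
qed simp

lemma Ck_on_component: "Ck_on k S (\<lambda>x. x $ i)"
proof (cases k)
  case (Suc m)
  show ?thesis unfolding Suc by (rule Ck_on_SucI[OF GDERIV_component Ck_on_const])
qed (auto intro!: continuous_intros)

lemma Ck_on_add: "Ck_on k S f \<Longrightarrow> Ck_on k S g \<Longrightarrow> Ck_on k S (\<lambda>x. f x + g x)"
proof (induction k arbitrary: f g)
  case (Suc k)
  obtain F where F: "\<And>x. x \<in> S \<Longrightarrow> GDERIV f x :> F x" "\<And>i. Ck_on k S (\<lambda>x. F x $ i)"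
    using Suc.prems(1) by (rule Ck_on_SucE) blast
  obtain G where G: "\<And>x. x \<in> S \<Longrightarrow> GDERIV g x :> G x" "\<And>i. Ck_on k S (\<lambda>x. G x $ i)"
    using Suc.prems(2) by (rule Ck_on_SucE) blast
  show ?case
    by (rule Ck_on_SucI[where G="\<lambda>x. F x + G x"]) (use F G in \<open>auto intro!: GDERIV_add Suc.IH\<close>)
qed (simp add: continuous_on_add)

lemma Ck_on_mult: "Ck_on k S f \<Longrightarrow> Ck_on k S g \<Longrightarrow> Ck_on k S (\<lambda>x. f x * g x)"
proof (induction k arbitrary: f g)
  case (Suc k)
  obtain F where F: "\<And>x. x \<in> S \<Longrightarrow> GDERIV f x :> F x" "\<And>i. Ck_on k S (\<lambda>x. F x $ i)"
    using Suc.prems(1) by (rule Ck_on_SucE) blast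
  obtain G where G: "\<And>x. x \<in> S \<Longrightarrow> GDERIV g x :> G x" "\<And>i. Ck_on k S (\<lambda>x. G x $ i)"
    using Suc.prems(2) by (rule Ck_on_SucE) blast
  have fg: "Ck_on k S f" "Ck_on k S g" using Suc.prems Ck_on_Suc_imp by blast+
  show ?case
    by (rule Ck_on_SucI[where G="\<lambda>x. f x *\<^sub>R G x + g x *\<^sub>R F x"])
      (use F G fg in \<open>auto intro!: GDERIV_mult Ck_on_add Suc.IH\<close>)
qed (simp add: continuous_on_mult)

lemma Ck_on_diff: "Ck_on k S f \<Longrightarrow> Ck_on k S g \<Longrightarrow> Ck_on k S (\<lambda>x. f x - g x)"
  using Ck_on_add[of k S f "\<lambda>x. -1 * g x"] Ck_on_mult[OF Ck_on_const[of k S "-1"]] by simp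

lemma Ck_on_prod: "finite I \<Longrightarrow> (\<And>i. i \<in> I \<Longrightarrow> Ck_on k S (f i)) \<Longrightarrow> Ck_on k S (\<lambda>x. \<Prod>i\<in>I. f i x)"
  by (induction I rule: finite_induct) (simp_all add: Ck_on_const Ck_on_mult)

lemma Ck_on_Suc_compose:
  assumes f: "Ck_on (Suc k) S f" and \<phi>: "\<And>t. (\<phi> has_real_derivative \<phi>' t) (at t)"
    and \<phi>': "Ck_on k S (\<lambda>x. \<phi>' (f x))"
  shows "Ck_on (Suc k) S (\<lambda>x. \<phi> (f x))"
proof -
  obtain F where F: "\<And>x. x \<in> S \<Longrightarrow> GDERIV f x :> F x" "\<And>i. Ck_on k S (\<lambda>x. F x $ i)"
    using f by (rule Ck_on_SucE) blast
  show ?thesis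
    by (rule Ck_on_SucI[where G="\<lambda>x. \<phi>' (f x) *\<^sub>R F x"])
      (use F in \<open>auto intro!: GDERIV_DERIV_compose[OF _ \<phi>] Ck_on_mult[OF \<phi>']\<close>)
qed

lemma second_difference:
  fixes u :: "real ^ 'n \<Rightarrow> real"
  assumes grad: "\<And>x. x \<in> S \<Longrightarrow> GDERIV u x :> p x"
    and hess: "\<And>x. x \<in> S \<Longrightarrow> GDERIV (\<lambda>x. p x $ i) x :> H x"
    and ball: "ball x r \<subseteq> S" and h: "0 < h" "2 * h < r"
  obtains \<xi> where "dist \<xi> x < r"
    "u (x + h *\<^sub>R axis i 1 + h *\<^sub>R axis j 1) - u (x + h *\<^sub>R axis i 1) - u (x + h *\<^sub>R axis j 1) + u x = h\<^sup>2 * H \<xi> $ j"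
proof -
  define y where "y s t = x + s *\<^sub>R axis i (1::real) + t *\<^sub>R axis j 1" for s t
  have near: "dist (y s t) x < r" if "0 \<le> s" "s \<le> h" "0 \<le> t" "t \<le> h" for s t
  proof -
    have "norm (s *\<^sub>R axis i (1::real) + t *\<^sub>R axis j 1) \<le> s + t"
      using norm_triangle_ineq[of "s *\<^sub>R axis i (1::real)" "t *\<^sub>R axis j 1"] that by simp
    then show ?thesis using that h by (simp add: dist_norm y_def add.assoc)
  qed
  then have in_S: "y s t \<in> S" if "0 \<le> s" "s \<le> h" "0 \<le> t" "t \<le> h" for s t
    using that ball by (auto simp: dist_commute)
  have deriv_s: "((\<lambda>s. u (y s t)) has_real_derivative p (y s t) $ i) (at s)"
    if "0 \<le> s" "s \<le> h" "0 \<le> t" "t \<le> h" for s t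
    using GDERIV_imp_DERIV_line[of u "x + t *\<^sub>R axis j 1" s "axis i 1"] grad[OF in_S[OF that]]
    by (simp add: y_def add_ac inner_axis)
  have deriv_t: "((\<lambda>t. p (y s t) $ i) has_real_derivative H (y s t) $ j) (at t)"
    if "0 \<le> s" "s \<le> h" "0 \<le> t" "t \<le> h" for s t
    using GDERIV_imp_DERIV_line[of "\<lambda>x. p x $ i" "x + s *\<^sub>R axis i 1" t "axis j 1"] hess[OF in_S[OF that]]
    by (simp add: y_def inner_axis)
  obtain s where s: "0 < s" "s < h"
    and mvt_s: "(u (y h h) - u (y h 0)) - (u (y 0 h) - u (y 0 0)) = (h - 0) * (p (y s h) $ i - p (y s 0) $ i)"
    using MVT2[OF h(1) DERIV_diff[OF deriv_s deriv_s], of h 0] h(1) by auto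
  obtain t where t: "0 < t" "t < h" and mvt_t: "p (y s h) $ i - p (y s 0) $ i = (h - 0) * H (y s t) $ j"
    using MVT2[OF h(1) deriv_t, of s] s by auto
  have "u (y h h) - u (y h 0) - u (y 0 h) + u (y 0 0) = h\<^sup>2 * H (y s t) $ j"
    using mvt_s mvt_t by (simp add: power2_eq_square)
  then show ?thesis using near[of s t] s t by (intro that[of "y s t"]) (auto simp: y_def)
qed

lemma mixed_partials_commute:
  fixes u :: "real ^ 'n \<Rightarrow> real"
  assumes "open S" "x \<in> S"
    and grad: "\<And>x. x \<in> S \<Longrightarrow> GDERIV u x :> p x"
    and hess: "\<And>i x. x \<in> S \<Longrightarrow> GDERIV (\<lambda>x. p x $ i) x :> H i x"
    and cont: "\<And>i. continuous_on S (H i)"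
  shows "H i x $ j = H j x $ i"
proof (rule ccontr)
  assume "H i x $ j \<noteq> H j x $ i"
  define \<epsilon> where "\<epsilon> = \<bar>H i x $ j - H j x $ i\<bar> / 2"
  have "\<epsilon> > 0" using \<open>H i x $ j \<noteq> H j x $ i\<close> by (simp add: \<epsilon>_def)
  have "\<forall>\<^sub>F y in nhds x. dist (H k y $ l) (H k x $ l) < \<epsilon>" for k l
  proof -
    have "isCont (\<lambda>y. H k y $ l) x"
      using cont[of k] assms(1,2) by (intro continuous_component) (simp add: continuous_on_eq_continuous_at)
    then have "((\<lambda>y. H k y $ l) \<longlongrightarrow> H k x $ l) (nhds x)"
      using tendsto_at_iff_tendsto_nhds[of "\<lambda>y. H k y $ l" x] by (simp add: isCont_def)
    then show ?thesis using \<open>\<epsilon> > 0\<close> by (rule tendstoD)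
  qed
  then have "\<forall>\<^sub>F y in nhds x. y \<in> S \<and> dist (H i y $ j) (H i x $ j) < \<epsilon> \<and> dist (H j y $ i) (H j x $ i) < \<epsilon>"
    using eventually_nhds_in_open[OF assms(1,2)] by (intro eventually_conj)
  then obtain r where "r > 0"
    and r: "\<And>y. dist y x < r \<Longrightarrow> y \<in> S \<and> dist (H i y $ j) (H i x $ j) < \<epsilon> \<and> dist (H j y $ i) (H j x $ i) < \<epsilon>"
    unfolding eventually_nhds_metric by blast
  define h where "h = r / 4"
  have ball: "ball x r \<subseteq> S" and h: "0 < h" "2 * h < r"
    using r \<open>r > 0\<close> by (auto simp: h_def dist_commute)
  obtain \<xi> where \<xi>: "dist \<xi> x < r" "u (x + h *\<^sub>R axis i 1 + h *\<^sub>R axis j 1) - u (x + h *\<^sub>R axis i 1)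
      - u (x + h *\<^sub>R axis j 1) + u x = h\<^sup>2 * H i \<xi> $ j"
    by (rule second_difference[OF grad hess ball h])
  obtain \<eta> where \<eta>: "dist \<eta> x < r" "u (x + h *\<^sub>R axis j 1 + h *\<^sub>R axis i 1) - u (x + h *\<^sub>R axis j 1)
      - u (x + h *\<^sub>R axis i 1) + u x = h\<^sup>2 * H j \<eta> $ i"
    by (rule second_difference[OF grad hess ball h])
  have "x + h *\<^sub>R axis j 1 + h *\<^sub>R axis i 1 = x + h *\<^sub>R axis i 1 + h *\<^sub>R axis j (1::real)" by (simp add: add_ac)
  then have "h\<^sup>2 * H i \<xi> $ j = h\<^sup>2 * H j \<eta> $ i" using \<xi>(2) \<eta>(2) by (simp only:)
  then have "H i \<xi> $ j = H j \<eta> $ i" using h by simp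
  then have "\<bar>H i x $ j - H j x $ i\<bar> < \<epsilon> + \<epsilon>"
    using r[OF \<xi>(1)] r[OF \<eta>(1)] by (simp add: dist_real_def abs_less_iff; linarith)
  then show False by (simp add: \<epsilon>_def)
qed

subsection \<open>Compactly supported functions and the divergence theorem\<close>

lemma borel_measurable_vec_nth [measurable (raw)]:
  fixes f :: "'a \<Rightarrow> real ^ 'n"
  assumes [measurable]: "f \<in> borel_measurable M"
  shows "(\<lambda>x. f x $ i) \<in> borel_measurable M"
proof -
  have "(\<lambda>x. f x \<bullet> axis i 1) \<in> borel_measurable M" by measurable
  then show ?thesis by (simp add: inner_axis)
qed

lemma has_real_derivative_integral:
  fixes F :: "real \<Rightarrow> 'a \<Rightarrow> real"
  assumes "\<delta> > 0" and int: "\<And>t. \<bar>t - a\<bar> < \<delta> \<Longrightarrow> integrable M (F t)" and "integrable M w"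
    and deriv: "\<And>x. ((\<lambda>t. F t x) has_real_derivative F' x) (at a)" and meas: "F' \<in> borel_measurable M"
    and lipschitz: "\<And>t x. \<bar>t - a\<bar> < \<delta> \<Longrightarrow> \<bar>F t x - F a x\<bar> \<le> w x * \<bar>t - a\<bar>"
  shows "((\<lambda>t. \<integral>x. F t x \<partial>M) has_real_derivative (\<integral>x. F' x \<partial>M)) (at a)"
  unfolding has_field_derivative_iff tendsto_at_iff_sequentially
proof (intro allI impI)
  fix X :: "nat \<Rightarrow> real"
  assume X: "\<forall>n. X n \<in> UNIV - {a}" "X \<longlonglongrightarrow> a"
  then obtain N where N: "\<And>n. n \<ge> N \<Longrightarrow> \<bar>X n - a\<bar> < \<delta>"
    using \<open>\<delta> > 0\<close> unfolding lim_sequentially dist_real_def by blast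
  define Y where "Y n = X (n + N)" for n
  have Y: "Y n \<noteq> a" "\<bar>Y n - a\<bar> < \<delta>" for n using X N by (auto simp: Y_def)
  have "Y \<longlonglongrightarrow> a" using X(2) unfolding Y_def by (rule LIMSEQ_ignore_initial_segment)
  have "(\<lambda>n. \<integral>x. (F (Y n) x - F a x) / (Y n - a) \<partial>M) \<longlonglongrightarrow> (\<integral>x. F' x \<partial>M)"
  proof (rule integral_dominated_convergence[OF meas _ \<open>integrable M w\<close>])
    show "(\<lambda>x. (F (Y n) x - F a x) / (Y n - a)) \<in> borel_measurable M" for n
      using int[OF Y(2)] int[of a] \<open>\<delta> > 0\<close> by (intro borel_measurable_divide borel_measurable_diff) auto
    have "(\<lambda>n. (F (Y n) x - F a x) / (Y n - a)) \<longlonglongrightarrow> F' x" for x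
      using deriv[of x] \<open>Y \<longlonglongrightarrow> a\<close> Y(1)
      unfolding has_field_derivative_iff tendsto_at_iff_sequentially by (auto simp: o_def)
    then show "AE x in M. (\<lambda>n. (F (Y n) x - F a x) / (Y n - a)) \<longlonglongrightarrow> F' x" by simp
    show "AE x in M. norm ((F (Y n) x - F a x) / (Y n - a)) \<le> w x" for n
      using lipschitz[OF Y(2)] Y(1) by (simp add: abs_divide pos_divide_le_eq)
  qed
  moreover have "(\<integral>x. (F (Y n) x - F a x) / (Y n - a) \<partial>M) = ((\<integral>x. F (Y n) x \<partial>M) - (\<integral>x. F a x \<partial>M)) / (Y n - a)" for n
    using Bochner_Integration.integral_diff[OF int[OF Y(2)] int[of a]] \<open>\<delta> > 0\<close> by simp
  ultimately have "(\<lambda>n. ((\<integral>x. F (X (n + N)) x \<partial>M) - (\<integral>x. F a x \<partial>M)) / (X (n + N) - a)) \<longlonglongrightarrow> (\<integral>x. F' x \<partial>M)"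
    by (simp only: Y_def)
  then show "((\<lambda>t. ((\<integral>x. F t x \<partial>M) - (\<integral>x. F a x \<partial>M)) / (t - a)) \<circ> X) \<longlonglongrightarrow> (\<integral>x. F' x \<partial>M)"
    unfolding o_def by (rule LIMSEQ_offset)
qed

lemma has_bochner_integral_lborel_translate:
  fixes f :: "'a::euclidean_space \<Rightarrow> 'b::{banach, second_countable_topology}"
  assumes "has_bochner_integral lborel f i"
  shows "has_bochner_integral lborel (\<lambda>x. f (a + x)) i"
proof -
  have "integrable (distr lborel borel ((+) a)) f" "integral\<^sup>L (distr lborel borel ((+) a)) f = i"
    using assms by (simp_all add: has_bochner_integral_iff lborel_distr_plus)
  then show ?thesis
    using integrable_distr[of "(+) a" lborel borel f] integral_distr[of "(+) a" lborel borel f] assms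
    by (simp add: has_bochner_integral_iff)
qed

definition C1_test :: "'a::euclidean_space set \<Rightarrow> ('a \<Rightarrow> real) \<Rightarrow> ('a \<Rightarrow> 'a) \<Rightarrow> bool" where
  "C1_test S \<psi> G \<longleftrightarrow> (\<forall>x. GDERIV \<psi> x :> G x) \<and> continuous_on UNIV G \<and>
     (\<exists>K. compact K \<and> K \<subseteq> S \<and> (\<forall>x. x \<notin> K \<longrightarrow> \<psi> x = 0))"

lemma C1_testI:
  assumes "compact K" "K \<subseteq> S" "\<And>x. x \<notin> K \<Longrightarrow> \<psi> x = 0" "\<And>x. GDERIV \<psi> x :> G x" "continuous_on UNIV G"
  shows "C1_test S \<psi> G"
  using assms unfolding C1_test_def by blast

lemma C1_test_GDERIV: "C1_test S \<psi> G \<Longrightarrow> GDERIV \<psi> x :> G x"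
  by (simp add: C1_test_def)

lemma C1_test_continuous_on: "C1_test S \<psi> G \<Longrightarrow> continuous_on A \<psi>"
  by (rule GDERIV_continuous_on[OF C1_test_GDERIV])

lemma C1_test_continuous_on_gradient: "C1_test S \<psi> G \<Longrightarrow> continuous_on A G"
  using continuous_on_subset by (auto simp: C1_test_def)

lemma C1_test_measurable:
  assumes "C1_test S \<psi> G"
  shows "\<psi> \<in> borel_measurable borel" "G \<in> borel_measurable borel"
  using assms C1_test_continuous_on C1_test_continuous_on_gradient
  by (blast intro: borel_measurable_continuous_onI)+

lemma C1_test_mono: "C1_test S \<psi> G \<Longrightarrow> S \<subseteq> T \<Longrightarrow> C1_test T \<psi> G"
  unfolding C1_test_def by blast

lemma C1_test_zero: "C1_test S (\<lambda>x. 0) (\<lambda>x. 0)"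
  by (rule C1_testI[of "{}"]) (auto simp: GDERIV_const)

lemma C1_test_supportE:
  assumes "C1_test S \<psi> G"
  obtains K where "compact K" "K \<subseteq> S" "\<And>x. x \<notin> K \<Longrightarrow> \<psi> x = 0" "\<And>x. x \<notin> K \<Longrightarrow> G x = 0"
proof -
  obtain K where K: "compact K" "K \<subseteq> S" "\<And>x. x \<notin> K \<Longrightarrow> \<psi> x = 0"
    using assms by (auto simp: C1_test_def)
  then have "G x = 0" if "x \<notin> K" for x
    using that C1_test_GDERIV[OF assms] GDERIV_zero_outside_closed[OF compact_imp_closed] GDERIV_unique by metis
  then show ?thesis using K that by blast
qed

lemma C1_test_zero_outside:
  assumes "C1_test S \<psi> G" "x \<notin> S"
  shows "\<psi> x = 0" "G x = 0"
  using C1_test_supportE[OF assms(1)] assms(2) by (metis subsetD)+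

lemma C1_test_gradient_bounded:
  assumes "C1_test S \<psi> G"
  obtains C where "C > 0" "\<And>x. norm (G x) \<le> C"
proof -
  obtain K where K: "compact K" "\<And>x. x \<notin> K \<Longrightarrow> G x = 0" by (rule C1_test_supportE[OF assms]) blast
  obtain C where C: "C \<ge> 0" "\<And>x. x \<in> K \<Longrightarrow> norm (G x) \<le> C"
    by (rule continuous_on_compact_bound[OF K(1) C1_test_continuous_on_gradient[OF assms]]) blast
  have "norm (G x) \<le> C + 1" for x using C(1) C(2)[of x] K(2)[of x] by (cases "x \<in> K") auto
  then show ?thesis using C(1) that[of "C + 1"] by simp
qed

lemma C1_test_extend_zero:
  assumes "open D" "compact K" "K \<subseteq> D" and zero: "\<And>x. x \<notin> K \<Longrightarrow> f x = 0"
    and grad: "\<And>x. x \<in> D \<Longrightarrow> GDERIV f x :> F x" and cont: "continuous_on D F"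
  shows "C1_test D f (\<lambda>x. indicator D x *\<^sub>R F x)"
proof (rule C1_testI[OF assms(2,3) zero])
  let ?G = "\<lambda>x. indicator D x *\<^sub>R F x"
  have "closed K" using assms(2) by (rule compact_imp_closed)
  have outside: "GDERIV f x :> 0" if "x \<notin> K" for x
    using \<open>closed K\<close> zero that by (rule GDERIV_zero_outside_closed)
  show "GDERIV f x :> ?G x" for x
    using grad[of x] outside[of x] assms(3) by (cases "x \<in> D") auto
  have "continuous_on (D \<union> - K) ?G"
  proof (rule continuous_on_open_Un)
    show "continuous_on D ?G" by (rule continuous_on_eq[OF cont]) auto
    have "F x = 0" if "x \<in> D" "x \<notin> K" for x
      using grad[OF that(1)] outside[OF that(2)] by (rule GDERIV_unique)
    then show "continuous_on (- K) ?G"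
      by (intro continuous_on_eq[OF continuous_on_const[of _ 0]]) (auto simp: indicator_def)
  qed (use \<open>open D\<close> \<open>closed K\<close> in auto)
  moreover have "D \<union> - K = UNIV" using assms(3) by auto
  ultimately show "continuous_on UNIV ?G" by simp
qed

lemma C1_test_mult:
  assumes \<psi>: "C1_test D \<psi> G" and "open D"
    and grad: "\<And>x. x \<in> D \<Longrightarrow> GDERIV f x :> F x" and cont: "continuous_on D F"
  shows "C1_test D (\<lambda>x. f x * \<psi> x) (\<lambda>x. indicator D x *\<^sub>R (f x *\<^sub>R G x + \<psi> x *\<^sub>R F x))"
proof -
  obtain K where K: "compact K" "K \<subseteq> D" "\<And>x. x \<notin> K \<Longrightarrow> \<psi> x = 0" by (rule C1_test_supportE[OF \<psi>]) blast
  show ?thesis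
  proof (rule C1_test_extend_zero[OF \<open>open D\<close> K(1,2)])
    show "GDERIV (\<lambda>x. f x * \<psi> x) x :> f x *\<^sub>R G x + \<psi> x *\<^sub>R F x" if "x \<in> D" for x
      by (rule GDERIV_mult[OF grad[OF that] C1_test_GDERIV[OF \<psi>]])
    show "continuous_on D (\<lambda>x. f x *\<^sub>R G x + \<psi> x *\<^sub>R F x)"
      by (intro continuous_intros cont GDERIV_continuous_on[OF grad]
          C1_test_continuous_on[OF \<psi>] C1_test_continuous_on_gradient[OF \<psi>])
  qed (simp add: K)
qed

lemma C1_test_mult_C1:
  assumes \<psi>: "C1_test S \<psi> G" and grad: "\<And>x. GDERIV f x :> F x" and cont: "continuous_on UNIV F"
  shows "C1_test S (\<lambda>x. f x * \<psi> x) (\<lambda>x. f x *\<^sub>R G x + \<psi> x *\<^sub>R F x)"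
proof -
  obtain K where K: "compact K" "K \<subseteq> S" "\<And>x. x \<notin> K \<Longrightarrow> \<psi> x = 0" by (rule C1_test_supportE[OF \<psi>]) blast
  show ?thesis
    by (rule C1_testI[OF K(1,2)])
      (use K(3) in \<open>auto intro!: GDERIV_mult[OF grad C1_test_GDERIV[OF \<psi>]] continuous_intros cont
        GDERIV_continuous_on[OF grad] C1_test_continuous_on[OF \<psi>] C1_test_continuous_on_gradient[OF \<psi>]\<close>)
qed

lemma C1_test_rescale:
  assumes f: "C1_test (cball 0 R) f F" and "r > 0" and "cball c (r * R) \<subseteq> S"
  shows "C1_test S (\<lambda>x. f ((1 / r) *\<^sub>R (x - c))) (\<lambda>x. (1 / r) *\<^sub>R F ((1 / r) *\<^sub>R (x - c)))"
proof (rule C1_testI[OF compact_cball assms(3)])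
  show "f ((1 / r) *\<^sub>R (x - c)) = 0" if "x \<notin> cball c (r * R)" for x
    using that \<open>r > 0\<close>
    by (intro C1_test_zero_outside(1)[OF f])
      (simp add: dist_norm norm_minus_commute[of c] pos_divide_le_eq mult.commute)
  show "GDERIV (\<lambda>x. f ((1 / r) *\<^sub>R (x - c))) x :> (1 / r) *\<^sub>R F ((1 / r) *\<^sub>R (x - c))" for x
    by (rule GDERIV_rescale[OF C1_test_GDERIV[OF f]])
  show "continuous_on UNIV (\<lambda>x. (1 / r) *\<^sub>R F ((1 / r) *\<^sub>R (x - c)))"
    by (intro continuous_intros continuous_on_compose2[OF C1_test_continuous_on_gradient[OF f, of UNIV]]) auto
qed

definition locally_integrable :: "'a::euclidean_space set \<Rightarrow> ('a \<Rightarrow> real) \<Rightarrow> bool" where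
  "locally_integrable S f \<longleftrightarrow> (\<forall>K. compact K \<longrightarrow> K \<subseteq> S \<longrightarrow> set_integrable lborel K f)"

lemma locally_integrableD: "locally_integrable S f \<Longrightarrow> compact K \<Longrightarrow> K \<subseteq> S \<Longrightarrow> set_integrable lborel K f"
  by (simp add: locally_integrable_def)

lemma locally_integrable_has_bochner_integral:
  "locally_integrable S f \<Longrightarrow> compact K \<Longrightarrow> K \<subseteq> S \<Longrightarrow>
    has_bochner_integral lborel (\<lambda>x. indicator K x * f x) (LINT x:K|lborel. f x)"
  using locally_integrableD[of S f K]
  by (simp add: has_bochner_integral_iff set_integrable_def set_lebesgue_integral_def)

lemma locally_integrable_continuous: "continuous_on S f \<Longrightarrow> locally_integrable S f"
  unfolding locally_integrable_def set_integrable_def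
  by (blast intro: borel_integrable_compact continuous_on_subset)

lemma locally_integrable_add:
  "locally_integrable S f \<Longrightarrow> locally_integrable S g \<Longrightarrow> locally_integrable S (\<lambda>x. f x + g x)"
  unfolding locally_integrable_def by (auto intro: set_integral_add)

lemma locally_integrable_diff:
  "locally_integrable S f \<Longrightarrow> locally_integrable S g \<Longrightarrow> locally_integrable S (\<lambda>x. f x - g x)"
  unfolding locally_integrable_def by (auto intro: set_integral_diff)

lemma set_integrable_mult_continuous:
  fixes f h :: "'a::euclidean_space \<Rightarrow> real"
  assumes M: "(\<lambda>x. x) \<in> M \<rightarrow>\<^sub>M borel"
    and f: "set_integrable M K f" and "compact K" and h: "continuous_on K h"
  shows "set_integrable M K (\<lambda>x. f x * h x)"
proof -
  obtain C where C: "C \<ge> 0" "\<And>x. x \<in> K \<Longrightarrow> norm (h x) \<le> C"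
    using continuous_on_compact_bound[OF \<open>compact K\<close> h] by blast
  have "(\<lambda>x. indicator K x *\<^sub>R h x) \<in> borel_measurable borel"
    by (rule borel_measurable_continuous_on_indicator) (use assms in \<open>auto simp: borel_compact\<close>)
  then have meas_h: "(\<lambda>x. indicator K x *\<^sub>R h x) \<in> borel_measurable M"
    using measurable_compose[OF M] by blast
  have "integrable M (\<lambda>x. (indicator K x *\<^sub>R f x) * (indicator K x *\<^sub>R h x))"
  proof (rule Bochner_Integration.integrable_bound)
    show "integrable M (\<lambda>x. C * (indicator K x *\<^sub>R f x))"
      using f by (simp add: set_integrable_def)
    show "(\<lambda>x. (indicator K x *\<^sub>R f x) * (indicator K x *\<^sub>R h x)) \<in> borel_measurable M"
      by (rule borel_measurable_times[OF borel_measurable_integrable[OF f[unfolded set_integrable_def]] meas_h])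
    show "AE x in M. norm ((indicator K x *\<^sub>R f x) * (indicator K x *\<^sub>R h x)) \<le> norm (C * (indicator K x *\<^sub>R f x))"
      using C by (intro AE_I2) (auto simp: indicator_def abs_mult mult.commute[of C] intro: mult_left_mono)
  qed
  moreover have "(\<lambda>x. (indicator K x *\<^sub>R f x) * (indicator K x *\<^sub>R h x)) = (\<lambda>x. indicator K x *\<^sub>R (f x * h x))"
    by (simp add: fun_eq_iff indicator_def)
  ultimately show ?thesis by (simp only: set_integrable_def)
qed

lemma locally_integrable_mult_continuous:
  "locally_integrable S f \<Longrightarrow> continuous_on S h \<Longrightarrow> locally_integrable S (\<lambda>x. f x * h x)"
  unfolding locally_integrable_def
  by (auto intro: set_integrable_mult_continuous continuous_on_subset)

lemma integrable_mult_compact_support: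
  fixes f h :: "'a::euclidean_space \<Rightarrow> real"
  assumes "(\<lambda>x. x) \<in> M \<rightarrow>\<^sub>M borel" "set_integrable M K f" "compact K" "continuous_on K h"
    and zero: "\<And>x. x \<notin> K \<Longrightarrow> h x = 0"
  shows "integrable M (\<lambda>x. f x * h x)"
proof -
  have "set_integrable M K (\<lambda>x. f x * h x)"
    by (rule set_integrable_mult_continuous[OF assms(1-4)])
  moreover have "(\<lambda>x. indicator K x *\<^sub>R (f x * h x)) = (\<lambda>x. f x * h x)"
    using zero by (force simp: indicator_def)
  ultimately show ?thesis by (simp only: set_integrable_def)
qed

lemma integrable_mult_C1_test:
  assumes "locally_integrable S f" and \<psi>: "C1_test S \<psi> G"
  shows "integrable lborel (\<lambda>x. f x * \<psi> x)" "continuous_on S V \<Longrightarrow> integrable lborel (\<lambda>x. f x * (G x \<bullet> V x))"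
proof -
  obtain K where K: "compact K" "K \<subseteq> S" "\<And>x. x \<notin> K \<Longrightarrow> \<psi> x = 0" "\<And>x. x \<notin> K \<Longrightarrow> G x = 0"
    by (rule C1_test_supportE[OF \<psi>]) blast
  have f: "set_integrable lborel K f" by (rule locally_integrableD[OF assms(1) K(1,2)])
  show "integrable lborel (\<lambda>x. f x * \<psi> x)"
    by (rule integrable_mult_compact_support[OF _ f K(1) C1_test_continuous_on[OF \<psi>] K(3)]) simp
  show "integrable lborel (\<lambda>x. f x * (G x \<bullet> V x))" if "continuous_on S V"
    by (rule integrable_mult_compact_support[OF _ f K(1)])
      (use K(4) continuous_on_subset[OF that K(2)] in \<open>auto intro!: continuous_intros C1_test_continuous_on_gradient[OF \<psi>]\<close>)
qed

lemma integrable_mult_C1_test_component: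
  "locally_integrable S f \<Longrightarrow> C1_test S \<psi> G \<Longrightarrow> integrable lborel (\<lambda>x. f x * G x $ i)"
  using integrable_mult_C1_test(2)[of S f \<psi> G "\<lambda>x. axis i 1"] by (simp add: inner_axis)

lemma set_integral_le_weighted_integral:
  fixes f w :: "'a \<Rightarrow> real"
  assumes "set_integrable M A f" "integrable M (\<lambda>x. f x * w x)" and f: "\<And>x. 0 \<le> f x"
    and w: "\<And>x. 0 \<le> w x" "\<And>x. x \<in> A \<Longrightarrow> m \<le> w x"
  shows "m * (LINT x:A|M. f x) \<le> (\<integral>x. f x * w x \<partial>M)"
proof -
  have "m * (indicator A x *\<^sub>R f x) \<le> f x * w x" for x
    using mult_right_mono[OF w(2) f, of x x] by (cases "x \<in> A") (simp_all add: mult.commute f w(1))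
  then have "(\<integral>x. m * (indicator A x *\<^sub>R f x) \<partial>M) \<le> (\<integral>x. f x * w x \<partial>M)"
    using assms(1,2) by (intro integral_mono) (simp_all add: set_integrable_def)
  then show ?thesis by (simp add: set_lebesgue_integral_def)
qed

lemma set_integral_mono_subset:
  fixes f :: "'a \<Rightarrow> real"
  assumes "set_integrable M B f" "A \<in> sets M" "A \<subseteq> B" and f: "\<And>x. 0 \<le> f x"
  shows "(LINT x:A|M. f x) \<le> (LINT x:B|M. f x)"
proof -
  have "set_integrable M A f" using assms(1-3) by (rule set_integrable_subset)
  moreover have "integrable M (\<lambda>x. f x * indicator B x)" using assms(1) by (simp add: set_integrable_def mult.commute)
  ultimately have "1 * (LINT x:A|M. f x) \<le> (\<integral>x. f x * indicator B x \<partial>M)"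
    using assms(3) f by (intro set_integral_le_weighted_integral) auto
  then show ?thesis by (simp add: set_lebesgue_integral_def mult.commute)
qed

lemma weighted_integral_le_set_integral:
  fixes f w :: "'a \<Rightarrow> real"
  assumes "set_integrable M A f" "integrable M (\<lambda>x. f x * w x)" and f: "\<And>x. 0 \<le> f x"
    and w: "\<And>x. x \<in> A \<Longrightarrow> w x \<le> m" "\<And>x. x \<notin> A \<Longrightarrow> w x = 0"
  shows "(\<integral>x. f x * w x \<partial>M) \<le> m * (LINT x:A|M. f x)"
proof -
  have "f x * w x \<le> m * (indicator A x *\<^sub>R f x)" for x
    using mult_right_mono[OF w(1) f, of x x] by (cases "x \<in> A") (simp_all add: mult.commute w(2))
  then have "(\<integral>x. f x * w x \<partial>M) \<le> (\<integral>x. m * (indicator A x *\<^sub>R f x) \<partial>M)"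
    using assms(1,2) by (intro integral_mono) (simp_all add: set_integrable_def)
  then show ?thesis by (simp add: set_lebesgue_integral_def)
qed

lemma C1_test_lipschitz:
  assumes \<psi>: "C1_test S \<psi> G" and C: "\<And>x. norm (G x) \<le> C"
  shows "\<bar>\<psi> x - \<psi> y\<bar> \<le> C * norm (x - y)"
proof -
  have "norm (\<psi> x - \<psi> y) \<le> C * norm (x - y)"
  proof (rule differentiable_bound[of UNIV \<psi> "\<lambda>x h. h \<bullet> G x"])
    show "onorm (\<lambda>h. h \<bullet> G x) \<le> C" for x
      using C[of x] Cauchy_Schwarz_ineq2[of _ "G x"]
      by (intro onorm_le) (metis mult.commute mult_right_mono norm_ge_zero order_trans real_norm_def)
  qed (use C1_test_GDERIV[OF \<psi>] in \<open>auto simp: gderiv_def\<close>)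
  then show ?thesis by simp
qed

text \<open>Differentiate the integral of \<open>\<lambda>x. \<psi> (x + t e)\<close>, which does not depend on \<open>t\<close>.\<close>

lemma has_bochner_integral_gradient:
  assumes \<psi>: "C1_test S \<psi> G"
  shows "has_bochner_integral lborel (\<lambda>x. G x \<bullet> e) 0"
proof -
  obtain K where K: "compact K" "\<And>x. x \<notin> K \<Longrightarrow> \<psi> x = 0" by (rule C1_test_supportE[OF \<psi>]) blast
  obtain C where C: "C > 0" "\<And>x. norm (G x) \<le> C" by (rule C1_test_gradient_bounded[OF \<psi>]) blast
  obtain R where R: "\<And>x. x \<in> K \<Longrightarrow> norm x \<le> R"
    using compact_imp_bounded[OF K(1)] by (auto simp: bounded_iff)
  have one: "locally_integrable S (\<lambda>x. 1)" by (simp add: locally_integrable_continuous)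
  have int: "integrable lborel \<psi>" and int_grad: "integrable lborel (\<lambda>x. G x \<bullet> e)"
    using integrable_mult_C1_test[OF one \<psi>] by simp_all
  have shift: "has_bochner_integral lborel (\<lambda>x. \<psi> (t *\<^sub>R e + x)) (\<integral>x. \<psi> x \<partial>lborel)" for t
    by (rule has_bochner_integral_lborel_translate[OF has_bochner_integral_integrable[OF int]])
  let ?B = "cball 0 (R + norm e) :: 'a set"
  have "((\<lambda>t. \<integral>x. \<psi> (t *\<^sub>R e + x) \<partial>lborel) has_real_derivative (\<integral>x. G x \<bullet> e \<partial>lborel)) (at 0)"
  proof (rule has_real_derivative_integral[of 1])
    show "integrable lborel (\<lambda>x. \<psi> (t *\<^sub>R e + x))" for t using shift by (simp add: has_bochner_integral_iff)
    show "integrable lborel (\<lambda>x. C * norm e * indicator ?B x)"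
      using emeasure_bounded_finite[OF bounded_cball, of "0::'a" "R + norm e"]
      by (intro integrable_mult_right integrable_real_indicator) (auto simp: less_top)
    show "((\<lambda>t. \<psi> (t *\<^sub>R e + x)) has_real_derivative G x \<bullet> e) (at 0)" for x
      using GDERIV_imp_DERIV_line[of \<psi> x 0 e "G x"] C1_test_GDERIV[OF \<psi>] by (simp add: add.commute)
    fix t x assume t: "\<bar>t - 0\<bar> < (1::real)"
    show "\<bar>\<psi> (t *\<^sub>R e + x) - \<psi> (0 *\<^sub>R e + x)\<bar> \<le> C * norm e * indicator ?B x * \<bar>t - 0\<bar>"
    proof (cases "x \<in> ?B")
      case True
      then show ?thesis using C1_test_lipschitz[OF \<psi> C(2), of "t *\<^sub>R e + x" x] by (simp add: mult_ac)
    next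
      case False
      have "norm x \<le> norm (t *\<^sub>R e + x) + norm (t *\<^sub>R e)"
        using norm_triangle_ineq4[of "t *\<^sub>R e + x" "t *\<^sub>R e"] by simp
      moreover have "norm (t *\<^sub>R e) \<le> norm e" using t by (simp add: mult_left_le_one_le)
      ultimately have "x \<notin> K" "t *\<^sub>R e + x \<notin> K"
        using False norm_ge_zero[of e] R[of x] R[of "t *\<^sub>R e + x"] by (auto simp del: norm_ge_zero)
      then show ?thesis using False by (simp add: K(2))
    qed
  qed (use C1_test_measurable[OF \<psi>] in auto)
  moreover have "(\<lambda>t. \<integral>x. \<psi> (t *\<^sub>R e + x) \<partial>lborel) = (\<lambda>t. \<integral>x. \<psi> x \<partial>lborel)"
    using shift by (auto simp: has_bochner_integral_iff)
  ultimately have "(\<integral>x. G x \<bullet> e \<partial>lborel) = 0" using DERIV_unique by (metis DERIV_const)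
  then show ?thesis using int_grad by (simp add: has_bochner_integral_iff)
qed

subsection \<open>Test functions and the fundamental lemma\<close>

lemma has_real_derivative_extend_zero:
  fixes f :: "real \<Rightarrow> real"
  assumes zero: "\<And>t. t \<le> a \<Longrightarrow> f t = 0" "\<And>t. t \<le> a \<Longrightarrow> f' t = 0"
    and deriv: "\<And>t. t > a \<Longrightarrow> (f has_real_derivative f' t) (at t)"
    and quadratic: "\<And>t. a < t \<Longrightarrow> t < a + 1 \<Longrightarrow> \<bar>f t\<bar> \<le> C * (t - a)\<^sup>2"
  shows "(f has_real_derivative f' t) (at t)"
proof -
  consider (below) "t < a" | (at) "t = a" | (above) "t > a" by linarith
  then show ?thesis
  proof cases
    case below
    have "((\<lambda>t. 0) has_real_derivative 0) (at t)" by simp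
    then have "(f has_real_derivative 0) (at t)"
      by (rule has_field_derivative_transform_within_open[where S="{..<a}"]) (use below zero in auto)
    then show ?thesis using below zero(2) by simp
  next
    case at
    have "\<forall>\<^sub>F s in at a. norm (f s / (s - a)) \<le> \<bar>C\<bar> * \<bar>s - a\<bar>"
      unfolding eventually_at
    proof (intro exI[of _ 1] conjI ballI impI)
      fix s assume s: "s \<noteq> a \<and> dist s a < 1"
      have "\<bar>f s\<bar> \<le> \<bar>C\<bar> * \<bar>s - a\<bar> * \<bar>s - a\<bar>"
      proof (cases "s < a")
        case False
        then have "\<bar>f s\<bar> \<le> C * (s - a)\<^sup>2" using s by (intro quadratic) (auto simp: dist_real_def)
        also have "\<dots> \<le> \<bar>C\<bar> * (s - a)\<^sup>2" by (intro mult_right_mono) auto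
        finally show ?thesis by (simp add: power2_eq_square)
      qed (simp add: zero)
      then show "norm (f s / (s - a)) \<le> \<bar>C\<bar> * \<bar>s - a\<bar>"
        using s by (simp add: abs_divide pos_divide_le_eq)
    qed simp
    moreover have "((\<lambda>s. \<bar>C\<bar> * \<bar>s - a\<bar>) \<longlongrightarrow> 0) (at a)"
      by (rule tendsto_eq_intros refl | simp)+
    ultimately have "((\<lambda>s. f s / (s - a)) \<longlongrightarrow> 0) (at a)"
      by (rule Lim_null_comparison)
    then show ?thesis using at by (simp add: has_field_derivative_iff zero)
  next
    case above
    then show ?thesis by (rule deriv)
  qed
qed

definition flat_exp :: "nat \<Rightarrow> real \<Rightarrow> real" where
  "flat_exp n t = (if t \<le> 0 then 0 else exp (- (1 / t)) / t ^ n)"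

lemma flat_exp_le_square: "\<bar>flat_exp n t\<bar> \<le> real (n + 2) ^ (n + 2) * t\<^sup>2"
proof (cases "t \<le> 0")
  case False
  define m where "m = n + 2"
  have pos: "t > 0" "m > 0" using False by (auto simp: m_def)
  have "1 / (t * m) \<le> exp (1 / (t * m))"
    using exp_ge_add_one_self[of "1 / (t * m)"] by linarith
  then have "(1 / (t * m)) ^ m \<le> exp (1 / (t * m)) ^ m"
    using pos by (intro power_mono) auto
  also have "\<dots> = exp (1 / t)"
    using pos by (simp add: exp_of_nat_mult[symmetric])
  finally have "exp (- (1 / t)) \<le> (t * m) ^ m"
    using pos by (simp add: exp_minus field_simps)
  then have "exp (- (1 / t)) / t ^ n \<le> (t * m) ^ m / t ^ n"
    using pos by (intro divide_right_mono) auto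
  also have "\<dots> = real m ^ m * t\<^sup>2"
    unfolding m_def power_mult_distrib power_add using pos by simp
  finally show ?thesis using pos by (simp add: flat_exp_def m_def abs_of_pos)
qed (simp add: flat_exp_def)

lemma DERIV_flat_exp: "(flat_exp n has_real_derivative flat_exp (n + 2) t - n * flat_exp (n + 1) t) (at t)"
proof (rule has_real_derivative_extend_zero[where a=0 and f="flat_exp n"
      and f'="\<lambda>t. flat_exp (n + 2) t - n * flat_exp (n + 1) t" and C="real (n + 2) ^ (n + 2)"])
  show "\<bar>flat_exp n t\<bar> \<le> real (n + 2) ^ (n + 2) * (t - 0)\<^sup>2" for t
    using flat_exp_le_square[of n t] by (simp only: diff_zero)
  fix t :: real assume t: "t > 0"
  define q where "q = 1 / t"
  have flat: "flat_exp k t = exp (- q) * q ^ k" for k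
    using t by (simp add: flat_exp_def q_def power_divide)
  have "((\<lambda>t. 1 / t) has_real_derivative - (q * q)) (at t)"
    using t by (auto intro!: derivative_eq_intros simp: q_def)
  moreover have "((\<lambda>q. exp (- q) * q ^ n) has_real_derivative
      - exp (- q) * q ^ n + exp (- q) * (n * q ^ (n - 1))) (at q)"
    by (auto intro!: derivative_eq_intros)
  ultimately have "((\<lambda>t. exp (- (1 / t)) * (1 / t) ^ n) has_real_derivative
      (- exp (- q) * q ^ n + exp (- q) * (n * q ^ (n - 1))) * - (q * q)) (at t)"
    by (intro DERIV_chain2[where f="\<lambda>q. exp (- q) * q ^ n" and g="\<lambda>t. 1 / t"]) (simp_all add: q_def)
  moreover have "(- exp (- q) * q ^ n + exp (- q) * (n * q ^ (n - 1))) * - (q * q)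
      = flat_exp (n + 2) t - n * flat_exp (n + 1) t"
    unfolding flat by (cases n) (simp_all add: algebra_simps power2_eq_square)
  ultimately have "((\<lambda>t. exp (- (1 / t)) / t ^ n) has_real_derivative
      flat_exp (n + 2) t - n * flat_exp (n + 1) t) (at t)"
    by (simp add: power_divide)
  then show "(flat_exp n has_real_derivative flat_exp (n + 2) t - n * flat_exp (n + 1) t) (at t)"
    by (rule has_field_derivative_transform_within_open[where S="{0<..}"]) (use t in \<open>auto simp: flat_exp_def\<close>)
qed (simp_all add: flat_exp_def)

lemma flat_exp_bounds: "0 \<le> flat_exp 0 t" "flat_exp 0 t \<le> 1"
  by (auto simp: flat_exp_def)

lemma flat_exp_tendsto_1:
  assumes "t > 0"
  shows "(\<lambda>m. flat_exp 0 (real (Suc m) * t)) \<longlonglongrightarrow> 1"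
proof -
  have "(\<lambda>m. exp (- (inverse (real (Suc m)) * (1 / t)))) \<longlonglongrightarrow> exp (- (0 * (1 / t)))"
    by (intro tendsto_intros LIMSEQ_inverse_real_of_nat)
  moreover have "flat_exp 0 (real (Suc m) * t) = exp (- (inverse (real (Suc m)) * (1 / t)))" for m
    using assms by (simp add: flat_exp_def mult_le_0_iff field_simps del: of_nat_Suc)
  ultimately show ?thesis by simp
qed

lemma Ck_on_flat_exp: "Ck_on k S f \<Longrightarrow> Ck_on k S (\<lambda>x. flat_exp n (f x))"
proof (induction k arbitrary: n)
  case 0
  have "continuous_on UNIV (flat_exp n)"
    by (rule DERIV_continuous_on[OF has_field_derivative_at_within[OF DERIV_flat_exp]])
  then show ?case using 0 by (auto intro: continuous_on_compose2)
next
  case (Suc k)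
  have "Ck_on k S f" using Suc.prems by (rule Ck_on_Suc_imp)
  then show ?case
    by (intro Ck_on_Suc_compose[OF Suc.prems DERIV_flat_exp] Ck_on_diff Ck_on_mult Ck_on_const Suc.IH)
qed

definition box_bump :: "real ^ 'n \<Rightarrow> real ^ 'n \<Rightarrow> nat \<Rightarrow> real ^ 'n \<Rightarrow> real" where
  "box_bump a b m x = (\<Prod>i\<in>UNIV. flat_exp 0 (Suc m * (x $ i - a $ i)) * flat_exp 0 (Suc m * (b $ i - x $ i)))"

lemma box_bump_zero: "x \<notin> box a b \<Longrightarrow> box_bump a b m x = 0"
  unfolding box_bump_def mem_box_cart
  by (auto simp: not_less flat_exp_def mult_le_0_iff intro!: prod_zero)

lemma box_bump_bounds: "0 \<le> box_bump a b m x" "box_bump a b m x \<le> 1"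
  unfolding box_bump_def
  by (auto intro!: prod_nonneg prod_le_1 mult_nonneg_nonneg mult_le_one simp: flat_exp_bounds)

lemma box_bump_tendsto_indicator:
  fixes x :: "real ^ 'n"
  shows "(\<lambda>m. box_bump a b m x) \<longlonglongrightarrow> indicator (box a b) x"
proof (cases "x \<in> box a b")
  case True
  then have factors: "(\<lambda>m. flat_exp 0 (Suc m * (x $ i - a $ i)) * flat_exp 0 (Suc m * (b $ i - x $ i))) \<longlonglongrightarrow> 1 * 1" for i
    by (intro tendsto_mult flat_exp_tendsto_1) (simp_all add: mem_box_cart)
  have "(\<lambda>m. box_bump a b m x) \<longlonglongrightarrow> (\<Prod>i\<in>(UNIV :: 'n set). 1 * 1)"
    unfolding box_bump_def by (intro tendsto_prod factors)
  then show ?thesis using True by simp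
qed (simp add: box_bump_zero)

lemma compact_supp_in_iff:
  "compact_supp_in S f \<longleftrightarrow> (\<exists>K. compact K \<and> K \<subseteq> S \<and> (\<forall>x. x \<notin> K \<longrightarrow> f x = 0))"
proof
  assume "compact_supp_in S f"
  then show "\<exists>K. compact K \<and> K \<subseteq> S \<and> (\<forall>x. x \<notin> K \<longrightarrow> f x = 0)"
    unfolding compact_supp_in_def using closure_subset[of "{x. f x \<noteq> 0}"] by blast
next
  assume "\<exists>K. compact K \<and> K \<subseteq> S \<and> (\<forall>x. x \<notin> K \<longrightarrow> f x = 0)"
  then obtain K where K: "compact K" "K \<subseteq> S" "{x. f x \<noteq> 0} \<subseteq> K" by blast
  then have "closure {x. f x \<noteq> 0} \<subseteq> K" by (simp add: closure_minimal compact_imp_closed)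
  moreover from this have "compact (closure {x. f x \<noteq> 0})"
    using compact_Int_closed[OF K(1) closed_closure, of "{x. f x \<noteq> 0}"] by (simp add: Int_absorb1)
  ultimately show "compact_supp_in S f"
    unfolding compact_supp_in_def using K(2) by blast
qed

lemma ex_C1_test_iff: "(\<exists>G. C1_test S \<psi> G) \<longleftrightarrow> Ck_on 1 UNIV \<psi> \<and> compact_supp_in S \<psi>"
proof
  assume "\<exists>G. C1_test S \<psi> G"
  then obtain G where G: "C1_test S \<psi> G" by blast
  have "Ck_on (Suc 0) UNIV \<psi>"
    by (rule Ck_on_SucI[OF C1_test_GDERIV[OF G]])
      (auto intro!: continuous_intros C1_test_continuous_on_gradient[OF G])
  then show "Ck_on 1 UNIV \<psi> \<and> compact_supp_in S \<psi>"
    using G by (auto simp: compact_supp_in_iff C1_test_def)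
next
  assume \<psi>: "Ck_on 1 UNIV \<psi> \<and> compact_supp_in S \<psi>"
  then obtain G where "\<And>x. GDERIV \<psi> x :> G x" "\<And>i. continuous_on UNIV (\<lambda>x. G x $ i)"
    using Ck_on_SucE[of 0 UNIV \<psi>] by auto
  then show "\<exists>G. C1_test S \<psi> G"
    using \<psi> continuous_on_componentwise[of UNIV G] by (auto simp: compact_supp_in_iff C1_test_def)
qed

lemma test_fun_imp_C1_test: "test_fun S \<psi> \<Longrightarrow> \<exists>G. C1_test S \<psi> G"
  unfolding ex_C1_test_iff test_fun_def Cinf_on_def by blast

lemma frechet_derivative_C1_test:
  assumes "C1_test S \<psi> G"
  shows "frechet_derivative \<psi> (at x) h = G x \<bullet> h"
proof -
  have "frechet_derivative \<psi> (at x) = (\<lambda>h. h \<bullet> G x)"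
    using C1_test_GDERIV[OF assms] frechet_derivative_at unfolding gderiv_def by metis
  then show ?thesis by (simp add: inner_commute)
qed

lemma Ck_on_box_bump: "Ck_on k S (box_bump a b m)"
  unfolding box_bump_def[abs_def]
  by (intro Ck_on_prod Ck_on_mult Ck_on_flat_exp Ck_on_diff Ck_on_component Ck_on_const) simp

lemma test_fun_box_bump:
  assumes "cbox a b \<subseteq> S"
  shows "test_fun S (box_bump a b m)"
proof -
  have "Cinf_on UNIV (box_bump a b m)" by (simp add: Cinf_on_def Ck_on_box_bump)
  moreover have "compact_supp_in S (box_bump a b m)"
    unfolding compact_supp_in_iff
    using assms box_subset_cbox[of a b] by (intro exI[of _ "cbox a b"]) (auto intro: box_bump_zero)
  ultimately show ?thesis by (simp add: test_fun_def)
qed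

lemma set_lebesgue_integral_box_eq_0:
  fixes w :: "pt \<Rightarrow> real"
  assumes w: "set_integrable lebesgue (cbox a b) w"
    and zero: "\<And>m. (\<integral>x. w x * box_bump a b m x \<partial>lebesgue) = 0"
  shows "(LINT x:box a b|lebesgue. w x) = 0"
proof -
  let ?v = "\<lambda>x. indicator (cbox a b) x *\<^sub>R w x"
  have int: "integrable lebesgue ?v" using w by (simp add: set_integrable_def)
  have v_eq: "?v x * box_bump a b m x = w x * box_bump a b m x"
    "?v x * indicator (box a b) x = indicator (box a b) x *\<^sub>R w x" for m x
    using box_subset_cbox[of a b] box_bump_zero[of x a b m] by (auto simp: indicator_def)
  have "(\<lambda>m. \<integral>x. ?v x * box_bump a b m x \<partial>lebesgue) \<longlonglongrightarrow> (\<integral>x. ?v x * indicator (box a b) x \<partial>lebesgue)"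
  proof (rule integral_dominated_convergence[where w="\<lambda>x. \<bar>?v x\<bar>"])
    have "continuous_on UNIV (box_bump a b m)" for m
      using Ck_on_box_bump[of 0 UNIV a b m] by simp
    then have "box_bump a b m \<in> borel_measurable lborel" for m
      by (simp add: borel_measurable_continuous_onI)
    then have "box_bump a b m \<in> borel_measurable lebesgue" for m
      by (rule measurable_completion)
    then show "(\<lambda>x. ?v x * box_bump a b m x) \<in> borel_measurable lebesgue" for m
      using int by (intro borel_measurable_times) auto
    show "(\<lambda>x. ?v x * indicator (box a b) x) \<in> borel_measurable lebesgue"
      using int by (intro borel_measurable_times borel_measurable_indicator) auto
    show "AE x in lebesgue. norm (?v x * box_bump a b m x) \<le> \<bar>?v x\<bar>" for m
      using box_bump_bounds[of a b m] by (intro AE_I2) (auto simp: abs_mult intro!: mult_right_le_one_le)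
    show "integrable lebesgue (\<lambda>x. \<bar>?v x\<bar>)" using int by (rule integrable_abs)
  qed (intro AE_I2 tendsto_mult tendsto_const box_bump_tendsto_indicator)
  then show ?thesis
    unfolding v_eq zero by (simp add: LIMSEQ_const_iff set_lebesgue_integral_def)
qed

lemma AE_eq_0_if_box_integrals_eq_0:
  fixes f :: "'a::euclidean_space \<Rightarrow> real"
  assumes f: "integrable lborel f" and zero: "\<And>a b. (LINT x:box a b|lborel. f x) = 0"
  shows "AE x in lborel. f x = 0"
proof -
  have [measurable]: "f \<in> borel_measurable borel" using f by simp
  have density_box: "emeasure (density lborel (\<lambda>x. ennreal (f x))) (box a b)
      = emeasure (density lborel (\<lambda>x. ennreal (- f x))) (box a b)"
    "emeasure (density lborel (\<lambda>x. ennreal (f x))) (box a b) \<noteq> \<infinity>" for a b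
  proof -
    let ?f = "\<lambda>x. indicator (box a b) x *\<^sub>R f x"
    have int: "integrable lborel ?f" by (rule integrable_mult_indicator[OF _ f]) simp
    have dens: "emeasure (density lborel (\<lambda>x. ennreal (s * f x))) (box a b) = (\<integral>\<^sup>+x. ennreal (s * ?f x) \<partial>lborel)" for s
      by (subst emeasure_density) (auto intro!: nn_integral_cong simp: indicator_def)
    have fin: "(\<integral>\<^sup>+x. ennreal (?f x) \<partial>lborel) \<noteq> \<infinity>" "(\<integral>\<^sup>+x. ennreal (- ?f x) \<partial>lborel) \<noteq> \<infinity>"
      using int unfolding real_integrable_def by auto
    have "enn2real (\<integral>\<^sup>+x. ennreal (?f x) \<partial>lborel) = enn2real (\<integral>\<^sup>+x. ennreal (- ?f x) \<partial>lborel)"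
      using real_lebesgue_integral_def[OF int] zero[of a b] by (simp add: set_lebesgue_integral_def)
    then have "(\<integral>\<^sup>+x. ennreal (?f x) \<partial>lborel) = (\<integral>\<^sup>+x. ennreal (- ?f x) \<partial>lborel)"
      using fin by (cases "\<integral>\<^sup>+x. ennreal (?f x) \<partial>lborel"; cases "\<integral>\<^sup>+x. ennreal (- ?f x) \<partial>lborel") auto
    then show "emeasure (density lborel (\<lambda>x. ennreal (f x))) (box a b)
        = emeasure (density lborel (\<lambda>x. ennreal (- f x))) (box a b)"
      "emeasure (density lborel (\<lambda>x. ennreal (f x))) (box a b) \<noteq> \<infinity>"
      using dens[of 1] dens[of "-1"] fin by simp_all
  qed
  have "density lborel (\<lambda>x. ennreal (f x)) = density lborel (\<lambda>x. ennreal (- f x))"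
  proof (rule measure_eqI_generator_eq[where E="range (\<lambda>(a, b). box a b)" and \<Omega>=UNIV
        and A="\<lambda>n. box (- (real n *\<^sub>R One)) (real n *\<^sub>R One)"])
    show "Int_stable (range (\<lambda>(a, b). box a b) :: 'a set set)"
      by (auto simp: Int_stable_def box_Int_box)
    show "(\<Union>n. box (- (real n *\<^sub>R One)) (real n *\<^sub>R One) :: 'a set) = UNIV" by (rule UN_box_eq_UNIV)
  qed (use density_box in \<open>auto simp: borel_eq_box\<close>)
  then have "AE x in lborel. ennreal (f x) = ennreal (- f x)"
    by (intro sigma_finite_measure.density_unique[OF sigma_finite_lborel]) auto
  then show ?thesis
    by eventually_elim (metis ennreal_eq_0_iff ennreal_neg linear neg_le_0_iff_le order_antisym)
qed

lemma AE_eq_0_if_lebesgue_box_integrals_eq_0: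
  fixes f :: "'a::euclidean_space \<Rightarrow> real"
  assumes int: "integrable lebesgue f" and zero: "\<And>a b. (LINT x:box a b|lebesgue. f x) = 0"
  shows "AE x in lborel. f x = 0"
proof -
  obtain v where [measurable]: "v \<in> borel_measurable borel" and v: "AE x in lborel. f x = v x"
    using completion_ex_borel_measurable_real[OF borel_measurable_integrable[OF int]] by auto
  have AE_v: "AE x in lebesgue. f x = v x" using v by (rule AE_completion)
  have "AE x in lborel. v x = 0"
  proof (rule AE_eq_0_if_box_integrals_eq_0)
    have "v \<in> borel_measurable lborel" by simp
    then show "integrable lborel v"
      using int integrable_cong_AE[OF _ _ AE_v] by (simp add: integrable_completion measurable_completion)
    fix a b
    have "(LINT x:box a b|lborel. v x) = (LINT x:box a b|lebesgue. v x)"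
      unfolding set_lebesgue_integral_def by (rule integral_completion[symmetric]) measurable
    also have "\<dots> = (LINT x:box a b|lebesgue. f x)"
      unfolding set_lebesgue_integral_def
    proof (rule integral_cong_AE)
      show "(\<lambda>x. indicator (box a b) x *\<^sub>R v x) \<in> borel_measurable lebesgue"
        by (rule measurable_completion) measurable
      show "(\<lambda>x. indicator (box a b) x *\<^sub>R f x) \<in> borel_measurable lebesgue"
        by (rule borel_measurable_integrable[OF integrable_mult_indicator[OF _ int]]) simp
    qed (use AE_v in \<open>auto elim!: eventually_mono\<close>)
    finally show "(LINT x:box a b|lborel. v x) = 0" unfolding zero .
  qed
  then show ?thesis using v by eventually_elim simp
qed

lemma fundamental_lemma_box:
  fixes w :: "pt \<Rightarrow> real"
  assumes w: "\<And>K. compact K \<Longrightarrow> K \<subseteq> S \<Longrightarrow> set_integrable lebesgue K w"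
    and zero: "\<And>\<psi>. test_fun S \<psi> \<Longrightarrow> (\<integral>x. w x * \<psi> x \<partial>lebesgue) = 0"
    and sub: "cbox c d \<subseteq> S"
  shows "AE x in lborel. x \<in> box c d \<longrightarrow> w x = 0"
proof -
  let ?v = "\<lambda>x. indicator (box c d) x *\<^sub>R w x"
  have "set_integrable lebesgue (box c d) w"
    by (rule set_integrable_subset[OF w[OF compact_cbox sub]]) (auto simp: box_subset_cbox)
  then have "integrable lebesgue ?v" by (simp add: set_integrable_def)
  moreover have "(LINT x:box a b|lebesgue. ?v x) = 0" for a b
  proof -
    obtain e f where ef: "box a b \<inter> box c d = box e f" using box_Int_box[of a b c d] by blast
    have "(LINT x:box e f|lebesgue. w x) = 0"
    proof (cases "box e f = {}")
      case False
      then have "cbox e f = closure (box e f)" by (simp add: closure_box)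
      also have "\<dots> \<subseteq> cbox c d" by (rule closure_minimal) (use ef box_subset_cbox in auto)
      finally have "cbox e f \<subseteq> S" using sub by blast
      then show ?thesis
        by (intro set_lebesgue_integral_box_eq_0 w zero test_fun_box_bump compact_cbox)
    qed (simp add: set_lebesgue_integral_def)
    moreover have "indicator (box e f) x *\<^sub>R w x = indicator (box a b) x *\<^sub>R ?v x" for x
      unfolding ef[symmetric] by (auto simp: indicator_def)
    ultimately show ?thesis by (simp only: set_lebesgue_integral_def)
  qed
  ultimately have "AE x in lborel. ?v x = 0" by (rule AE_eq_0_if_lebesgue_box_integrals_eq_0)
  then show ?thesis by eventually_elim (auto split: split_indicator_asm)
qed

lemma fundamental_lemma:
  fixes w :: "pt \<Rightarrow> real"
  assumes "open S"
    and w: "\<And>K. compact K \<Longrightarrow> K \<subseteq> S \<Longrightarrow> set_integrable lebesgue K w"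
    and zero: "\<And>\<psi>. test_fun S \<psi> \<Longrightarrow> (\<integral>x. w x * \<psi> x \<partial>lebesgue) = 0"
  shows "AE x in lborel. x \<in> S \<longrightarrow> w x = 0"
proof -
  obtain \<D> where \<D>: "countable \<D>" "\<D> \<subseteq> Pow S" "\<And>X. X \<in> \<D> \<Longrightarrow> \<exists>a b. X = cbox a b" "\<Union>\<D> = S"
    using open_countable_Union_open_cbox[OF \<open>open S\<close>] by metis
  have "AE x in lborel. \<forall>X\<in>\<D>. x \<in> X \<longrightarrow> w x = 0"
    unfolding AE_ball_countable[OF \<D>(1)]
  proof
    fix X assume "X \<in> \<D>"
    then obtain a b where X: "X = cbox a b" "cbox a b \<subseteq> S" using \<D>(2,3) by blast
    have "AE x in lebesgue. x \<notin> cbox a b - box a b"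
      using negligible_frontier_interval[of a b] by (intro AE_not_in) (simp add: negligible_iff_null_sets)
    then have "AE x in lborel. x \<notin> cbox a b - box a b" by (simp add: AE_completion_iff)
    moreover have "AE x in lborel. x \<in> box a b \<longrightarrow> w x = 0"
      by (rule fundamental_lemma_box[OF w zero X(2)])
    ultimately show "AE x in lborel. x \<in> X \<longrightarrow> w x = 0"
      unfolding X(1) by eventually_elim auto
  qed
  then show ?thesis using \<D>(4) by (auto elim: eventually_mono)
qed

lemma set_lebesgue_integral_eq_lborel:
  fixes f f' :: "'a::euclidean_space \<Rightarrow> real"
  assumes [measurable]: "f' \<in> borel_measurable borel" "A \<in> sets borel"
    and AE: "AE x in lborel. x \<in> A \<longrightarrow> f x = f' x"
  shows "(LINT x:A|lebesgue. f x) = (LINT x:A|lborel. f' x)"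
    and "set_integrable lebesgue A f \<longleftrightarrow> set_integrable lborel A f'"
proof -
  have AE_eq: "AE x in lebesgue. indicator A x *\<^sub>R f' x = indicator A x *\<^sub>R f x"
    by (rule AE_completion) (use AE in eventually_elim, auto simp: indicator_def)
  have lborel: "(\<lambda>x. indicator A x *\<^sub>R f' x) \<in> borel_measurable lborel" by measurable
  have meas: "(\<lambda>x. indicator A x *\<^sub>R f' x) \<in> borel_measurable lebesgue"
    using lborel by (rule measurable_completion)
  then have meas': "(\<lambda>x. indicator A x *\<^sub>R f x) \<in> borel_measurable lebesgue"
    using AE_eq by (rule borel_measurable_AE)
  show "(LINT x:A|lebesgue. f x) = (LINT x:A|lborel. f' x)"
    unfolding set_lebesgue_integral_def integral_cong_AE[OF meas meas' AE_eq, symmetric]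
    by (rule integral_completion[OF lborel])
  show "set_integrable lebesgue A f \<longleftrightarrow> set_integrable lborel A f'"
    unfolding set_integrable_def integrable_cong_AE[OF meas meas' AE_eq, symmetric]
    by (rule integrable_completion[OF lborel])
qed

lemma continuous_AE_zero_imp_zero:
  fixes f :: "'a::euclidean_space \<Rightarrow> real"
  assumes "open S" "continuous_on S f" "AE x in lborel. x \<in> S \<longrightarrow> f x = 0" "x \<in> S"
  shows "f x = 0"
proof (rule ccontr)
  assume "f x \<noteq> 0"
  let ?N = "S \<inter> f -` (- {0})"
  have "open ?N" using continuous_open_preimage[OF assms(2,1), of "- {0}"] by auto
  then have "?N \<in> sets lborel" by simp
  moreover have "AE x in lborel. x \<notin> ?N" using assms(3) by eventually_elim auto
  ultimately have "?N \<in> null_sets lborel" by (simp add: AE_iff_null_sets)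
  then have "negligible ?N" using negligible_iff_null_sets null_sets_completionI by blast
  moreover have "x \<in> ?N" using assms(4) \<open>f x \<noteq> 0\<close> by simp
  ultimately show False using open_not_negligible[OF \<open>open ?N\<close>] by blast
qed

subsection \<open>The divergence theorem on positivity sets\<close>

text \<open>\<open>DV i\<close> is the gradient of the \<open>i\<close>-th component of a vector field.\<close>

definition divergence :: "('n::finite \<Rightarrow> real ^ 'n \<Rightarrow> real ^ 'n) \<Rightarrow> real ^ 'n \<Rightarrow> real" where
  "divergence DV x = (\<Sum>i\<in>UNIV. DV i x $ i)"

lemma has_bochner_integral_divergence_test:
  fixes V :: "real ^ 'n \<Rightarrow> real ^ 'n"
  assumes \<psi>: "C1_test D \<psi> G" and "open D"
    and grad: "\<And>i x. x \<in> D \<Longrightarrow> GDERIV (\<lambda>x. V x $ i) x :> DV i x" and cont: "\<And>i. continuous_on D (DV i)"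
  shows "has_bochner_integral lborel (\<lambda>x. indicator D x * (\<psi> x * divergence DV x + G x \<bullet> V x)) 0"
proof -
  have "has_bochner_integral lborel
      (\<lambda>x. \<Sum>i\<in>UNIV. (indicator D x *\<^sub>R (V x $ i *\<^sub>R G x + \<psi> x *\<^sub>R DV i x)) \<bullet> axis i 1) (\<Sum>i\<in>(UNIV :: 'n set). 0)"
    by (rule has_bochner_integral_sum,
        rule has_bochner_integral_gradient[OF C1_test_mult[OF \<psi> \<open>open D\<close> grad cont]])
  moreover have "(\<Sum>i\<in>UNIV. (indicator D x *\<^sub>R (V x $ i *\<^sub>R G x + \<psi> x *\<^sub>R DV i x)) \<bullet> axis i 1)
      = indicator D x * (\<psi> x * divergence DV x + G x \<bullet> V x)" for x
    by (cases "x \<in> D") (simp_all add: divergence_def inner_vec_def[of "G x"] inner_axis sum.distrib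
        sum_distrib_left mult.commute add.commute)
  ultimately show ?thesis by simp
qed

definition truncate :: "real \<Rightarrow> real \<Rightarrow> real" where
  "truncate e t = (if t \<le> e then 0 else (t - e)\<^sup>2 / t)"

definition truncate' :: "real \<Rightarrow> real \<Rightarrow> real" where
  "truncate' e t = (if t \<le> e then 0 else 1 - (e / t)\<^sup>2)"

lemma DERIV_truncate:
  assumes "e > 0"
  shows "(truncate e has_real_derivative truncate' e t) (at t)"
proof (rule has_real_derivative_extend_zero[where a=e and C="1 / e"])
  fix t assume t: "e < t"
  have "((\<lambda>t. (t - e)\<^sup>2 / t) has_real_derivative 1 - (e / t)\<^sup>2) (at t)"
    using t assms by (auto intro!: derivative_eq_intros simp: field_simps power2_eq_square)
  then have "(truncate e has_real_derivative 1 - (e / t)\<^sup>2) (at t)"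
    by (rule has_field_derivative_transform_within_open[where S="{e<..}"]) (use t in \<open>auto simp: truncate_def\<close>)
  then show "(truncate e has_real_derivative truncate' e t) (at t)" using t by (simp add: truncate'_def)
  show "\<bar>truncate e t\<bar> \<le> 1 / e * (t - e)\<^sup>2"
    using t assms by (simp add: truncate_def frac_le abs_of_pos)
qed (simp_all add: truncate_def truncate'_def)

lemma continuous_on_truncate':
  assumes "e > 0"
  shows "continuous_on UNIV (truncate' e)"
proof -
  have "continuous_on ({..e} \<union> {e..}) (\<lambda>t. if t \<le> e then 0 else 1 - (e / t)\<^sup>2)"
    by (rule continuous_on_If) (use assms in \<open>auto intro!: continuous_intros\<close>)
  moreover have "{..e} \<union> {e..} = (UNIV :: real set)" by auto
  ultimately show ?thesis by (simp add: truncate'_def[abs_def])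
qed

lemma truncate_bounds:
  assumes "e > 0" "t > 0"
  shows "\<bar>truncate e t\<bar> \<le> t" "\<bar>truncate' e t\<bar> \<le> 1"
proof -
  show "\<bar>truncate e t\<bar> \<le> t"
  proof (cases "t \<le> e")
    case False
    have "(t - e) * (t - e) \<le> t * t" using False assms by (intro mult_mono) auto
    then show ?thesis using False assms by (simp add: truncate_def pos_divide_le_eq power2_eq_square)
  qed (use assms in \<open>simp add: truncate_def\<close>)
  show "\<bar>truncate' e t\<bar> \<le> 1" using assms by (auto simp: truncate'_def power_le_one)
qed

lemma truncate_tendsto:
  assumes "t > 0"
  shows "(\<lambda>n. truncate (inverse (real (Suc n))) t) \<longlonglongrightarrow> t" "(\<lambda>n. truncate' (inverse (real (Suc n))) t) \<longlonglongrightarrow> 1"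
proof -
  let ?e = "\<lambda>n. inverse (real (Suc n))"
  have ev: "\<forall>\<^sub>F n in sequentially. ?e n < t"
    using LIMSEQ_inverse_real_of_nat assms by (rule order_tendstoD(2))
  have "(\<lambda>n. (t - ?e n)\<^sup>2 / t) \<longlonglongrightarrow> (t - 0)\<^sup>2 / t" "(\<lambda>n. 1 - (?e n / t)\<^sup>2) \<longlonglongrightarrow> 1 - (0 / t)\<^sup>2"
    using assms by (intro tendsto_intros LIMSEQ_inverse_real_of_nat; simp)+
  moreover have "(t - 0)\<^sup>2 / t = t" "1 - (0 / t)\<^sup>2 = 1" using assms by (simp_all add: power2_eq_square)
  ultimately show "(\<lambda>n. truncate (?e n) t) \<longlonglongrightarrow> t" "(\<lambda>n. truncate' (?e n) t) \<longlonglongrightarrow> 1"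
    by (force intro: Lim_transform_eventually eventually_mono[OF ev] simp: truncate_def truncate'_def)+
qed

lemma C1_test_truncate:
  fixes w :: "'a::euclidean_space \<Rightarrow> real"
  assumes "open D" and D: "D = {x \<in> S. w x > 0}" and w: "continuous_on S w"
    and grad: "\<And>x. x \<in> D \<Longrightarrow> GDERIV w x :> W x" "continuous_on D W"
    and \<psi>: "C1_test S \<psi> G" and "e > 0"
  shows "C1_test D (\<lambda>x. truncate e (w x) * \<psi> x)
    (\<lambda>x. indicator D x *\<^sub>R (truncate e (w x) *\<^sub>R G x + \<psi> x *\<^sub>R truncate' e (w x) *\<^sub>R W x))"
proof -
  obtain K where K: "compact K" "K \<subseteq> S" "\<And>x. x \<notin> K \<Longrightarrow> \<psi> x = 0" by (rule C1_test_supportE[OF \<psi>]) blast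
  define L where "L = K \<inter> (K \<inter> w -` {e..})"
  have "closed (K \<inter> w -` {e..})"
    by (rule continuous_closed_preimage[OF continuous_on_subset[OF w K(2)] compact_imp_closed[OF K(1)]]) simp
  then have "compact L" unfolding L_def using K(1) by (rule compact_Int_closed[rotated])
  show ?thesis
  proof (rule C1_test_extend_zero[OF \<open>open D\<close> \<open>compact L\<close>])
    show "L \<subseteq> D" using \<open>e > 0\<close> K(2) by (auto simp: L_def D)
    show "truncate e (w x) * \<psi> x = 0" if "x \<notin> L" for x
      using that K(3)[of x] by (cases "x \<in> K") (auto simp: L_def truncate_def)
    show "GDERIV (\<lambda>x. truncate e (w x) * \<psi> x) x :> truncate e (w x) *\<^sub>R G x + \<psi> x *\<^sub>R truncate' e (w x) *\<^sub>R W x"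
      if "x \<in> D" for x
      by (intro GDERIV_mult GDERIV_DERIV_compose grad that DERIV_truncate \<open>e > 0\<close> C1_test_GDERIV[OF \<psi>])
    have cont_w: "continuous_on D w" using w by (rule continuous_on_subset) (auto simp: D)
    have "continuous_on UNIV (truncate e)"
      by (rule DERIV_continuous_on[OF has_field_derivative_at_within[OF DERIV_truncate[OF \<open>e > 0\<close>]]])
    then have "continuous_on D (\<lambda>x. truncate e (w x))" "continuous_on D (\<lambda>x. truncate' e (w x))"
      using continuous_on_truncate'[OF \<open>e > 0\<close>] cont_w by (auto intro: continuous_on_compose2)
    then show "continuous_on D (\<lambda>x. truncate e (w x) *\<^sub>R G x + \<psi> x *\<^sub>R truncate' e (w x) *\<^sub>R W x)"
      by (intro continuous_intros grad(2) C1_test_continuous_on[OF \<psi>] C1_test_continuous_on_gradient[OF \<psi>])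
  qed
qed

lemma integral_truncation_limit:
  assumes pos: "\<And>x. x \<in> D \<Longrightarrow> w x > 0"
    and trunc: "\<And>e. e > 0 \<Longrightarrow> has_bochner_integral M
        (\<lambda>x. indicator D x * (truncate' e (w x) * a x + truncate e (w x) * b x)) 0"
    and a: "integrable M (\<lambda>x. indicator D x * a x)" and b: "integrable M (\<lambda>x. indicator D x * (w x * b x))"
  shows "has_bochner_integral M (\<lambda>x. indicator D x * (a x + w x * b x)) 0"
proof -
  let ?e = "\<lambda>n. inverse (real (Suc n))"
  let ?f = "\<lambda>n x. indicator D x * (truncate' (?e n) (w x) * a x + truncate (?e n) (w x) * b x)"
  have int: "integrable M (\<lambda>x. indicator D x * (a x + w x * b x))"
    using Bochner_Integration.integrable_add[OF a b] by (simp add: distrib_left)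
  have "(\<lambda>n. \<integral>x. ?f n x \<partial>M) \<longlonglongrightarrow> (\<integral>x. indicator D x * (a x + w x * b x) \<partial>M)"
  proof (rule integral_dominated_convergence[where w="\<lambda>x. \<bar>indicator D x * a x\<bar> + \<bar>indicator D x * (w x * b x)\<bar>"])
    show "?f n \<in> borel_measurable M" for n
      by (rule borel_measurable_has_bochner_integral[OF trunc]) simp
    have "(\<lambda>n. ?f n x) \<longlonglongrightarrow> indicator D x * (a x + w x * b x)" for x
    proof (cases "x \<in> D")
      case True
      have "(\<lambda>n. ?f n x) \<longlonglongrightarrow> 1 * (1 * a x + w x * b x)"
        using True by (intro tendsto_intros truncate_tendsto pos) auto
      then show ?thesis using True by simp
    qed simp
    then show "AE x in M. (\<lambda>n. ?f n x) \<longlonglongrightarrow> indicator D x * (a x + w x * b x)" by simp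
    have "norm (?f n x) \<le> \<bar>indicator D x * a x\<bar> + \<bar>indicator D x * (w x * b x)\<bar>" for n x
    proof (cases "x \<in> D")
      case True
      have "\<bar>truncate' (?e n) (w x)\<bar> * \<bar>a x\<bar> \<le> 1 * \<bar>a x\<bar>" "\<bar>truncate (?e n) (w x)\<bar> * \<bar>b x\<bar> \<le> \<bar>w x\<bar> * \<bar>b x\<bar>"
        using truncate_bounds[of "?e n" "w x"] pos[OF True] by (intro mult_right_mono; simp)+
      then show ?thesis
        using True abs_triangle_ineq[of "truncate' (?e n) (w x) * a x" "truncate (?e n) (w x) * b x"]
        by (simp add: abs_mult)
    qed simp
    then show "AE x in M. norm (?f n x) \<le> \<bar>indicator D x * a x\<bar> + \<bar>indicator D x * (w x * b x)\<bar>" for n by simp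
  qed (use int a b in auto)
  moreover have "(\<integral>x. ?f n x \<partial>M) = 0" for n by (rule has_bochner_integral_integral_eq[OF trunc]) simp
  ultimately show ?thesis using int by (simp add: has_bochner_integral_iff LIMSEQ_const_iff)
qed

text \<open>There is no boundary term: \<open>w\<close> vanishes on the part of the boundary of \<open>D\<close> that lies in \<open>S\<close>. The
  truncations of \<open>w\<close> vanish near it, so nothing is required of \<open>w\<close> there.\<close>

lemma has_bochner_integral_divergence_positivity_set:
  fixes w :: "real ^ 'n \<Rightarrow> real"
  assumes "open D" and D: "D = {x \<in> S. w x > 0}" and w: "continuous_on S w"
    and grad_w: "\<And>x. x \<in> D \<Longrightarrow> GDERIV w x :> W x" "continuous_on D W"
    and \<psi>: "C1_test S \<psi> G"
    and grad_V: "\<And>i x. x \<in> D \<Longrightarrow> GDERIV (\<lambda>x. V x $ i) x :> DV i x" "\<And>i. continuous_on D (DV i)"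
    and int: "integrable lborel (\<lambda>x. indicator D x * (\<psi> x * (W x \<bullet> V x)))"
      "integrable lborel (\<lambda>x. indicator D x * (w x * (\<psi> x * divergence DV x + G x \<bullet> V x)))"
  shows "has_bochner_integral lborel
    (\<lambda>x. indicator D x * (\<psi> x * (W x \<bullet> V x) + w x * (\<psi> x * divergence DV x + G x \<bullet> V x))) 0"
proof (rule integral_truncation_limit[OF _ _ int])
  show "w x > 0" if "x \<in> D" for x using that D by simp
  fix e :: real assume "e > 0"
  have "has_bochner_integral lborel (\<lambda>x. indicator D x * (truncate e (w x) * \<psi> x * divergence DV x
      + (indicator D x *\<^sub>R (truncate e (w x) *\<^sub>R G x + \<psi> x *\<^sub>R truncate' e (w x) *\<^sub>R W x)) \<bullet> V x)) 0"
    by (rule has_bochner_integral_divergence_test[OF C1_test_truncate[OF assms(1-6) \<open>e > 0\<close>] \<open>open D\<close> grad_V])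
  moreover have "indicator D x * (truncate e (w x) * \<psi> x * divergence DV x
      + (indicator D x *\<^sub>R (truncate e (w x) *\<^sub>R G x + \<psi> x *\<^sub>R truncate' e (w x) *\<^sub>R W x)) \<bullet> V x)
    = indicator D x * (truncate' e (w x) * (\<psi> x * (W x \<bullet> V x))
        + truncate e (w x) * (\<psi> x * divergence DV x + G x \<bullet> V x))" for x
    by (cases "x \<in> D") (simp_all add: inner_add_left algebra_simps)
  ultimately show "has_bochner_integral lborel (\<lambda>x. indicator D x *
      (truncate' e (w x) * (\<psi> x * (W x \<bullet> V x)) + truncate e (w x) * (\<psi> x * divergence DV x + G x \<bullet> V x))) 0"
    by (simp only:)
qed

subsection \<open>The gradient of a variational solution\<close>

lemma power2_norm_pt: "(norm y)\<^sup>2 = (y $ 1)\<^sup>2 + (y $ 2)\<^sup>2" for y :: pt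
  by (simp add: norm_vec_def L2_set_def sum_2)

lemma inner_pt: "x \<bullet> y = x $ 1 * y $ 1 + x $ 2 * y $ 2" for x y :: pt
  by (simp add: inner_vec_def sum_2)

context
  fixes S :: "pt set" and \<phi> :: "pt \<Rightarrow> pt" and G :: "2 \<Rightarrow> pt \<Rightarrow> pt"
  assumes \<phi>: "\<And>i. C1_test S (\<lambda>x. \<phi> x $ i) (G i)"
begin

lemma Dfield_nth: "Dfield \<phi> x h $ i = G i x \<bullet> h"
proof -
  have "(\<phi> has_derivative (\<lambda>h. \<chi> i. G i x \<bullet> h)) (at x)"
    unfolding has_derivative_componentwise_within[of \<phi>] using C1_test_GDERIV[OF \<phi>]
    by (auto simp: Basis_vec_def inner_axis GDERIV_iff_has_derivative)
  from frechet_derivative_at[OF this, symmetric] show ?thesis by (simp add: Dfield_def)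
qed

lemma divg_eq_divergence: "divg \<phi> x = divergence G x"
  by (simp add: divg_def divergence_def Dfield_nth inner_axis)

lemma C1_0_field_if_C1_test: "C1_0_field S \<phi>"
proof -
  have "\<forall>i. \<exists>K. compact K \<and> K \<subseteq> S \<and> (\<forall>x. x \<notin> K \<longrightarrow> \<phi> x $ i = 0)"
    using \<phi> unfolding C1_test_def by blast
  then obtain K where "\<And>i. compact (K i)" "\<And>i. K i \<subseteq> S" "\<And>i x. x \<notin> K i \<Longrightarrow> \<phi> x $ i = 0" by metis
  then have "compact_supp_in S \<phi>"
    unfolding compact_supp_in_iff by (intro exI[of _ "\<Union>i. K i"]) (auto simp: vec_eq_iff)
  moreover have "Ck_on 1 UNIV (\<lambda>x. \<phi> x $ i)" for i using \<phi> ex_C1_test_iff by blast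
  ultimately show ?thesis by (simp add: C1_0_field_def)
qed

end

locale free_boundary_solution =
  fixes \<Omega> :: "pt set" and u :: "pt \<Rightarrow> real" and g :: "pt \<Rightarrow> pt"
  assumes open_domain: "open \<Omega>" and solution: "variational_solution \<Omega> u g"
begin

definition fluid :: "pt set" where
  "fluid = {x \<in> \<Omega>. u x > 0}"

definition air :: "pt set" where
  "air = {x \<in> \<Omega>. x $ 2 > 0 \<and> u x = 0}"

text \<open>The values of \<open>u\<close> and \<open>g\<close> outside \<open>\<Omega>\<close> are arbitrary, and \<open>g\<close> is determined only almost everywhere.
  From here on \<open>u\<close> is replaced by its extension by zero and \<open>g\<close> by the classical gradient.\<close>

definition u_ext :: "pt \<Rightarrow> real" where
  "u_ext x = indicator \<Omega> x * u x"

definition grad :: "pt \<Rightarrow> pt" where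
  "grad x = indicator fluid x *\<^sub>R gradient u x"

definition energy_density :: "pt \<Rightarrow> real" where
  "energy_density x = (norm (grad x))\<^sup>2"

definition hess :: "2 \<Rightarrow> pt \<Rightarrow> pt" where
  "hess i = gradient (\<lambda>x. grad x $ i)"

lemma u_continuous_on: "continuous_on \<Omega> u" and u_nonneg: "x \<in> \<Omega> \<Longrightarrow> u x \<ge> 0"
  and u_zero_below: "x \<in> \<Omega> \<Longrightarrow> x $ 2 \<le> 0 \<Longrightarrow> u x = 0"
  using solution by (auto simp: variational_solution_def)

lemma u_ext_continuous_on: "continuous_on \<Omega> u_ext"
  by (rule continuous_on_eq[OF u_continuous_on]) (simp add: u_ext_def)

lemma fluid_eq_u_ext: "fluid = {x \<in> \<Omega>. u_ext x > 0}"
  by (auto simp: fluid_def u_ext_def)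

lemma fluid_subset: "fluid \<subseteq> \<Omega>"
  by (auto simp: fluid_def)

lemma fluid_above: "x \<in> fluid \<Longrightarrow> x $ 2 > 0"
  using u_zero_below by (force simp: fluid_def)

lemma air_eq: "air = {x \<in> \<Omega>. x $ 2 > 0} - fluid"
  using u_nonneg by (force simp: air_def fluid_def)

lemma open_fluid: "open fluid"
proof -
  have "fluid = \<Omega> \<inter> u -` {0<..}" by (auto simp: fluid_def)
  then show ?thesis using continuous_open_preimage[OF u_continuous_on open_domain, of "{0<..}"] by simp
qed

lemma u_ext_off_fluid: "x \<notin> fluid \<Longrightarrow> u_ext x = 0"
  using u_nonneg[of x] by (cases "x \<in> \<Omega>") (auto simp: fluid_def u_ext_def)

lemma grad_off_fluid: "x \<notin> fluid \<Longrightarrow> grad x = 0"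
  by (simp add: grad_def)

lemma GDERIV_u_ext: "x \<in> fluid \<Longrightarrow> GDERIV u_ext x :> grad x"
  and Ck_on_grad: "Ck_on 1 fluid (\<lambda>x. grad x $ i)"
proof -
  have "\<Omega> \<inter> {x. u x > 0} = fluid" by (auto simp: fluid_def)
  then have u: "Ck_on (Suc 1) fluid u"
    using solution by (simp add: variational_solution_def numeral_2_eq_2)
  show "Ck_on 1 fluid (\<lambda>x. grad x $ i)"
    by (rule Ck_on_cong_open[OF Ck_on_gradient(2)[OF u open_fluid] open_fluid]) (simp add: grad_def)
  show "GDERIV u_ext x :> grad x" if "x \<in> fluid"
  proof (rule GDERIV_transform_open[OF _ open_fluid that])
    show "GDERIV u x :> grad x" using Ck_on_gradient(1)[OF u open_fluid that] that by (simp add: grad_def)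
  qed (use fluid_subset in \<open>auto simp: u_ext_def indicator_def\<close>)
qed

lemma GDERIV_grad: "x \<in> fluid \<Longrightarrow> GDERIV (\<lambda>x. grad x $ i) x :> hess i x"
  and hess_continuous_on: "continuous_on fluid (hess i)"
proof -
  have "Ck_on (Suc 0) fluid (\<lambda>x. grad x $ i)" using Ck_on_grad[of i] by simp
  note Ck_on_gradient[OF this open_fluid]
  then show "x \<in> fluid \<Longrightarrow> GDERIV (\<lambda>x. grad x $ i) x :> hess i x" "continuous_on fluid (hess i)"
    by (auto simp: hess_def intro: continuous_on_componentwise)
qed

lemma grad_continuous_on: "continuous_on fluid grad"
  by (rule continuous_on_componentwise) (rule GDERIV_continuous_on[OF GDERIV_grad])

lemma hess_symmetric: "x \<in> fluid \<Longrightarrow> hess i x $ j = hess j x $ i"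
  by (rule mixed_partials_commute[OF open_fluid _ GDERIV_u_ext GDERIV_grad hess_continuous_on])

lemma fluid_measurable [measurable]: "fluid \<in> sets borel"
  and domain_measurable [measurable]: "\<Omega> \<in> sets borel"
  using open_fluid open_domain by simp_all

lemma air_measurable [measurable]: "air \<in> sets borel"
proof -
  have "air = (\<Omega> \<inter> {x. x $ 2 > 0}) - fluid" unfolding air_eq by auto
  also have "\<dots> \<in> sets borel" by measurable
  finally show ?thesis .
qed

lemma u_ext_measurable [measurable]: "u_ext \<in> borel_measurable borel"
  using borel_measurable_continuous_on_indicator[OF domain_measurable u_continuous_on]
  by (simp add: u_ext_def[abs_def])

lemma grad_measurable [measurable]: "grad \<in> borel_measurable borel"
proof -
  have "(\<lambda>x. indicator fluid x *\<^sub>R grad x) = grad" by (simp add: fun_eq_iff grad_def indicator_def)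
  then show ?thesis
    using borel_measurable_continuous_on_indicator[OF fluid_measurable grad_continuous_on] by simp
qed

lemma fluid_divergence_theorem:
  assumes \<psi>: "C1_test \<Omega> \<psi> G"
    and V: "\<And>i x. x \<in> fluid \<Longrightarrow> GDERIV (\<lambda>x. V x $ i) x :> DV i x" "\<And>i. continuous_on fluid (DV i)"
    and int: "integrable lborel (\<lambda>x. \<psi> x * (grad x \<bullet> V x))"
      "integrable lborel (\<lambda>x. u_ext x * (\<psi> x * divergence DV x + G x \<bullet> V x))"
  shows "has_bochner_integral lborel
    (\<lambda>x. \<psi> x * (grad x \<bullet> V x) + u_ext x * (\<psi> x * divergence DV x + G x \<bullet> V x)) 0"
proof -
  have supp: "indicator fluid x * (\<psi> x * (grad x \<bullet> V x)) = \<psi> x * (grad x \<bullet> V x)"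
    "indicator fluid x * (u_ext x * b) = u_ext x * b" for x b
    by (cases "x \<in> fluid"; simp add: grad_off_fluid u_ext_off_fluid)+
  have "has_bochner_integral lborel (\<lambda>x. indicator fluid x *
      (\<psi> x * (grad x \<bullet> V x) + u_ext x * (\<psi> x * divergence DV x + G x \<bullet> V x))) 0"
    by (rule has_bochner_integral_divergence_positivity_set[OF open_fluid fluid_eq_u_ext
          u_ext_continuous_on GDERIV_u_ext grad_continuous_on \<psi> V]) (simp_all only: supp int)
  then show ?thesis by (simp only: distrib_left supp)
qed

lemma u_ext_by_parts:
  assumes \<psi>: "C1_test \<Omega> \<psi> G" and int: "integrable lborel (\<lambda>x. \<psi> x * grad x $ i)"
  shows "has_bochner_integral lborel (\<lambda>x. \<psi> x * grad x $ i + u_ext x * G x $ i) 0"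
proof -
  have div: "divergence (\<lambda>j x. 0) x = 0" for x :: pt by (simp add: divergence_def)
  have "has_bochner_integral lborel (\<lambda>x. \<psi> x * (grad x \<bullet> axis i 1)
      + u_ext x * (\<psi> x * divergence (\<lambda>j x. 0) x + G x \<bullet> axis i 1)) 0"
  proof (rule fluid_divergence_theorem[OF \<psi>])
    show "integrable lborel (\<lambda>x. u_ext x * (\<psi> x * divergence (\<lambda>j x. 0) x + G x \<bullet> axis i 1))"
      using integrable_mult_C1_test(2)[OF locally_integrable_continuous[OF u_ext_continuous_on] \<psi>]
      by (simp add: div)
  qed (use int in \<open>simp_all add: GDERIV_const inner_axis\<close>)
  then show ?thesis by (simp add: div inner_axis)
qed

lemma g_set_integrable:
  assumes "compact K" "K \<subseteq> \<Omega>"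
  shows "set_integrable lebesgue K (\<lambda>x. g x $ i)" "set_integrable lebesgue K (\<lambda>x. (norm (g x))\<^sup>2)"
  using solution assms by (auto simp: variational_solution_def W12_loc_def)

lemma g_weak_gradient:
  assumes "test_fun \<Omega> \<psi>" and \<psi>: "C1_test \<Omega> \<psi> G"
  shows "(\<integral>x. g x $ i * \<psi> x \<partial>lebesgue) = - (\<integral>x. u_ext x * G x $ i \<partial>lborel)"
proof -
  note [measurable] = C1_test_measurable[OF \<psi>]
  have "(\<integral>x. g x $ i * \<psi> x \<partial>lebesgue) = (LINT x:\<Omega>|lebesgue. g x $ i * \<psi> x)"
    unfolding set_lebesgue_integral_def
    by (rule Bochner_Integration.integral_cong) (auto simp: indicator_def C1_test_zero_outside[OF \<psi>])
  also have "\<dots> = - (LINT x:\<Omega>|lebesgue. u x * frechet_derivative \<psi> (at x) (axis i 1))"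
    using solution assms(1) by (simp add: variational_solution_def W12_loc_def weak_gradient_def)
  also have "(LINT x:\<Omega>|lebesgue. u x * frechet_derivative \<psi> (at x) (axis i 1))
      = (LINT x:\<Omega>|lborel. u_ext x * G x $ i)"
  proof (rule set_lebesgue_integral_eq_lborel(1))
    show "AE x in lborel. x \<in> \<Omega> \<longrightarrow> u x * frechet_derivative \<psi> (at x) (axis i 1) = u_ext x * G x $ i"
      by (simp add: frechet_derivative_C1_test[OF \<psi>] u_ext_def inner_axis)
  qed measurable
  also have "\<dots> = (\<integral>x. u_ext x * G x $ i \<partial>lborel)"
    unfolding set_lebesgue_integral_def
    by (rule Bochner_Integration.integral_cong) (auto simp: indicator_def u_ext_def)
  finally show ?thesis .
qed

lemma AE_g_eq_grad_on:
  assumes "open S" "S \<subseteq> \<Omega>" and loc: "\<And>i. locally_integrable S (\<lambda>x. grad x $ i)"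
  shows "AE x in lborel. x \<in> S \<longrightarrow> g x = grad x"
proof -
  have "AE x in lborel. x \<in> S \<longrightarrow> g x $ i - grad x $ i = 0" for i
  proof (rule fundamental_lemma[OF \<open>open S\<close>])
    show int: "set_integrable lebesgue K (\<lambda>x. g x $ i - grad x $ i)" if "compact K" "K \<subseteq> S" for K
    proof (rule set_integral_diff)
      show "set_integrable lebesgue K (\<lambda>x. g x $ i)" using that assms(2) by (intro g_set_integrable) auto
      show "set_integrable lebesgue K (\<lambda>x. grad x $ i)"
        using locally_integrableD[OF loc that] that
        by (subst set_lebesgue_integral_eq_lborel(2)[of "\<lambda>x. grad x $ i"]) (auto simp: borel_compact)
    qed
    fix \<psi> assume t: "test_fun S \<psi>"
    then obtain G where G: "C1_test S \<psi> G" using test_fun_imp_C1_test by blast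
    then obtain K where K: "compact K" "K \<subseteq> S" "\<And>x. x \<notin> K \<Longrightarrow> \<psi> x = 0" by (rule C1_test_supportE) blast
    have t\<Omega>: "test_fun \<Omega> \<psi>" using t assms(2) by (auto simp: test_fun_def compact_supp_in_def)
    have G\<Omega>: "C1_test \<Omega> \<psi> G" by (rule C1_test_mono[OF G assms(2)])
    have int_grad: "integrable lborel (\<lambda>x. grad x $ i * \<psi> x)" by (rule integrable_mult_C1_test(1)[OF loc G])
    have int_u: "integrable lborel (\<lambda>x. u_ext x * G x $ i)"
      by (rule integrable_mult_C1_test_component[OF locally_integrable_continuous[OF u_ext_continuous_on] G\<Omega>])
    have "(\<integral>x. grad x $ i * \<psi> x + u_ext x * G x $ i \<partial>lborel) = 0"
      using has_bochner_integral_integral_eq[OF u_ext_by_parts[OF G\<Omega>]] int_grad by (simp add: mult.commute)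
    then have "(\<integral>x. g x $ i * \<psi> x \<partial>lebesgue) = (\<integral>x. grad x $ i * \<psi> x \<partial>lborel)"
      using g_weak_gradient[OF t\<Omega> G\<Omega>, of i] int_grad int_u by simp
    moreover have meas: "(\<lambda>x. grad x $ i * \<psi> x) \<in> borel_measurable lborel"
      using int_grad by (rule borel_measurable_integrable)
    moreover have "integrable lebesgue (\<lambda>x. g x $ i * \<psi> x)"
      by (rule integrable_mult_compact_support[OF _ g_set_integrable(1)[OF K(1)] K(1) C1_test_continuous_on[OF G] K(3)])
        (use K(2) assms(2) in \<open>auto intro!: measurable_completion\<close>)
    ultimately show "(\<integral>x. (g x $ i - grad x $ i) * \<psi> x \<partial>lebesgue) = 0"
      using int_grad by (simp add: left_diff_distrib integral_completion[OF meas] integrable_completion[OF meas])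
  qed
  then have "AE x in lborel. \<forall>i. x \<in> S \<longrightarrow> g x $ i - grad x $ i = 0"
    unfolding AE_all_countable by blast
  then show ?thesis by eventually_elim (simp add: vec_eq_iff)
qed

lemma grad_locally_integrable: "locally_integrable \<Omega> (\<lambda>x. grad x $ i)"
  and energy_density_locally_integrable: "locally_integrable \<Omega> energy_density"
proof -
  have "locally_integrable fluid (\<lambda>x. grad x $ i)" for i
    by (intro locally_integrable_continuous continuous_intros grad_continuous_on)
  then have "AE x in lborel. x \<in> fluid \<longrightarrow> g x = grad x"
    by (rule AE_g_eq_grad_on[OF open_fluid fluid_subset])
  then have AE: "AE x in lebesgue. x \<in> fluid \<longrightarrow> g x = grad x" by (rule AE_completion)
  have transfer: "set_integrable lborel K (\<lambda>x. f (grad x))"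
    if "compact K" "set_integrable lebesgue K (\<lambda>x. f (g x))" "f 0 = 0" and [measurable]: "f \<in> borel_measurable borel"
    for K and f :: "pt \<Rightarrow> real"
  proof -
    have [measurable]: "K \<in> sets borel" using that(1) by (simp add: borel_compact)
    have "set_borel_measurable lborel K (\<lambda>x. f (grad x))"
      unfolding set_borel_measurable_def by measurable
    then have "set_borel_measurable lebesgue K (\<lambda>x. f (grad x))"
      unfolding set_borel_measurable_def by (rule measurable_completion)
    then have "set_integrable lebesgue K (\<lambda>x. f (grad x))"
    proof (rule set_integrable_bound[OF that(2)])
      have "norm (f (grad x)) \<le> norm (f (g x))" if "x \<in> fluid \<longrightarrow> g x = grad x" for x
        using that \<open>f 0 = 0\<close> by (cases "x \<in> fluid") (auto simp: grad_off_fluid)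
      then show "AE x in lebesgue. x \<in> K \<longrightarrow> norm (f (grad x)) \<le> norm (f (g x))"
        using AE by (auto elim: eventually_mono)
    qed
    then show ?thesis
      by (subst (asm) set_lebesgue_integral_eq_lborel(2)[of "\<lambda>x. f (grad x)"]) auto
  qed
  show "locally_integrable \<Omega> (\<lambda>x. grad x $ i)"
    unfolding locally_integrable_def
    using g_set_integrable(1) by (auto intro!: transfer[of _ "\<lambda>y. y $ i"])
  show "locally_integrable \<Omega> energy_density"
    unfolding locally_integrable_def energy_density_def[abs_def]
    using g_set_integrable(2) by (auto intro!: transfer[of _ "\<lambda>y. (norm y)\<^sup>2"])
qed

lemma AE_g_eq_grad: "AE x in lborel. x \<in> \<Omega> \<longrightarrow> g x = grad x"
  by (rule AE_g_eq_grad_on[OF open_domain order_refl grad_locally_integrable])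

lemma u_ext_square_locally_integrable: "locally_integrable \<Omega> (\<lambda>x. (u_ext x)\<^sup>2)"
  by (intro locally_integrable_continuous continuous_intros u_ext_continuous_on)

lemma u_ext_grad_locally_integrable: "locally_integrable \<Omega> (\<lambda>x. u_ext x * grad x $ i)"
  using locally_integrable_mult_continuous[OF grad_locally_integrable u_ext_continuous_on]
  by (simp add: mult.commute)

lemma grad_grad_locally_integrable: "locally_integrable \<Omega> (\<lambda>x. grad x $ i * grad x $ j)"
  unfolding locally_integrable_def
proof (intro allI impI)
  fix K assume K: "compact K" "K \<subseteq> \<Omega>"
  note [measurable] = borel_compact[OF K(1)]
  show "set_integrable lborel K (\<lambda>x. grad x $ i * grad x $ j)"
  proof (rule set_integrable_bound[OF locally_integrableD[OF energy_density_locally_integrable K]])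
    show "set_borel_measurable lborel K (\<lambda>x. grad x $ i * grad x $ j)"
      unfolding set_borel_measurable_def by measurable
    have "\<bar>grad x $ i * grad x $ j\<bar> \<le> energy_density x" for x
      unfolding energy_density_def power2_eq_square abs_mult by (intro mult_mono component_le_norm_cart) auto
    then show "AE x in lborel. x \<in> K \<longrightarrow> norm (grad x $ i * grad x $ j) \<le> norm (energy_density x)"
      by (auto intro: order_trans[OF _ abs_ge_self])
  qed
qed

lemma u_ext_square_by_parts:
  assumes \<psi>: "C1_test \<Omega> \<psi> G"
  shows "has_bochner_integral lborel (\<lambda>x. (u_ext x)\<^sup>2 * G x $ i + 2 * (u_ext x * grad x $ i * \<psi> x)) 0"
proof -
  define DV where "DV j x = axis i 1 $ j *\<^sub>R grad x" for j x
  have div: "divergence DV x = grad x $ i" for x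
    by (simp add: divergence_def DV_def axis_def if_distrib[of "\<lambda>a. a * _"] sum.delta cong: if_cong)
  have int_cross: "integrable lborel (\<lambda>x. u_ext x * grad x $ i * \<psi> x)"
    by (rule integrable_mult_C1_test(1)[OF u_ext_grad_locally_integrable \<psi>])
  have int_square: "integrable lborel (\<lambda>x. (u_ext x)\<^sup>2 * G x $ i)"
    by (rule integrable_mult_C1_test_component[OF u_ext_square_locally_integrable \<psi>])
  have "has_bochner_integral lborel (\<lambda>x. \<psi> x * (grad x \<bullet> (u_ext x *\<^sub>R axis i 1))
      + u_ext x * (\<psi> x * divergence DV x + G x \<bullet> (u_ext x *\<^sub>R axis i 1))) 0"
  proof (rule fluid_divergence_theorem[OF \<psi>])
    show "GDERIV (\<lambda>x. (u_ext x *\<^sub>R axis i 1) $ j) x :> DV j x" if "x \<in> fluid" for j x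
      using GDERIV_mult[OF GDERIV_u_ext[OF that] GDERIV_const[of "axis i 1 $ j"]] by (simp add: DV_def)
    show "continuous_on fluid (DV j)" for j
      unfolding DV_def by (intro continuous_intros grad_continuous_on)
    show "integrable lborel (\<lambda>x. \<psi> x * (grad x \<bullet> (u_ext x *\<^sub>R axis i 1)))"
      using int_cross by (simp add: inner_axis mult_ac)
    show "integrable lborel (\<lambda>x. u_ext x * (\<psi> x * divergence DV x + G x \<bullet> (u_ext x *\<^sub>R axis i 1)))"
      using Bochner_Integration.integrable_add[OF int_cross int_square]
      by (simp add: div inner_axis power2_eq_square algebra_simps)
  qed
  then show ?thesis by (simp add: div inner_axis power2_eq_square algebra_simps)
qed

subsection \<open>The stress identity and harmonicity\<close>

definition stress :: "(2 \<Rightarrow> pt \<Rightarrow> pt) \<Rightarrow> pt \<Rightarrow> real" where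
  "stress G x = energy_density x * divergence G x - 2 * (\<Sum>i\<in>UNIV. grad x $ i * (G i x \<bullet> grad x))"

lemma stress_integrable:
  assumes \<phi>: "\<And>i. C1_test \<Omega> (\<phi> i) (G i)"
  shows "integrable lborel (stress G)"
proof -
  have "integrable lborel (\<lambda>x. \<Sum>i\<in>UNIV. energy_density x * G i x $ i)"
    by (intro Bochner_Integration.integrable_sum integrable_mult_C1_test_component[OF energy_density_locally_integrable \<phi>])
  moreover have "integrable lborel (\<lambda>x. \<Sum>i\<in>UNIV. \<Sum>j\<in>UNIV. grad x $ i * grad x $ j * G i x $ j)"
    by (intro Bochner_Integration.integrable_sum integrable_mult_C1_test_component[OF grad_grad_locally_integrable \<phi>])
  ultimately have "integrable lborel (\<lambda>x. (\<Sum>i\<in>UNIV. energy_density x * G i x $ i)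
      - 2 * (\<Sum>i\<in>UNIV. \<Sum>j\<in>UNIV. grad x $ i * grad x $ j * G i x $ j))" by auto
  then show ?thesis
    by (simp add: stress_def[abs_def] divergence_def inner_vec_def sum_distrib_left sum_distrib_right mult_ac)
qed

lemma halfplane_divergence:
  assumes \<phi>: "\<And>i. C1_test \<Omega> (\<lambda>x. \<phi> x $ i) (G i)"
  shows "has_bochner_integral lborel
    (\<lambda>x. indicator {x \<in> \<Omega>. x $ 2 > 0} x * (x $ 2 * divergence G x + \<phi> x $ 2)) 0"
proof -
  let ?D = "{x \<in> \<Omega>. x $ 2 > 0}"
  have "?D = \<Omega> \<inter> {x. x $ 2 > 0}" by auto
  moreover have "open {x::pt. x $ 2 > 0}"
    by (intro open_Collect_less continuous_intros)
  ultimately have "open ?D" using open_domain by (simp only: open_Int)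
  have div: "divergence (\<lambda>j x. 0) x = 0" for x :: pt by (simp add: divergence_def)
  have loc: "locally_integrable \<Omega> (\<lambda>x. 1)" "locally_integrable \<Omega> (\<lambda>x. x $ 2)"
    by (intro locally_integrable_continuous continuous_intros)+
  have component: "has_bochner_integral lborel (\<lambda>x. indicator ?D x * (\<phi> x $ i * (axis 2 1 \<bullet> axis i (1::real))
      + x $ 2 * (\<phi> x $ i * divergence (\<lambda>j x. 0) x + G i x \<bullet> axis i 1))) 0" for i
  proof (rule has_bochner_integral_divergence_positivity_set[where w="\<lambda>x. x $ 2", OF \<open>open ?D\<close> refl _ _ _ \<phi>])
    show "GDERIV (\<lambda>x. x $ 2) x :> axis 2 1" for x :: pt by (rule GDERIV_component)
    have "integrable lborel (\<lambda>x. indicator ?D x *\<^sub>R ((1 * \<phi> x $ i) * (axis 2 1 \<bullet> axis i (1::real))))"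
      by (intro integrable_mult_indicator integrable_mult_left integrable_mult_C1_test(1)[OF loc(1) \<phi>])
        (simp add: \<open>open ?D\<close>)
    then show "integrable lborel (\<lambda>x. indicator ?D x * (\<phi> x $ i * (axis 2 1 \<bullet> axis i (1::real))))" by simp
    have "integrable lborel (\<lambda>x. indicator ?D x *\<^sub>R (x $ 2 * (G i x \<bullet> axis i 1)))"
      by (intro integrable_mult_indicator integrable_mult_C1_test(2)[OF loc(2) \<phi>] continuous_on_const) (simp add: \<open>open ?D\<close>)
    then show "integrable lborel (\<lambda>x. indicator ?D x *
        (x $ 2 * (\<phi> x $ i * divergence (\<lambda>j x. 0) x + G i x \<bullet> axis i 1)))"
      by (simp add: div)
  qed (auto intro!: continuous_intros simp: GDERIV_const)
  have "axis 2 (1::real) $ (1::2) = 0" by (simp add: axis_def)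
  then show ?thesis
    using has_bochner_integral_add[OF component[of 1] component[of 2]]
    by (simp add: div divergence_def sum_2 inner_axis
      inner_axis_axis algebra_simps)
qed

lemma variational_identity:
  assumes \<phi>: "\<And>i. C1_test \<Omega> (\<lambda>x. \<phi> x $ i) (G i)"
  shows "(\<integral>x. stress G x + indicator fluid x * (x $ 2 * divergence G x + \<phi> x $ 2) \<partial>lborel) = 0"
proof -
  note [measurable] = C1_test_measurable[OF \<phi>]
  have [measurable]: "stress G \<in> borel_measurable borel" "divergence G \<in> borel_measurable borel"
    using borel_measurable_integrable[OF stress_integrable[OF \<phi>]] by (auto simp: divergence_def[abs_def])
  let ?L = "\<lambda>x. (norm (g x))\<^sup>2 * divg \<phi> x - 2 * (g x \<bullet> Dfield \<phi> x (g x))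
      + x $ 2 * chi_pos u x * divg \<phi> x + chi_pos u x * \<phi> x $ 2"
  let ?f = "\<lambda>x. stress G x + indicator fluid x * (x $ 2 * divergence G x + \<phi> x $ 2)"
  have "(LINT x:\<Omega>|lebesgue. ?L x) = 0"
    using solution C1_0_field_if_C1_test[OF \<phi>] by (simp add: variational_solution_def)
  also have "(LINT x:\<Omega>|lebesgue. ?L x) = (LINT x:\<Omega>|lborel. ?f x)"
  proof (rule set_lebesgue_integral_eq_lborel(1))
    have pointwise: "?L x = ?f x" if "x \<in> \<Omega>" "g x = grad x" for x
      using that by (simp add: stress_def energy_density_def divg_eq_divergence[OF \<phi>] inner_vec_def[of _ "Dfield \<phi> x _"]
          Dfield_nth[OF \<phi>] chi_pos_def fluid_def algebra_simps)
    show "AE x in lborel. x \<in> \<Omega> \<longrightarrow> ?L x = ?f x"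
      using AE_g_eq_grad by eventually_elim (use pointwise in blast)
  qed measurable
  also have "\<dots> = (\<integral>x. ?f x \<partial>lborel)"
  proof -
    have "indicator \<Omega> x *\<^sub>R ?f x = ?f x" for x
      using fluid_subset C1_test_zero_outside[OF \<phi>, of x]
      by (cases "x \<in> \<Omega>") (auto simp: stress_def divergence_def)
    then show ?thesis unfolding set_lebesgue_integral_def by (simp only:)
  qed
  finally show ?thesis .
qed

text \<open>Subtracting the divergence of \<open>x\<^sub>2 \<phi>\<close> on the upper half-plane turns the terms carried by \<open>fluid\<close> into
  terms carried by \<open>air\<close>.\<close>

lemma stress_identity:
  assumes \<phi>: "\<And>i. C1_test \<Omega> (\<lambda>x. \<phi> x $ i) (G i)"
  shows "has_bochner_integral lborel
    (\<lambda>x. stress G x - indicator air x * (x $ 2 * divergence G x + \<phi> x $ 2)) 0"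
proof -
  let ?h = "\<lambda>x. x $ 2 * divergence G x + \<phi> x $ 2"
  have loc: "locally_integrable \<Omega> (\<lambda>x. x $ 2)" "locally_integrable \<Omega> (\<lambda>x. 1)"
    by (intro locally_integrable_continuous continuous_intros)+
  have "integrable lborel (\<lambda>x. (\<Sum>i\<in>UNIV. x $ 2 * G i x $ i) + 1 * \<phi> x $ 2)"
    by (intro Bochner_Integration.integrable_add Bochner_Integration.integrable_sum
        integrable_mult_C1_test(1)[OF loc(2) \<phi>] integrable_mult_C1_test_component[OF loc(1) \<phi>])
  then have "integrable lborel ?h" by (simp add: divergence_def sum_distrib_left)
  then have "integrable lborel (\<lambda>x. indicator fluid x *\<^sub>R ?h x)" by (intro integrable_mult_indicator) auto
  then have "has_bochner_integral lborel (\<lambda>x. stress G x + indicator fluid x * ?h x) 0"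
    using variational_identity[OF \<phi>] stress_integrable[OF \<phi>] by (simp add: has_bochner_integral_iff)
  from has_bochner_integral_diff[OF this halfplane_divergence[OF \<phi>]]
  show ?thesis
  proof (rule has_bochner_integral_cong[THEN iffD1, rotated -1])
    show "stress G x + indicator fluid x * ?h x - indicator {x \<in> \<Omega>. x $ 2 > 0} x * ?h x
        = stress G x - indicator air x * ?h x" for x
      using fluid_subset fluid_above[of x] by (auto simp: air_eq indicator_def)
  qed auto
qed

text \<open>The vector field \<open>stress_row j\<close> is the \<open>j\<close>-th row of the stress tensor; its divergence is
  \<open>- 2 \<partial>\<^sub>j u \<Delta>u\<close>.\<close>

definition stress_row :: "2 \<Rightarrow> pt \<Rightarrow> pt" where
  "stress_row j x = energy_density x *\<^sub>R axis j 1 - (2 * grad x $ j) *\<^sub>R grad x"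

definition stress_row_gradient :: "2 \<Rightarrow> 2 \<Rightarrow> pt \<Rightarrow> pt" where
  "stress_row_gradient j k x = axis j 1 $ k *\<^sub>R (2 *\<^sub>R (\<Sum>l\<in>UNIV. grad x $ l *\<^sub>R hess l x))
    - 2 *\<^sub>R (grad x $ j *\<^sub>R hess k x + grad x $ k *\<^sub>R hess j x)"

lemma GDERIV_stress_row:
  assumes "x \<in> fluid"
  shows "GDERIV (\<lambda>x. stress_row j x $ k) x :> stress_row_gradient j k x"
proof -
  have product: "GDERIV (\<lambda>x. grad x $ i * grad x $ k) x :> grad x $ i *\<^sub>R hess k x + grad x $ k *\<^sub>R hess i x" for i k
    by (rule GDERIV_mult[OF GDERIV_grad[OF assms] GDERIV_grad[OF assms]])
  have row: "stress_row j x $ k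
      = (grad x $ 1 * grad x $ 1 + grad x $ 2 * grad x $ 2) * axis j 1 $ k
      - 2 * (grad x $ j * grad x $ k)" for x
    unfolding stress_row_def energy_density_def power2_norm_pt by (simp add: power2_eq_square mult.assoc)
  show ?thesis
    unfolding row
    by (rule GDERIV_subst[OF GDERIV_diff[OF GDERIV_mult[OF GDERIV_add[OF product product] GDERIV_const]
            GDERIV_mult[OF GDERIV_const product]]])
      (simp add: stress_row_gradient_def sum_2 vec_eq_iff algebra_simps)
qed

lemma divergence_stress_row:
  assumes "x \<in> fluid"
  shows "divergence (stress_row_gradient j) x = - 2 * (grad x $ j * divergence hess x)"
  using hess_symmetric[OF assms, of 1 2] exhaust_2[of j]
  by (auto simp: divergence_def stress_row_gradient_def sum_2 axis_def algebra_simps)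

lemma stress_single_row: "stress (\<lambda>i. if i = j then G else (\<lambda>x. 0)) x = G x \<bullet> stress_row j x"
  by (simp add: stress_def stress_row_def divergence_def inner_diff_right inner_axis
      if_distrib if_distribR sum.delta cong: if_cong)

lemma integral_grad_laplacian_eq_0:
  assumes \<eta>: "C1_test fluid \<eta> G"
  shows "(\<integral>x. indicator fluid x * (grad x $ j * divergence hess x) * \<eta> x \<partial>lborel) = 0"
proof -
  let ?\<phi> = "\<lambda>x. \<eta> x *\<^sub>R axis j (1::real)" and ?R = "\<lambda>i. if i = j then G else (\<lambda>x. 0)"
  have "continuous_on fluid (stress_row_gradient j k)" for k
    unfolding stress_row_gradient_def[abs_def] by (intro continuous_intros grad_continuous_on hess_continuous_on)
  then have div: "has_bochner_integral lborel
      (\<lambda>x. indicator fluid x * (\<eta> x * divergence (stress_row_gradient j) x + G x \<bullet> stress_row j x)) 0"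
    by (intro has_bochner_integral_divergence_test[OF \<eta> open_fluid] GDERIV_stress_row)
  have row: "C1_test \<Omega> (\<lambda>x. ?\<phi> x $ i) (?R i)" for i
    using C1_test_mono[OF \<eta> fluid_subset] C1_test_zero[of \<Omega>] by (cases "i = j") (auto simp: axis_def)
  have "has_bochner_integral lborel (stress ?R) 0"
  proof (rule has_bochner_integral_cong[THEN iffD1, OF refl _ refl stress_identity[OF row]])
    show "stress ?R x - indicator air x * (x $ 2 * divergence ?R x + ?\<phi> x $ 2) = stress ?R x" for x
      using C1_test_zero_outside[OF \<eta>, of x]
      by (cases "x \<in> fluid") (simp_all add: air_eq divergence_def if_distribR cong: if_cong)
  qed
  from has_bochner_integral_diff[OF div this]
  have "has_bochner_integral lborel (\<lambda>x. - 2 * (indicator fluid x * (grad x $ j * divergence hess x) * \<eta> x)) 0"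
  proof (rule has_bochner_integral_cong[THEN iffD1, OF refl _ _, rotated -1])
    show "indicator fluid x * (\<eta> x * divergence (stress_row_gradient j) x + G x \<bullet> stress_row j x) - stress ?R x
        = - 2 * (indicator fluid x * (grad x $ j * divergence hess x) * \<eta> x)" for x
      using C1_test_zero_outside[OF \<eta>, of x]
      by (cases "x \<in> fluid") (simp_all add: stress_single_row divergence_stress_row)
  qed simp
  then show ?thesis
    using has_bochner_integral_integral_eq by fastforce
qed

lemma grad_laplacian_eq_0:
  assumes "x \<in> fluid"
  shows "grad x $ j * divergence hess x = 0"
proof (rule continuous_AE_zero_imp_zero[OF open_fluid _ _ assms])
  let ?f = "\<lambda>x. grad x $ j * divergence hess x"
  show cont: "continuous_on fluid ?f"
    unfolding divergence_def by (intro continuous_intros grad_continuous_on hess_continuous_on)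
  have meas: "(\<lambda>x. indicator fluid x * ?f x) \<in> borel_measurable borel"
    using borel_measurable_continuous_on_indicator[OF fluid_measurable cont] by simp
  have "AE x in lborel. x \<in> fluid \<longrightarrow> indicator fluid x * ?f x = 0"
  proof (rule fundamental_lemma[OF open_fluid])
    show "set_integrable lebesgue K (\<lambda>x. indicator fluid x * ?f x)" if K: "compact K" "K \<subseteq> fluid" for K
    proof (subst set_lebesgue_integral_eq_lborel(2)[OF meas])
      have "continuous_on K (\<lambda>x. indicator fluid x * ?f x)"
        by (rule continuous_on_eq[OF continuous_on_subset[OF cont K(2)]]) (use K in auto)
      then show "set_integrable lborel K (\<lambda>x. indicator fluid x * ?f x)"
        unfolding set_integrable_def by (rule borel_integrable_compact[OF K(1)])
    qed (use K in \<open>auto simp: borel_compact\<close>)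
    fix \<psi> assume "test_fun fluid \<psi>"
    then obtain G where G: "C1_test fluid \<psi> G" using test_fun_imp_C1_test by blast
    have "(\<lambda>x. indicator fluid x * ?f x * \<psi> x) \<in> borel_measurable lborel"
      using meas C1_test_measurable(1)[OF G] by simp
    then show "(\<integral>x. indicator fluid x * ?f x * \<psi> x \<partial>lebesgue) = 0"
      using integral_grad_laplacian_eq_0[OF G] by (simp only: integral_completion)
  qed
  then show "AE x in lborel. x \<in> fluid \<longrightarrow> ?f x = 0" by eventually_elim auto
qed

lemma laplacian_eq_0:
  assumes "x \<in> fluid"
  shows "divergence hess x = 0"
proof (rule ccontr)
  assume "divergence hess x \<noteq> 0"
  let ?N = "fluid \<inter> divergence hess -` (- {0})"
  have "continuous_on fluid (divergence hess)"
    unfolding divergence_def[abs_def] by (intro continuous_intros hess_continuous_on)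
  then have "open ?N" using continuous_open_preimage[OF _ open_fluid, of _ "- {0}"] by auto
  have "x \<in> ?N" using assms \<open>divergence hess x \<noteq> 0\<close> by simp
  have "grad y $ i = 0" if "y \<in> ?N" for y i using grad_laplacian_eq_0[of y i] that by auto
  then have "GDERIV (\<lambda>x. grad x $ i) x :> 0" for i
    by (intro GDERIV_transform_open[OF GDERIV_const[of 0] \<open>open ?N\<close> \<open>x \<in> ?N\<close>]) auto
  then have "hess i x = 0" for i using GDERIV_unique[OF GDERIV_grad[OF assms]] by blast
  then show False using \<open>divergence hess x \<noteq> 0\<close> by (simp add: divergence_def)
qed

lemma energy_by_parts:
  assumes \<psi>: "C1_test \<Omega> \<psi> G"
  shows "has_bochner_integral lborel (\<lambda>x. energy_density x * \<psi> x + u_ext x * (G x \<bullet> grad x)) 0"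
proof -
  have harmonic: "u_ext x * (\<psi> x * divergence hess x + G x \<bullet> grad x) = u_ext x * (G x \<bullet> grad x)" for x
    by (cases "x \<in> fluid") (simp_all add: laplacian_eq_0 u_ext_off_fluid)
  have "has_bochner_integral lborel (\<lambda>x. \<psi> x * (grad x \<bullet> grad x)
      + u_ext x * (\<psi> x * divergence hess x + G x \<bullet> grad x)) 0"
  proof (rule fluid_divergence_theorem[OF \<psi> GDERIV_grad hess_continuous_on])
    show "integrable lborel (\<lambda>x. \<psi> x * (grad x \<bullet> grad x))"
      using integrable_mult_C1_test(1)[OF energy_density_locally_integrable \<psi>]
      by (simp add: energy_density_def power2_norm_eq_inner mult.commute)
    have "integrable lborel (\<lambda>x. \<Sum>i\<in>UNIV. u_ext x * grad x $ i * G x $ i)"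
      by (intro Bochner_Integration.integrable_sum integrable_mult_C1_test_component[OF u_ext_grad_locally_integrable \<psi>])
    then show "integrable lborel (\<lambda>x. u_ext x * (\<psi> x * divergence hess x + G x \<bullet> grad x))"
      unfolding harmonic by (simp add: inner_vec_def sum_distrib_left mult_ac)
  qed
  then show ?thesis by (simp add: harmonic energy_density_def power2_norm_eq_inner mult.commute)
qed

end

subsection \<open>Integrals against a radial kernel\<close>

definition pos_power :: "nat \<Rightarrow> real \<Rightarrow> real" where
  "pos_power n t = max 0 t ^ n"

lemma pos_power_nonneg: "0 \<le> pos_power n t"
  by (simp add: pos_power_def)

lemma pos_power_eq_0: "t \<le> 0 \<Longrightarrow> n > 0 \<Longrightarrow> pos_power n t = 0"
  by (simp add: pos_power_def)

lemma pos_power_eq_power: "t \<ge> 0 \<Longrightarrow> pos_power n t = t ^ n"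
  by (simp add: pos_power_def)

lemma pos_power_mono: "s \<le> t \<Longrightarrow> pos_power n s \<le> pos_power n t"
  unfolding pos_power_def by (intro power_mono) auto

lemma pos_power_le_power: "t \<le> T \<Longrightarrow> 0 \<le> T \<Longrightarrow> pos_power n t \<le> T ^ n"
  using pos_power_mono pos_power_eq_power by metis

lemma mult_pos_power: "n > 0 \<Longrightarrow> t * pos_power n t = pos_power (n + 1) t"
  by (cases "t \<ge> 0") (auto simp: pos_power_def)

lemma continuous_on_pos_power [continuous_intros]:
  "continuous_on S f \<Longrightarrow> continuous_on S (\<lambda>x. pos_power n (f x))"
  unfolding pos_power_def by (intro continuous_intros)

lemma DERIV_pos_power:
  assumes "n \<ge> 2"
  shows "(pos_power n has_real_derivative n * pos_power (n - 1) t) (at t)"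
proof (rule has_real_derivative_extend_zero[where a=0 and C=1 and f'="\<lambda>t. n * pos_power (n - 1) t"])
  fix t :: real assume t: "0 < t"
  have "((\<lambda>t. t ^ n) has_real_derivative n * pos_power (n - 1) t) (at t)"
    using t by (auto intro!: derivative_eq_intros simp: pos_power_def)
  then show "(pos_power n has_real_derivative n * pos_power (n - 1) t) (at t)"
    by (rule has_field_derivative_transform_within_open[where S="{0<..}"]) (use t in \<open>auto simp: pos_power_def\<close>)
  show "\<bar>pos_power n t\<bar> \<le> 1 * (t - 0)\<^sup>2" if "t < 0 + 1"
    using t that assms by (simp add: pos_power_def power_decreasing)
qed (use assms in \<open>auto simp: pos_power_eq_0\<close>)

lemma pos_power_lipschitz:
  assumes "s \<le> T" "t \<le> T" "0 \<le> T"
  shows "\<bar>pos_power n s - pos_power n t\<bar> \<le> n * T ^ (n - 1) * \<bar>s - t\<bar>"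
proof -
  define a b where "a = max 0 s" and "b = max 0 t"
  have ab: "0 \<le> a" "a \<le> T" "0 \<le> b" "b \<le> T" using assms by (auto simp: a_def b_def)
  have "\<bar>\<Sum>i<n. b ^ (n - Suc i) * a ^ i\<bar> \<le> (\<Sum>i<n. T ^ (n - 1))"
  proof (rule order_trans[OF sum_abs sum_mono])
    fix i assume "i \<in> {..<n}"
    then have "n - 1 = (n - Suc i) + i" by auto
    then have "T ^ (n - 1) = T ^ (n - Suc i) * T ^ i" by (simp only: power_add)
    moreover have "b ^ (n - Suc i) * a ^ i \<le> T ^ (n - Suc i) * T ^ i"
      using ab assms(3) by (intro mult_mono power_mono) auto
    ultimately show "\<bar>b ^ (n - Suc i) * a ^ i\<bar> \<le> T ^ (n - 1)" using ab by simp
  qed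
  then have "\<bar>a - b\<bar> * \<bar>\<Sum>i<n. b ^ (n - Suc i) * a ^ i\<bar> \<le> \<bar>s - t\<bar> * (n * T ^ (n - 1))"
    by (intro mult_mono) (auto simp: a_def b_def)
  then show ?thesis
    unfolding pos_power_def a_def[symmetric] b_def[symmetric] power_diff_sumr2 by (simp add: abs_mult mult_ac)
qed

text \<open>The kernels \<open>(\<tau> - |x - c|\<^sup>2)\<^sup>+\<^sup>n\<close> smooth out the ball of radius \<open>\<surd>\<tau>\<close>: the integrals against them are
  differentiable in \<open>\<tau>\<close> everywhere, and no boundary terms occur.\<close>

definition ball_kernel :: "nat \<Rightarrow> 'a::real_inner \<Rightarrow> real \<Rightarrow> 'a \<Rightarrow> real" where
  "ball_kernel n c \<tau> x = pos_power n (\<tau> - (norm (x - c))\<^sup>2)"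

lemma ball_kernel_nonneg: "0 \<le> ball_kernel n c \<tau> x"
  by (simp add: ball_kernel_def pos_power_nonneg)

lemma ball_kernel_continuous_on: "continuous_on S (ball_kernel n c \<tau>)"
  unfolding ball_kernel_def[abs_def] by (intro continuous_intros)

lemma ball_kernel_measurable [measurable]:
  fixes c :: "'a::euclidean_space"
  shows "ball_kernel n c \<tau> \<in> borel_measurable borel"
  using ball_kernel_continuous_on by (rule borel_measurable_continuous_onI)

lemma ball_kernel_mono: "\<sigma> \<le> \<tau> \<Longrightarrow> ball_kernel n c \<sigma> x \<le> ball_kernel n c \<tau> x"
  unfolding ball_kernel_def by (intro pos_power_mono) simp

lemma ball_kernel_le_power: "0 \<le> \<tau> \<Longrightarrow> ball_kernel n c \<tau> x \<le> \<tau> ^ n"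
  unfolding ball_kernel_def by (intro pos_power_le_power) auto

lemma mem_cball_iff_power2_norm: "0 \<le> r \<Longrightarrow> x \<in> cball c r \<longleftrightarrow> (norm (x - c))\<^sup>2 \<le> r\<^sup>2"
  by (simp add: dist_norm norm_minus_commute abs_le_square_iff[symmetric])

lemma ball_kernel_eq_0:
  assumes "n > 0" "\<sigma> \<le> \<tau>" "x \<notin> cball c (sqrt \<tau>)"
  shows "ball_kernel n c \<sigma> x = 0"
proof (cases "\<tau> \<ge> 0")
  case True
  then have "\<tau> < (norm (x - c))\<^sup>2"
    using assms(3) mem_cball_iff_power2_norm[of "sqrt \<tau>" x c] by simp
  then show ?thesis using assms by (simp add: ball_kernel_def pos_power_eq_0)
next
  case False
  then have "\<sigma> - (norm (x - c))\<^sup>2 \<le> 0" using assms(2) zero_le_power2[of "norm (x - c)"] by linarith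
  then show ?thesis using assms(1) by (simp add: ball_kernel_def pos_power_eq_0)
qed

lemma inner_diff_ball_kernel_gradient:
  assumes "n > 0"
  shows "(x - c) \<bullet> ((- 2 * real (n + 1) * ball_kernel n c \<tau> x) *\<^sub>R (x - c))
    = 2 * real (n + 1) * (ball_kernel (n + 1) c \<tau> x - \<tau> * ball_kernel n c \<tau> x)"
proof -
  have "(norm (x - c))\<^sup>2 * ball_kernel n c \<tau> x = \<tau> * ball_kernel n c \<tau> x - ball_kernel (n + 1) c \<tau> x"
    unfolding ball_kernel_def using mult_pos_power[OF assms, of "\<tau> - (norm (x - c))\<^sup>2"] by (simp add: algebra_simps)
  then show ?thesis
    unfolding inner_scaleR_right power2_norm_eq_inner[symmetric] by algebra
qed

lemma C1_test_ball_kernel: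
  fixes c :: "'a::euclidean_space"
  assumes "n > 0" "cball c (sqrt \<tau>) \<subseteq> S"
  shows "C1_test S (ball_kernel (n + 1) c \<tau>) (\<lambda>x. (- 2 * real (n + 1) * ball_kernel n c \<tau> x) *\<^sub>R (x - c))"
proof (rule C1_testI[OF compact_cball assms(2)])
  show "GDERIV (ball_kernel (n + 1) c \<tau>) x :> (- 2 * real (n + 1) * ball_kernel n c \<tau> x) *\<^sub>R (x - c)" for x
  proof -
    have "GDERIV (\<lambda>x. \<tau> - (norm (x - c))\<^sup>2) x :> - (2 *\<^sub>R (x - c))"
      using GDERIV_diff[OF GDERIV_const GDERIV_power2_norm_diff] by simp
    from GDERIV_DERIV_compose[OF this DERIV_pos_power[of "n + 1"]]
    have "GDERIV (ball_kernel (n + 1) c \<tau>) x :> (real (n + 1) * ball_kernel n c \<tau> x) *\<^sub>R - (2 *\<^sub>R (x - c))"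
      using assms(1) by (simp add: ball_kernel_def[abs_def])
    then show ?thesis by (rule GDERIV_subst) (simp add: scaleR_left_distrib scaleR_left_diff_distrib algebra_simps)
  qed
qed (use assms(1) in \<open>auto intro!: continuous_intros ball_kernel_continuous_on ball_kernel_eq_0\<close>)

lemma DERIV_ball_kernel:
  assumes "n \<ge> 2"
  shows "((\<lambda>\<tau>. ball_kernel n c \<tau> x) has_real_derivative n * ball_kernel (n - 1) c \<tau> x) (at \<tau>)"
proof -
  have "((\<lambda>\<tau>. \<tau> - (norm (x - c))\<^sup>2) has_real_derivative 1) (at \<tau>)" by (auto intro!: derivative_eq_intros)
  from DERIV_chain2[OF DERIV_pos_power[OF assms] this] show ?thesis by (simp add: ball_kernel_def)
qed

lemma ball_kernel_lipschitz:
  assumes "n > 0" "s \<le> T" "t \<le> T" "0 \<le> T"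
  shows "\<bar>ball_kernel n c s x - ball_kernel n c t x\<bar> \<le> n * T ^ (n - 1) * indicator (cball c (sqrt T)) x * \<bar>s - t\<bar>"
proof (cases "x \<in> cball c (sqrt T)")
  case True
  have "s - (norm (x - c))\<^sup>2 \<le> T" "t - (norm (x - c))\<^sup>2 \<le> T"
    using assms zero_le_power2[of "norm (x - c)"] by linarith+
  from pos_power_lipschitz[OF this assms(4)] True show ?thesis by (simp add: ball_kernel_def)
next
  case False
  then show ?thesis using assms(1-3) by (simp add: ball_kernel_eq_0[where \<tau>=T] del: mem_cball)
qed

definition kernel_integral :: "nat \<Rightarrow> ('a::euclidean_space \<Rightarrow> real) \<Rightarrow> 'a \<Rightarrow> real \<Rightarrow> real" where
  "kernel_integral n f c \<tau> = (\<integral>x. f x * ball_kernel n c \<tau> x \<partial>lborel)"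

context
  fixes S :: "'a::euclidean_space set" and f :: "'a \<Rightarrow> real"
  assumes f: "locally_integrable S f"
begin

lemma has_bochner_integral_ball_kernel:
  assumes "cball c (sqrt \<tau>) \<subseteq> S" "n > 0"
  shows "has_bochner_integral lborel (\<lambda>x. f x * ball_kernel n c \<tau> x) (kernel_integral n f c \<tau>)"
  unfolding kernel_integral_def
proof (rule has_bochner_integral_integrable, rule integrable_mult_compact_support)
  show "set_integrable lborel (cball c (sqrt \<tau>)) f" by (rule locally_integrableD[OF f compact_cball assms(1)])
qed (use assms(2) in \<open>auto intro!: ball_kernel_continuous_on ball_kernel_eq_0\<close>)

lemma integrable_mult_ball_kernel:
  "cball c (sqrt \<tau>) \<subseteq> S \<Longrightarrow> n > 0 \<Longrightarrow> integrable lborel (\<lambda>x. f x * ball_kernel n c \<tau> x)"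
  using has_bochner_integral_ball_kernel by (simp add: has_bochner_integral_iff)

lemma DERIV_kernel_integral:
  assumes T: "cball c (sqrt T) \<subseteq> S" "0 \<le> T" and "\<tau> < T" and n: "n \<ge> 2"
  shows "((\<lambda>\<tau>. kernel_integral n f c \<tau>) has_real_derivative n * kernel_integral (n - 1) f c \<tau>) (at \<tau>)"
proof -
  let ?B = "cball c (sqrt T)"
  have sub: "cball c (sqrt t) \<subseteq> S" if "t \<le> T" for t
    using T(1) that subset_cball[of "sqrt t" "sqrt T" c] by auto
  have "((\<lambda>\<tau>. \<integral>x. f x * ball_kernel n c \<tau> x \<partial>lborel) has_real_derivative
      (\<integral>x. f x * (n * ball_kernel (n - 1) c \<tau> x) \<partial>lborel)) (at \<tau>)"
  proof (rule has_real_derivative_integral)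
    show "T - \<tau> > 0" using \<open>\<tau> < T\<close> by simp
    show "integrable lborel (\<lambda>x. f x * ball_kernel n c t x)" if "\<bar>t - \<tau>\<bar> < T - \<tau>" for t
      using that n by (intro integrable_mult_ball_kernel sub) auto
    show "integrable lborel (\<lambda>x. n * T ^ (n - 1) * \<bar>indicator ?B x *\<^sub>R f x\<bar>)"
      using locally_integrableD[OF f compact_cball T(1)] unfolding set_integrable_def
      by (intro integrable_mult_right integrable_abs)
    show "((\<lambda>t. f x * ball_kernel n c t x) has_real_derivative f x * (n * ball_kernel (n - 1) c \<tau> x)) (at \<tau>)" for x
      by (rule DERIV_cmult[OF DERIV_ball_kernel[OF n]])
    have "(\<lambda>x. f x * ball_kernel (n - 1) c \<tau> x * n) \<in> borel_measurable lborel"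
      using integrable_mult_ball_kernel[OF sub, of \<tau> "n - 1"] n \<open>\<tau> < T\<close>
      by (intro borel_measurable_times borel_measurable_integrable) auto
    then show "(\<lambda>x. f x * (n * ball_kernel (n - 1) c \<tau> x)) \<in> borel_measurable lborel" by (simp add: mult_ac)
    fix t x assume t: "\<bar>t - \<tau>\<bar> < T - \<tau>"
    have "\<bar>ball_kernel n c t x - ball_kernel n c \<tau> x\<bar> \<le> n * T ^ (n - 1) * indicator ?B x * \<bar>t - \<tau>\<bar>"
      using t n \<open>\<tau> < T\<close> T(2) by (intro ball_kernel_lipschitz) auto
    from mult_left_mono[OF this abs_ge_zero[of "f x"]]
    show "\<bar>f x * ball_kernel n c t x - f x * ball_kernel n c \<tau> x\<bar> \<le> n * T ^ (n - 1) * \<bar>indicator ?B x *\<^sub>R f x\<bar> * \<bar>t - \<tau>\<bar>"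
      by (simp add: right_diff_distrib[symmetric] abs_mult mult_ac)
  qed
  then show ?thesis by (simp add: kernel_integral_def mult_ac)
qed

lemma kernel_integral_mono:
  assumes "\<And>x. f x \<ge> 0" "cball c (sqrt T) \<subseteq> S" "\<tau> \<le> T" "n > 0"
  shows "kernel_integral n f c \<tau> \<le> kernel_integral n f c T"
proof -
  have "cball c (sqrt \<tau>) \<subseteq> S" using assms(2,3) subset_cball[of "sqrt \<tau>" "sqrt T" c] by auto
  then show ?thesis
    unfolding kernel_integral_def
    by (intro integral_mono integrable_mult_ball_kernel mult_left_mono ball_kernel_mono assms)
qed

lemma ball_integral_le_kernel_integral:
  assumes nonneg: "\<And>x. f x \<ge> 0" and sub: "cball c (sqrt \<tau>) \<subseteq> S" and "n > 0"
    and m: "0 \<le> m" "r\<^sup>2 + m \<le> \<tau>" "0 \<le> r"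
  shows "m ^ n * (LINT x:cball c r|lborel. f x) \<le> kernel_integral n f c \<tau>"
  unfolding kernel_integral_def
proof (rule set_integral_le_weighted_integral)
  have "r \<le> sqrt \<tau>" using m by (simp add: real_le_rsqrt)
  then have "cball c r \<subseteq> S" using sub subset_cball[of r "sqrt \<tau>" c] by auto
  then show "set_integrable lborel (cball c r) f" by (rule locally_integrableD[OF f compact_cball])
  show "m ^ n \<le> ball_kernel n c \<tau> x" if "x \<in> cball c r" for x
  proof -
    have "(norm (x - c))\<^sup>2 \<le> r\<^sup>2" using that m(3) mem_cball_iff_power2_norm by blast
    then show ?thesis unfolding ball_kernel_def pos_power_def using m(1,2) by (intro power_mono) auto
  qed
qed (use nonneg ball_kernel_nonneg integrable_mult_ball_kernel[OF sub \<open>n > 0\<close>] in auto)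

lemma kernel_integral_le_ball_integral:
  assumes nonneg: "\<And>x. f x \<ge> 0" and sub: "cball c (sqrt \<tau>) \<subseteq> S" and "n > 0" "0 \<le> \<tau>"
  shows "kernel_integral n f c \<tau> \<le> \<tau> ^ n * (LINT x:cball c (sqrt \<tau>)|lborel. f x)"
  unfolding kernel_integral_def
  by (rule weighted_integral_le_set_integral[OF locally_integrableD[OF f compact_cball sub]
        integrable_mult_ball_kernel[OF sub \<open>n > 0\<close>] nonneg ball_kernel_le_power[OF \<open>0 \<le> \<tau>\<close>]
        ball_kernel_eq_0[OF \<open>n > 0\<close> order_refl]])

lemma kernel_integral_tendsto_center:
  assumes X: "X \<longlonglongrightarrow> c" "\<And>m. cball (X m) (sqrt \<tau>) \<subseteq> cball c R" and R: "cball c R \<subseteq> S"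
    and "n > 0" "0 \<le> \<tau>"
  shows "(\<lambda>m. kernel_integral n f (X m) \<tau>) \<longlonglongrightarrow> kernel_integral n f c \<tau>"
  unfolding kernel_integral_def
proof (rule integral_dominated_convergence[where w="\<lambda>x. \<tau> ^ n * \<bar>indicator (cball c R) x *\<^sub>R f x\<bar>"])
  show "integrable lborel (\<lambda>x. \<tau> ^ n * \<bar>indicator (cball c R) x *\<^sub>R f x\<bar>)"
    using locally_integrableD[OF f compact_cball R]
    by (intro integrable_mult_right integrable_abs) (simp add: set_integrable_def)
  show meas: "(\<lambda>x. f x * ball_kernel n (X m) \<tau> x) \<in> borel_measurable lborel" for m
    using X(2) R \<open>n > 0\<close> by (intro borel_measurable_integrable integrable_mult_ball_kernel) auto
  have lim: "(\<lambda>m. f x * ball_kernel n (X m) \<tau> x) \<longlonglongrightarrow> f x * ball_kernel n c \<tau> x" for x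
  proof (intro tendsto_mult tendsto_const)
    have "continuous_on UNIV (\<lambda>y. ball_kernel n y \<tau> x)" unfolding ball_kernel_def by (intro continuous_intros)
    then show "(\<lambda>m. ball_kernel n (X m) \<tau> x) \<longlonglongrightarrow> ball_kernel n c \<tau> x"
      by (rule continuous_on_tendsto_compose[OF _ X(1)]) auto
  qed
  then show "AE x in lborel. (\<lambda>m. f x * ball_kernel n (X m) \<tau> x) \<longlonglongrightarrow> f x * ball_kernel n c \<tau> x" by simp
  show "(\<lambda>x. f x * ball_kernel n c \<tau> x) \<in> borel_measurable lborel"
    using lim meas by (rule borel_measurable_LIMSEQ_real)
  have "\<bar>f x * ball_kernel n (X m) \<tau> x\<bar> \<le> \<tau> ^ n * \<bar>indicator (cball c R) x *\<^sub>R f x\<bar>" for m x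
  proof (cases "x \<in> cball c R")
    case True
    then show ?thesis using mult_right_mono[OF ball_kernel_le_power[OF \<open>0 \<le> \<tau>\<close>, of n "X m" x] abs_ge_zero[of "f x"]]
      by (simp add: abs_mult ball_kernel_nonneg mult.commute)
  next
    case False
    then have "x \<notin> cball (X m) (sqrt \<tau>)" using X(2)[of m] by blast
    from ball_kernel_eq_0[OF \<open>n > 0\<close> order_refl this] show ?thesis using \<open>0 \<le> \<tau>\<close> by simp
  qed
  then show "AE x in lborel. norm (f x * ball_kernel n (X m) \<tau> x) \<le> \<tau> ^ n * \<bar>indicator (cball c R) x *\<^sub>R f x\<bar>" for m
    by simp
qed

end

lemma kernel_integral_nonneg: "(\<And>x. f x \<ge> 0) \<Longrightarrow> kernel_integral n f c \<tau> \<ge> 0"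
  unfolding kernel_integral_def by (intro integral_nonneg_AE AE_I2 mult_nonneg_nonneg ball_kernel_nonneg)

lemma DERIV_mult_powr:
  fixes f :: "real \<Rightarrow> real"
  assumes "(f has_real_derivative (p * f t + k) / t) (at t)" "t > 0"
  shows "((\<lambda>t. f t * t powr - p) has_real_derivative k * t powr (- p - 1)) (at t)"
proof -
  have "((\<lambda>t. f t * t powr - p) has_real_derivative
      (p * f t + k) / t * t powr - p + (- p * t powr (- p - 1)) * f t) (at t)"
    by (rule DERIV_mult[OF assms(1) has_real_derivative_powr[OF assms(2)]])
  moreover have "t powr - p = t * t powr (- p - 1)"
    using assms(2) powr_add[of t 1 "- p - 1"] by simp
  ultimately show ?thesis using assms(2) by (simp add: field_simps)
qed

subsection \<open>Weighted energies and the frequency\<close>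

context free_boundary_solution
begin

definition air_density :: "pt \<Rightarrow> real" where
  "air_density x = indicator air x * x $ 2"

definition radial :: "pt \<Rightarrow> pt \<Rightarrow> real" where
  "radial c x = (x - c) \<bullet> grad x"

text \<open>By Euler's identity \<open>defect c N\<close> vanishes if \<open>u\<close> is homogeneous of degree \<open>N\<close> about \<open>c\<close>.\<close>

definition defect :: "pt \<Rightarrow> real \<Rightarrow> pt \<Rightarrow> real" where
  "defect c N x = radial c x - N * u_ext x"

lemma air_density_nonneg: "air_density x \<ge> 0"
  by (auto simp: air_density_def air_def indicator_def)

lemma energy_density_nonneg: "energy_density x \<ge> 0"
  by (simp add: energy_density_def)

lemma air_density_measurable [measurable]: "air_density \<in> borel_measurable borel"
  unfolding air_density_def[abs_def] by measurable

lemma energy_density_measurable [measurable]: "energy_density \<in> borel_measurable borel"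
  unfolding energy_density_def[abs_def] by measurable

lemma air_density_locally_integrable: "locally_integrable \<Omega> air_density"
proof -
  have "locally_integrable \<Omega> (\<lambda>x. x $ 2)" by (intro locally_integrable_continuous continuous_intros)
  then have "integrable lborel (\<lambda>x. indicator air x *\<^sub>R (indicator K x *\<^sub>R x $ 2))" if "compact K" "K \<subseteq> \<Omega>" for K
    using locally_integrableD[OF _ that, of "\<lambda>x. x $ 2"] unfolding set_integrable_def
    by (intro integrable_mult_indicator[of air]) simp_all
  then show ?thesis
    by (simp add: locally_integrable_def set_integrable_def air_density_def[abs_def] mult_ac)
qed

lemma u_ext_radial_locally_integrable: "locally_integrable \<Omega> (\<lambda>x. u_ext x * radial c x)"
proof -
  have "locally_integrable \<Omega> (\<lambda>x. u_ext x * grad x $ 1 * (x - c) $ 1 + u_ext x * grad x $ 2 * (x - c) $ 2)"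
    by (intro locally_integrable_add locally_integrable_mult_continuous u_ext_grad_locally_integrable continuous_intros)
  then show ?thesis by (simp add: radial_def inner_vec_def sum_2 algebra_simps)
qed

lemma radial_square_locally_integrable: "locally_integrable \<Omega> (\<lambda>x. (radial c x)\<^sup>2)"
proof -
  have "locally_integrable \<Omega> (\<lambda>x. grad x $ 1 * grad x $ 1 * ((x - c) $ 1 * (x - c) $ 1)
      + grad x $ 1 * grad x $ 2 * (2 * (x - c) $ 1 * (x - c) $ 2)
      + grad x $ 2 * grad x $ 2 * ((x - c) $ 2 * (x - c) $ 2))"
    by (intro locally_integrable_add locally_integrable_mult_continuous grad_grad_locally_integrable continuous_intros)
  moreover have "grad x $ 1 * grad x $ 1 * ((x - c) $ 1 * (x - c) $ 1)
      + grad x $ 1 * grad x $ 2 * (2 * (x - c) $ 1 * (x - c) $ 2)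
      + grad x $ 2 * grad x $ 2 * ((x - c) $ 2 * (x - c) $ 2) = (radial c x)\<^sup>2" for x
    unfolding radial_def inner_vec_def sum_2 inner_real_def by algebra
  ultimately show ?thesis by simp
qed

lemma defect_square_eq:
  "(defect c N x)\<^sup>2 = (radial c x)\<^sup>2 + u_ext x * radial c x * (- 2 * N) + (u_ext x)\<^sup>2 * N\<^sup>2"
  unfolding defect_def by algebra

lemma defect_square_locally_integrable: "locally_integrable \<Omega> (\<lambda>x. (defect c N x)\<^sup>2)"
  unfolding defect_square_eq
  by (intro locally_integrable_add locally_integrable_mult_continuous radial_square_locally_integrable
      u_ext_radial_locally_integrable u_ext_square_locally_integrable continuous_intros)

definition energy :: "pt \<Rightarrow> real \<Rightarrow> real" where
  "energy c \<tau> = kernel_integral 3 energy_density c \<tau> / 6"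

definition air_energy :: "pt \<Rightarrow> real \<Rightarrow> real" where
  "air_energy c \<tau> = kernel_integral 3 air_density c \<tau> / 6"

definition mass :: "pt \<Rightarrow> real \<Rightarrow> real" where
  "mass c \<tau> = kernel_integral 2 (\<lambda>x. (u_ext x)\<^sup>2) c \<tau>"

definition radial_energy :: "pt \<Rightarrow> real \<Rightarrow> real" where
  "radial_energy c \<tau> = kernel_integral 2 (\<lambda>x. (radial c x)\<^sup>2) c \<tau>"

lemma energy_nonneg: "energy c \<tau> \<ge> 0" and air_energy_nonneg: "air_energy c \<tau> \<ge> 0" and mass_nonneg: "mass c \<tau> \<ge> 0"
  unfolding energy_def air_energy_def mass_def
  by (auto intro!: divide_nonneg_nonneg kernel_integral_nonneg air_density_nonneg energy_density_nonneg)

definition admissible :: "pt \<Rightarrow> real \<Rightarrow> bool" where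
  "admissible c \<tau> \<longleftrightarrow> 0 < \<tau> \<and> cball c (sqrt \<tau>) \<subseteq> \<Omega>"

lemma admissible_mono: "admissible c T \<Longrightarrow> 0 < \<tau> \<Longrightarrow> \<tau> \<le> T \<Longrightarrow> admissible c \<tau>"
  unfolding admissible_def by (meson order_trans real_sqrt_le_mono subset_cball)

lemma energy_mono: "admissible c T \<Longrightarrow> \<tau> \<le> T \<Longrightarrow> energy c \<tau> \<le> energy c T"
  unfolding energy_def admissible_def
  by (intro divide_right_mono kernel_integral_mono[OF energy_density_locally_integrable]) (auto simp: energy_density_nonneg)

lemma air_energy_mono: "admissible c T \<Longrightarrow> \<tau> \<le> T \<Longrightarrow> air_energy c \<tau> \<le> air_energy c T"
  unfolding air_energy_def admissible_def
  by (intro divide_right_mono kernel_integral_mono[OF air_density_locally_integrable]) (auto simp: air_density_nonneg)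

lemma energy_eq_kernel_integral_radial:
  assumes "admissible c \<tau>"
  shows "energy c \<tau> = kernel_integral 2 (\<lambda>x. u_ext x * radial c x) c \<tau>"
proof -
  have sub: "cball c (sqrt \<tau>) \<subseteq> \<Omega>" using assms by (simp add: admissible_def)
  let ?F = "\<lambda>x. energy_density x * ball_kernel 3 c \<tau> x - 6 * (u_ext x * radial c x * ball_kernel 2 c \<tau> x)"
  have "has_bochner_integral lborel ?F 0"
    using energy_by_parts[OF C1_test_ball_kernel[OF _ sub, of 2]] by (simp add: radial_def mult_ac)
  moreover have "has_bochner_integral lborel ?F
      (6 * energy c \<tau> - 6 * kernel_integral 2 (\<lambda>x. u_ext x * radial c x) c \<tau>)"
    using has_bochner_integral_ball_kernel[OF energy_density_locally_integrable sub, of 3]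
    by (intro has_bochner_integral_diff has_bochner_integral_mult_right
        has_bochner_integral_ball_kernel[OF u_ext_radial_locally_integrable sub]) (simp_all add: energy_def)
  ultimately show ?thesis using has_bochner_integral_eq by fastforce
qed

lemma C1_test_radial_field:
  assumes "C1_test S a A"
  shows "C1_test S (\<lambda>x. (a x *\<^sub>R (x - c)) $ i) (\<lambda>x. (x - c) $ i *\<^sub>R A x + a x *\<^sub>R axis i 1)"
  using C1_test_mult_C1[OF assms GDERIV_diff_component continuous_on_const] by (simp add: mult.commute)

lemma divergence_radial_field:
  fixes c :: "real ^ 'n" and a :: "real ^ 'n \<Rightarrow> real"
  shows "divergence (\<lambda>i x. (x - c) $ i *\<^sub>R A x + a x *\<^sub>R axis i 1) x = (x - c) \<bullet> A x + CARD('n) * a x"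
  by (simp add: divergence_def inner_vec_def sum.distrib)

lemma mass_radial_field:
  assumes a: "C1_test \<Omega> a A"
  shows "has_bochner_integral lborel
    (\<lambda>x. (u_ext x)\<^sup>2 * ((x - c) \<bullet> A x + 2 * a x) + 2 * (u_ext x * radial c x * a x)) 0"
  using has_bochner_integral_add[OF u_ext_square_by_parts[OF C1_test_radial_field[OF a, of c 1], of 1]
      u_ext_square_by_parts[OF C1_test_radial_field[OF a, of c 2], of 2]]
  by (simp add: radial_def inner_vec_def sum_2 algebra_simps)

lemma stress_radial_field:
  assumes a: "C1_test \<Omega> a A"
  shows "has_bochner_integral lborel (\<lambda>x. energy_density x * ((x - c) \<bullet> A x) - 2 * (radial c x * (A x \<bullet> grad x))
    - indicator air x * (x $ 2 * ((x - c) \<bullet> A x + 2 * a x) + (x - c) $ 2 * a x)) 0"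
proof -
  have div: "divergence (\<lambda>i x. (x - c) $ i *\<^sub>R A x + a x *\<^sub>R axis i 1) x = (x - c) \<bullet> A x + 2 * a x" for x
    by (simp add: divergence_radial_field del: vector_minus_component)
  have stress: "stress (\<lambda>i x. (x - c) $ i *\<^sub>R A x + a x *\<^sub>R axis i 1) x
      = energy_density x * ((x - c) \<bullet> A x) - 2 * (radial c x * (A x \<bullet> grad x))" for x
    unfolding stress_def div energy_density_def power2_norm_pt
    by (simp add: radial_def inner_pt sum_2 axis_def power2_eq_square algebra_simps)
  show ?thesis
    using stress_identity[OF C1_test_radial_field[OF a, of c]]
    unfolding stress div by (simp add: mult.commute)
qed

lemma mass_identity:
  assumes "admissible c \<tau>"
  shows "2 * \<tau> * kernel_integral 1 (\<lambda>x. (u_ext x)\<^sup>2) c \<tau> = 3 * mass c \<tau> + energy c \<tau>"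
proof -
  have sub: "cball c (sqrt \<tau>) \<subseteq> \<Omega>" using assms by (simp add: admissible_def)
  let ?F = "\<lambda>x. 6 * ((u_ext x)\<^sup>2 * ball_kernel 2 c \<tau> x) - 4 * \<tau> * ((u_ext x)\<^sup>2 * ball_kernel 1 c \<tau> x)
      + 2 * (u_ext x * radial c x * ball_kernel 2 c \<tau> x)"
  have "has_bochner_integral lborel ?F 0"
    using mass_radial_field[OF C1_test_ball_kernel[OF zero_less_one sub], of c]
    unfolding inner_diff_ball_kernel_gradient[OF zero_less_one]
    by (simp add: algebra_simps flip: numeral_2_eq_2)
  moreover have "has_bochner_integral lborel ?F
      (6 * mass c \<tau> - 4 * \<tau> * kernel_integral 1 (\<lambda>x. (u_ext x)\<^sup>2) c \<tau> + 2 * energy c \<tau>)"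
    unfolding mass_def energy_eq_kernel_integral_radial[OF assms]
    by (intro has_bochner_integral_add has_bochner_integral_diff has_bochner_integral_mult_right
        has_bochner_integral_ball_kernel[OF u_ext_square_locally_integrable sub]
        has_bochner_integral_ball_kernel[OF u_ext_radial_locally_integrable sub]) auto
  ultimately show ?thesis using has_bochner_integral_eq by fastforce
qed

lemma energy_identity:
  assumes "admissible c \<tau>" "c $ 2 = 0"
  shows "\<tau> * (kernel_integral 2 energy_density c \<tau> / 2 - kernel_integral 2 air_density c \<tau> / 2)
    = 3 * energy c \<tau> - 9 / 2 * air_energy c \<tau> + radial_energy c \<tau>"
proof -
  have sub: "cball c (sqrt \<tau>) \<subseteq> \<Omega>" using assms by (simp add: admissible_def)
  let ?A = "\<lambda>x. (- 2 * real (2 + 1) * ball_kernel 2 c \<tau> x) *\<^sub>R (x - c)"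
  let ?F = "\<lambda>x. 6 * (energy_density x * ball_kernel 3 c \<tau> x) - 6 * \<tau> * (energy_density x * ball_kernel 2 c \<tau> x)
      + 12 * ((radial c x)\<^sup>2 * ball_kernel 2 c \<tau> x)
      - (9 * (air_density x * ball_kernel 3 c \<tau> x) - 6 * \<tau> * (air_density x * ball_kernel 2 c \<tau> x))"
  have radial: "?A x \<bullet> grad x = - 6 * ball_kernel 2 c \<tau> x * radial c x" for x by (simp add: radial_def)
  have "has_bochner_integral lborel ?F 0"
    using stress_radial_field[OF C1_test_ball_kernel[OF pos2 sub], of c] assms(2)
    unfolding inner_diff_ball_kernel_gradient[OF pos2] radial
    by (simp add: air_density_def power2_eq_square algebra_simps flip: numeral_3_eq_3)
  moreover have "has_bochner_integral lborel ?F
      (6 * (6 * energy c \<tau>) - 6 * \<tau> * kernel_integral 2 energy_density c \<tau> + 12 * radial_energy c \<tau>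
      - (9 * (6 * air_energy c \<tau>) - 6 * \<tau> * kernel_integral 2 air_density c \<tau>))"
    using has_bochner_integral_ball_kernel[OF energy_density_locally_integrable sub, of 3]
      has_bochner_integral_ball_kernel[OF air_density_locally_integrable sub, of 3]
    by (intro has_bochner_integral_add has_bochner_integral_diff has_bochner_integral_mult_right)
      (simp_all add: energy_def air_energy_def radial_energy_def
        has_bochner_integral_ball_kernel[OF energy_density_locally_integrable sub]
        has_bochner_integral_ball_kernel[OF air_density_locally_integrable sub]
        has_bochner_integral_ball_kernel[OF radial_square_locally_integrable sub])
  ultimately show ?thesis
    using has_bochner_integral_eq[OF _ \<open>has_bochner_integral lborel ?F 0\<close>] by (fastforce simp: algebra_simps)
qed

lemma DERIV_mass:
  assumes "admissible c T" "0 < \<tau>" "\<tau> < T"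
  shows "(mass c has_real_derivative (3 * mass c \<tau> + energy c \<tau>) / \<tau>) (at \<tau>)"
proof -
  have "(mass c has_real_derivative 2 * kernel_integral 1 (\<lambda>x. (u_ext x)\<^sup>2) c \<tau>) (at \<tau>)"
    unfolding mass_def[abs_def] using assms
      DERIV_kernel_integral[OF u_ext_square_locally_integrable, of c T \<tau> 2] by (simp add: admissible_def)
  moreover have "2 * kernel_integral 1 (\<lambda>x. (u_ext x)\<^sup>2) c \<tau> = (3 * mass c \<tau> + energy c \<tau>) / \<tau>"
    using mass_identity[OF admissible_mono[OF assms(1,2)]] assms(2,3) by (simp add: eq_divide_eq mult_ac)
  ultimately show ?thesis by simp
qed

lemma DERIV_energy_diff:
  assumes "admissible c T" "0 < \<tau>" "\<tau> < T" "c $ 2 = 0"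
  shows "((\<lambda>\<tau>. energy c \<tau> - air_energy c \<tau>) has_real_derivative
    (3 * energy c \<tau> - 9 / 2 * air_energy c \<tau> + radial_energy c \<tau>) / \<tau>) (at \<tau>)"
proof -
  have deriv: "((\<lambda>\<tau>. kernel_integral 3 f c \<tau> / 6) has_real_derivative kernel_integral 2 f c \<tau> / 2) (at \<tau>)"
    if "locally_integrable \<Omega> f" for f
    using DERIV_cdivide[OF DERIV_kernel_integral[OF that, of c T \<tau> 3], of 6] assms by (simp add: admissible_def)
  have "((\<lambda>\<tau>. energy c \<tau> - air_energy c \<tau>) has_real_derivative
      kernel_integral 2 energy_density c \<tau> / 2 - kernel_integral 2 air_density c \<tau> / 2) (at \<tau>)"
    unfolding energy_def air_energy_def
    by (intro DERIV_diff deriv energy_density_locally_integrable air_density_locally_integrable)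
  moreover have "kernel_integral 2 energy_density c \<tau> / 2 - kernel_integral 2 air_density c \<tau> / 2
      = (3 * energy c \<tau> - 9 / 2 * air_energy c \<tau> + radial_energy c \<tau>) / \<tau>"
    using energy_identity[OF admissible_mono[OF assms(1,2)] assms(4)] assms(2,3) by (simp add: eq_divide_eq mult.commute)
  ultimately show ?thesis by simp
qed

lemma kernel_integral_defect_square:
  assumes "admissible c \<tau>"
  shows "kernel_integral 2 (\<lambda>x. (defect c N x)\<^sup>2) c \<tau> = radial_energy c \<tau> - 2 * N * energy c \<tau> + N\<^sup>2 * mass c \<tau>"
proof -
  have sub: "cball c (sqrt \<tau>) \<subseteq> \<Omega>" using assms by (simp add: admissible_def)
  have "has_bochner_integral lborel (\<lambda>x. (radial c x)\<^sup>2 * ball_kernel 2 c \<tau> x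
      - (2 * N) * (u_ext x * radial c x * ball_kernel 2 c \<tau> x) + N\<^sup>2 * ((u_ext x)\<^sup>2 * ball_kernel 2 c \<tau> x))
      (radial_energy c \<tau> - (2 * N) * energy c \<tau> + N\<^sup>2 * mass c \<tau>)"
    unfolding radial_energy_def mass_def energy_eq_kernel_integral_radial[OF assms]
    by (intro has_bochner_integral_add has_bochner_integral_diff has_bochner_integral_mult_right
        has_bochner_integral_ball_kernel[OF u_ext_square_locally_integrable sub]
        has_bochner_integral_ball_kernel[OF radial_square_locally_integrable sub]
        has_bochner_integral_ball_kernel[OF u_ext_radial_locally_integrable sub]) auto
  then show ?thesis
    unfolding kernel_integral_def defect_square_eq
    by (simp add: has_bochner_integral_iff algebra_simps)
qed

text \<open>At \<open>c \<in> \<Sigma>\<close> this is a weighted integral of \<open>\<Phi>(r) - \<Phi>(0+)\<close> over the radii \<open>r \<le> \<surd>\<tau>\<close>.\<close>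

definition excess :: "pt \<Rightarrow> real \<Rightarrow> real" where
  "excess c \<tau> = energy c \<tau> - air_energy c \<tau> - 3 / 2 * mass c \<tau>"

lemma DERIV_excess:
  assumes "admissible c T" "0 < \<tau>" "\<tau> < T" "c $ 2 = 0"
  shows "(excess c has_real_derivative
    (9 / 2 * excess c \<tau> + kernel_integral 2 (\<lambda>x. (defect c (3 / 2) x)\<^sup>2) c \<tau>) / \<tau>) (at \<tau>)"
proof -
  have adm: "admissible c \<tau>" using admissible_mono[OF assms(1,2)] assms(3) by simp
  have "(excess c has_real_derivative (3 * energy c \<tau> - 9 / 2 * air_energy c \<tau> + radial_energy c \<tau>) / \<tau>
      - 3 / 2 * ((3 * mass c \<tau> + energy c \<tau>) / \<tau>)) (at \<tau>)"
    unfolding excess_def[abs_def]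
    by (intro DERIV_diff DERIV_cmult DERIV_energy_diff[OF assms] DERIV_mass[OF assms(1-3)])
  moreover have "(3 * energy c \<tau> - 9 / 2 * air_energy c \<tau> + radial_energy c \<tau>) / \<tau>
        - 3 / 2 * ((3 * mass c \<tau> + energy c \<tau>) / \<tau>)
      = (9 / 2 * excess c \<tau> + kernel_integral 2 (\<lambda>x. (defect c (3 / 2) x)\<^sup>2) c \<tau>) / \<tau>"
    unfolding kernel_integral_defect_square[OF adm] excess_def
    using assms(2) by (simp add: field_simps power2_eq_square)
  ultimately show ?thesis by simp
qed

lemma excess_nonneg:
  assumes "admissible c T" "c $ 2 = 0" and lim: "((\<lambda>\<tau>. excess c \<tau> * \<tau> powr - (9 / 2)) \<longlongrightarrow> 0) (at_right 0)"
    and \<tau>: "0 < \<tau>" "\<tau> < T"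
  shows "excess c \<tau> \<ge> 0"
proof -
  let ?f = "\<lambda>t. excess c t * t powr - (9 / 2)"
  have "?f t \<le> ?f \<tau>" if t: "0 < t" "t < \<tau>" for t
  proof (rule DERIV_nonneg_imp_nondecreasing[where f="?f"])
    fix s assume s: "t \<le> s" "s \<le> \<tau>"
    have "(?f has_real_derivative kernel_integral 2 (\<lambda>x. (defect c (3 / 2) x)\<^sup>2) c s * s powr (- (9 / 2) - 1)) (at s)"
      by (rule DERIV_mult_powr[OF DERIV_excess[OF assms(1) _ _ assms(2)]]) (use s t \<tau> in auto)
    moreover have "0 \<le> kernel_integral 2 (\<lambda>x. (defect c (3 / 2) x)\<^sup>2) c s * s powr (- (9 / 2) - 1)"
      by (intro mult_nonneg_nonneg kernel_integral_nonneg) auto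
    ultimately show "\<exists>y. (?f has_real_derivative y) (at s) \<and> 0 \<le> y" by blast
  qed (use t in simp)
  then have "\<forall>\<^sub>F t in at_right 0. ?f t \<le> ?f \<tau>"
    using \<tau>(1) unfolding eventually_at_right_field by blast
  then have "0 \<le> ?f \<tau>" by (rule tendsto_upperbound[OF lim]) simp
  then show ?thesis using \<tau>(1) by (simp add: zero_le_mult_iff)
qed

definition center :: "pt \<Rightarrow> real \<Rightarrow> bool" where
  "center c T \<longleftrightarrow> admissible c T \<and> c $ 2 = 0 \<and> c \<in> closure fluid \<and> (\<forall>\<tau>. 0 < \<tau> \<longrightarrow> \<tau> < T \<longrightarrow> excess c \<tau> \<ge> 0)"

lemma center_admissible: "center c T \<Longrightarrow> 0 < \<tau> \<Longrightarrow> \<tau> \<le> T \<Longrightarrow> admissible c \<tau>"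
  using admissible_mono by (auto simp: center_def)

lemma mass_pos:
  assumes "center c T" "0 < \<tau>" "\<tau> \<le> T"
  shows "mass c \<tau> > 0"
proof (rule ccontr)
  assume "\<not> mass c \<tau> > 0"
  then have "mass c \<tau> = 0" using mass_nonneg[of c \<tau>] by simp
  have "cball c (sqrt \<tau>) \<subseteq> \<Omega>" using center_admissible[OF assms] by (simp add: admissible_def)
  then have "integrable lborel (\<lambda>x. (u_ext x)\<^sup>2 * ball_kernel 2 c \<tau> x)"
    by (rule integrable_mult_ball_kernel[OF u_ext_square_locally_integrable]) simp
  then have "AE x in lborel. (u_ext x)\<^sup>2 * ball_kernel 2 c \<tau> x = 0"
    using \<open>mass c \<tau> = 0\<close> unfolding mass_def kernel_integral_def
    by (subst (asm) integral_nonneg_eq_0_iff_AE) (auto simp: ball_kernel_nonneg)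
  then have "AE x in lborel. x \<in> \<Omega> \<longrightarrow> (u_ext x)\<^sup>2 * ball_kernel 2 c \<tau> x = 0" by eventually_elim simp
  moreover have "continuous_on \<Omega> (\<lambda>x. (u_ext x)\<^sup>2 * ball_kernel 2 c \<tau> x)"
    by (intro continuous_intros u_ext_continuous_on ball_kernel_continuous_on)
  ultimately have zero: "(u_ext x)\<^sup>2 * ball_kernel 2 c \<tau> x = 0" if "x \<in> \<Omega>" for x
    using continuous_AE_zero_imp_zero[OF open_domain] that by blast
  have "c \<in> closure fluid" using assms(1) by (simp add: center_def)
  then obtain x where x: "x \<in> fluid" "dist x c < sqrt \<tau>"
    using assms(2) unfolding closure_approachable by (metis real_sqrt_gt_zero)
  have "(dist x c)\<^sup>2 < (sqrt \<tau>)\<^sup>2" using x(2) by (intro power_strict_mono) auto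
  then have "ball_kernel 2 c \<tau> x > 0" using assms(2) by (simp add: ball_kernel_def pos_power_def dist_norm)
  then show False using zero[of x] x(1) by (auto simp: fluid_eq_u_ext)
qed

lemma energy_lower_bound: "center c T \<Longrightarrow> 0 < \<tau> \<Longrightarrow> \<tau> < T \<Longrightarrow> 3 / 2 * mass c \<tau> + air_energy c \<tau> \<le> energy c \<tau>"
  by (auto simp: center_def excess_def algebra_simps)

definition frequency :: "pt \<Rightarrow> real \<Rightarrow> real" where
  "frequency c \<tau> = (energy c \<tau> - air_energy c \<tau>) / mass c \<tau>"

definition homogeneity_defect :: "pt \<Rightarrow> real \<Rightarrow> real" where
  "homogeneity_defect c \<tau> = kernel_integral 2 (\<lambda>x. (defect c (energy c \<tau> / mass c \<tau>) x)\<^sup>2) c \<tau>"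

lemma frequency_ge: "center c T \<Longrightarrow> 0 < \<tau> \<Longrightarrow> \<tau> < T \<Longrightarrow> 3 / 2 \<le> frequency c \<tau>"
  using energy_lower_bound[of c T \<tau>] mass_pos[of c T \<tau>] by (simp add: frequency_def pos_le_divide_eq)

lemma homogeneity_defect_nonneg: "homogeneity_defect c \<tau> \<ge> 0"
  unfolding homogeneity_defect_def by (intro kernel_integral_nonneg) simp

lemma homogeneity_defect_eq:
  assumes "center c T" "0 < \<tau>" "\<tau> \<le> T"
  shows "homogeneity_defect c \<tau> = (radial_energy c \<tau> * mass c \<tau> - (energy c \<tau>)\<^sup>2) / mass c \<tau>"
  unfolding homogeneity_defect_def kernel_integral_defect_square[OF center_admissible[OF assms]]
  using mass_pos[OF assms] by (simp add: field_simps power2_eq_square)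

lemma DERIV_frequency:
  assumes "center c T" "0 < \<tau>" "\<tau> < T"
  shows "(frequency c has_real_derivative (homogeneity_defect c \<tau> / mass c \<tau>
    + air_energy c \<tau> * (energy c \<tau> - 3 / 2 * mass c \<tau>) / (mass c \<tau>)\<^sup>2) / \<tau>) (at \<tau>)"
proof -
  have adm: "admissible c T" "c $ 2 = 0" using assms(1) by (auto simp: center_def)
  define S Y I R where "S = energy c \<tau>" and "Y = air_energy c \<tau>" and "I = mass c \<tau>" and "R = radial_energy c \<tau>"
  have "I > 0" using mass_pos[OF assms(1,2)] assms(3) by (simp add: I_def)
  have "(frequency c has_real_derivative
      ((3 * S - 9 / 2 * Y + R) / \<tau> * I - (S - Y) * ((3 * I + S) / \<tau>)) / (I * I)) (at \<tau>)"
    unfolding frequency_def[abs_def] S_def Y_def I_def R_def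
    by (rule DERIV_divide[OF DERIV_energy_diff[OF adm(1) assms(2,3) adm(2)] DERIV_mass[OF adm(1) assms(2,3)]])
      (use \<open>I > 0\<close> in \<open>simp add: I_def\<close>)
  moreover have "((3 * S - 9 / 2 * Y + R) / \<tau> * I - (S - Y) * ((3 * I + S) / \<tau>)) / (I * I)
      = ((R * I - S\<^sup>2) / I / I + Y * (S - 3 / 2 * I) / I\<^sup>2) / \<tau>"
    using \<open>I > 0\<close> assms(2) by (simp add: divide_simps power2_eq_square) (simp add: algebra_simps)
  moreover have "homogeneity_defect c \<tau> = (R * I - S\<^sup>2) / I"
    using homogeneity_defect_eq[OF assms(1,2)] assms(3) by (simp add: S_def I_def R_def)
  ultimately show ?thesis by (simp add: S_def Y_def I_def)
qed

lemma frequency_air_term_ge: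
  assumes "center c T" "0 < \<tau>" "\<tau> < T"
  shows "(air_energy c \<tau> / mass c \<tau>)\<^sup>2 \<le> air_energy c \<tau> * (energy c \<tau> - 3 / 2 * mass c \<tau>) / (mass c \<tau>)\<^sup>2"
proof -
  have "air_energy c \<tau> * air_energy c \<tau> \<le> air_energy c \<tau> * (energy c \<tau> - 3 / 2 * mass c \<tau>)"
    using energy_lower_bound[OF assms] by (intro mult_left_mono air_energy_nonneg) auto
  then show ?thesis by (simp add: power_divide power2_eq_square divide_right_mono)
qed

lemma frequency_mono:
  assumes "center c T" "0 < a" "a \<le> b" "b < T"
  shows "frequency c a \<le> frequency c b"
proof (rule DERIV_nonneg_imp_nondecreasing[OF assms(3)])
  fix \<tau> assume "a \<le> \<tau>" "\<tau> \<le> b"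
  then have \<tau>: "0 < \<tau>" "\<tau> < T" using assms by auto
  have "0 \<le> air_energy c \<tau> * (energy c \<tau> - 3 / 2 * mass c \<tau>) / (mass c \<tau>)\<^sup>2"
    using frequency_air_term_ge[OF assms(1) \<tau>] by (meson order_trans zero_le_power2)
  moreover have "0 \<le> homogeneity_defect c \<tau> / mass c \<tau>"
    by (intro divide_nonneg_nonneg homogeneity_defect_nonneg mass_nonneg)
  ultimately have "0 \<le> (homogeneity_defect c \<tau> / mass c \<tau>
      + air_energy c \<tau> * (energy c \<tau> - 3 / 2 * mass c \<tau>) / (mass c \<tau>)\<^sup>2) / \<tau>"
    using \<tau>(1) by (intro divide_nonneg_pos[OF add_nonneg_nonneg])
  then show "\<exists>y. (frequency c has_real_derivative y) (at \<tau>) \<and> 0 \<le> y"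
    using DERIV_frequency[OF assms(1) \<tau>] by blast
qed

lemma frequency_pinching:
  assumes "center c T" "0 < a" "a < b" "b < T"
  obtains \<tau> where "a < \<tau>" "\<tau> < b"
    "homogeneity_defect c \<tau> \<le> b / (b - a) * (frequency c b - frequency c a) * mass c \<tau>"
    "(air_energy c \<tau>)\<^sup>2 \<le> b / (b - a) * (frequency c b - frequency c a) * (mass c \<tau>)\<^sup>2"
proof -
  define gap where "gap = b / (b - a) * (frequency c b - frequency c a)"
  define air_term where "air_term \<tau> = air_energy c \<tau> * (energy c \<tau> - 3 / 2 * mass c \<tau>) / (mass c \<tau>)\<^sup>2" for \<tau>
  have deriv: "(frequency c has_real_derivative (homogeneity_defect c \<tau> / mass c \<tau> + air_term \<tau>) / \<tau>) (at \<tau>)"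
    if "a \<le> \<tau>" "\<tau> \<le> b" for \<tau>
    unfolding air_term_def by (rule DERIV_frequency[OF assms(1)]) (use that assms in auto)
  obtain \<tau> where \<tau>: "a < \<tau>" "\<tau> < b"
    and mvt: "frequency c b - frequency c a = (b - a) * ((homogeneity_defect c \<tau> / mass c \<tau> + air_term \<tau>) / \<tau>)"
    using MVT2[OF assms(3) deriv] by blast
  have pos: "0 < \<tau>" "\<tau> < T" using \<tau> assms by auto
  have "mass c \<tau> > 0" using mass_pos[OF assms(1)] pos by simp
  have "homogeneity_defect c \<tau> / mass c \<tau> + air_term \<tau> = \<tau> / (b - a) * (frequency c b - frequency c a)"
    unfolding mvt using pos assms by simp
  also have "\<dots> \<le> gap"
    unfolding gap_def using \<tau> assms frequency_mono[OF assms(1,2), of b]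
    by (intro mult_right_mono divide_right_mono) auto
  finally have sum_le: "homogeneity_defect c \<tau> / mass c \<tau> + air_term \<tau> \<le> gap" .
  have air: "(air_energy c \<tau> / mass c \<tau>)\<^sup>2 \<le> air_term \<tau>"
    unfolding air_term_def by (rule frequency_air_term_ge[OF assms(1) pos])
  have defect: "0 \<le> homogeneity_defect c \<tau> / mass c \<tau>"
    by (intro divide_nonneg_nonneg homogeneity_defect_nonneg mass_nonneg)
  have "homogeneity_defect c \<tau> / mass c \<tau> \<le> gap" "(air_energy c \<tau> / mass c \<tau>)\<^sup>2 \<le> gap"
    using sum_le air defect zero_le_power2[of "air_energy c \<tau> / mass c \<tau>"] by linarith+
  then show ?thesis
    using \<open>mass c \<tau> > 0\<close> by (intro that[OF \<tau>]) (simp_all add: gap_def power_divide pos_divide_le_eq)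
qed

lemma DERIV_mass_mult_powr:
  assumes "center c T" "0 < \<tau>" "\<tau> < T"
  shows "((\<lambda>\<tau>. mass c \<tau> * \<tau> powr - (3 + \<Lambda>)) has_real_derivative
    (energy c \<tau> - \<Lambda> * mass c \<tau>) * \<tau> powr (- (3 + \<Lambda>) - 1)) (at \<tau>)"
proof (rule DERIV_mult_powr[OF _ assms(2)])
  have "admissible c T" using assms(1) by (simp add: center_def)
  then show "(mass c has_real_derivative ((3 + \<Lambda>) * mass c \<tau> + (energy c \<tau> - \<Lambda> * mass c \<tau>)) / \<tau>) (at \<tau>)"
    using DERIV_mass[OF _ assms(2,3)] by (simp add: algebra_simps)
qed

lemma mass_decay:
  assumes "center c T" "0 < a" "a \<le> b" "b < T"
  shows "mass c a \<le> mass c b * (a / b) powr (9 / 2)"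
proof -
  have "mass c a * a powr - (3 + 3 / 2) \<le> mass c b * b powr - (3 + 3 / 2)"
  proof (rule DERIV_nonneg_imp_nondecreasing[OF assms(3)])
    fix \<tau> assume "a \<le> \<tau>" "\<tau> \<le> b"
    then have \<tau>: "0 < \<tau>" "\<tau> < T" using assms by auto
    have "0 \<le> (energy c \<tau> - 3 / 2 * mass c \<tau>) * \<tau> powr (- (3 + 3 / 2) - 1)"
      using energy_lower_bound[OF assms(1) \<tau>] air_energy_nonneg[of c \<tau>] by (intro mult_nonneg_nonneg) auto
    then show "\<exists>y. ((\<lambda>\<tau>. mass c \<tau> * \<tau> powr - (3 + 3 / 2)) has_real_derivative y) (at \<tau>) \<and> 0 \<le> y"
      using DERIV_mass_mult_powr[OF assms(1) \<tau>] by blast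
  qed
  then show ?thesis using assms by (simp add: powr_minus powr_divide field_simps)
qed

lemma energy_le_mass:
  assumes "center c T" "0 < \<tau>" "2 * \<tau> < T"
  shows "energy c \<tau> \<le> 2 * mass c (2 * \<tau>)"
proof -
  have adm: "admissible c T" using assms(1) by (simp add: center_def)
  have deriv: "(mass c has_real_derivative (3 * mass c t + energy c t) / t) (at t)" if "\<tau> \<le> t" "t \<le> 2 * \<tau>" for t
    by (rule DERIV_mass[OF adm]) (use that assms in auto)
  have "\<tau> < 2 * \<tau>" using assms(2) by simp
  then obtain t where t: "\<tau> < t" "t < 2 * \<tau>"
    and mvt: "mass c (2 * \<tau>) - mass c \<tau> = (2 * \<tau> - \<tau>) * ((3 * mass c t + energy c t) / t)"
    using MVT2[OF _ deriv] by blast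
  have "energy c \<tau> \<le> energy c t"
    using t assms by (intro energy_mono center_admissible[OF assms(1)]) auto
  also have "\<dots> \<le> 3 * mass c t + energy c t" using mass_nonneg by simp
  finally have "\<tau> * (energy c \<tau> / (2 * \<tau>)) \<le> \<tau> * ((3 * mass c t + energy c t) / t)"
    using t assms energy_nonneg[of c \<tau>] energy_nonneg[of c t] mass_nonneg[of c t]
    by (intro mult_left_mono frac_le) auto
  then have "energy c \<tau> / 2 \<le> mass c (2 * \<tau>) - mass c \<tau>" using mvt assms by simp
  then show ?thesis using mass_nonneg[of c \<tau>] by simp
qed

lemma energy_minus_mass_le_air_energy:
  assumes "center c T" "0 < t" "t \<le> s" "s < T" and freq: "frequency c s \<le> \<Lambda>"
  shows "energy c t - \<Lambda> * mass c t \<le> air_energy c s"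
proof -
  have "frequency c t \<le> \<Lambda>" using frequency_mono[OF assms(1-4)] freq by linarith
  then have "energy c t - air_energy c t \<le> \<Lambda> * mass c t"
    using mass_pos[OF assms(1,2)] assms(3,4) by (simp add: frequency_def pos_divide_le_eq)
  moreover have "air_energy c t \<le> air_energy c s"
    using assms by (intro air_energy_mono center_admissible[OF assms(1)]) auto
  ultimately show ?thesis by linarith
qed

lemma mass_doubling:
  assumes "center c T" "0 < t" "t < s" "s < T"
    and freq: "frequency c s \<le> \<Lambda>" and air: "air_energy c s \<le> \<delta> * mass c s"
  shows "mass c s * ((t / s) powr (3 + \<Lambda>) - \<delta> * (s / t)) \<le> mass c t"
proof -
  let ?f = "\<lambda>\<tau>. mass c \<tau> * \<tau> powr - (3 + \<Lambda>)" and ?p = "- (3 + \<Lambda>) - 1"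
  have rhs_nonneg: "0 \<le> \<delta> * mass c s" using air air_energy_nonneg order_trans by blast
  have "\<Lambda> \<ge> 3 / 2" using frequency_ge[OF assms(1), of s] freq assms by simp
  have deriv: "(?f has_real_derivative (energy c \<tau> - \<Lambda> * mass c \<tau>) * \<tau> powr ?p) (at \<tau>)" if "t \<le> \<tau>" "\<tau> \<le> s" for \<tau>
    by (rule DERIV_mass_mult_powr[OF assms(1)]) (use that assms in auto)
  obtain \<tau> where \<tau>: "t < \<tau>" "\<tau> < s"
    and mvt: "?f s - ?f t = (s - t) * ((energy c \<tau> - \<Lambda> * mass c \<tau>) * \<tau> powr ?p)"
    using MVT2[OF assms(3) deriv] by blast
  have "energy c \<tau> - \<Lambda> * mass c \<tau> \<le> \<delta> * mass c s"
    using energy_minus_mass_le_air_energy[OF assms(1) _ _ assms(4) freq, of \<tau>] \<tau> assms(2) air by simp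
  then have "(energy c \<tau> - \<Lambda> * mass c \<tau>) * \<tau> powr ?p \<le> \<delta> * mass c s * \<tau> powr ?p"
    by (intro mult_right_mono) auto
  also have "\<dots> \<le> \<delta> * mass c s * t powr ?p"
    using \<tau> assms(2) \<open>\<Lambda> \<ge> 3 / 2\<close> rhs_nonneg by (intro mult_left_mono powr_mono2') auto
  finally have "(s - t) * ((energy c \<tau> - \<Lambda> * mass c \<tau>) * \<tau> powr ?p) \<le> (s - t) * (\<delta> * mass c s * t powr ?p)"
    using assms(3) by (intro mult_left_mono) auto
  also have "\<dots> \<le> s * (\<delta> * mass c s * t powr ?p)"
    using assms(2) rhs_nonneg by (intro mult_right_mono) auto
  finally have "(s - t) * ((energy c \<tau> - \<Lambda> * mass c \<tau>) * \<tau> powr ?p) \<le> s * (\<delta> * mass c s * t powr ?p)" .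
  then have "?f s - s * (\<delta> * mass c s * t powr ?p) \<le> ?f t" using mvt by linarith
  then have "(?f s - s * (\<delta> * mass c s * t powr ?p)) * t powr (3 + \<Lambda>) \<le> ?f t * t powr (3 + \<Lambda>)"
    by (rule mult_right_mono) simp
  also have "?f t * t powr (3 + \<Lambda>) = mass c t"
    using assms(2) by (simp add: mult.assoc powr_add[symmetric])
  also have "(?f s - s * (\<delta> * mass c s * t powr ?p)) * t powr (3 + \<Lambda>)
      = mass c s * ((t / s) powr (3 + \<Lambda>) - \<delta> * (s / t))"
  proof -
    have "t powr ?p * t powr (3 + \<Lambda>) = 1 / t"
      using assms(2) by (simp add: powr_add[symmetric] powr_minus_divide)
    moreover have "s powr - (3 + \<Lambda>) * t powr (3 + \<Lambda>) = (t / s) powr (3 + \<Lambda>)"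
      using assms unfolding powr_minus_divide by (simp add: powr_divide)
    ultimately show ?thesis by (simp add: left_diff_distrib mult.assoc) (simp add: algebra_simps)
  qed
  finally show ?thesis .
qed

lemma frequency_small_gap:
  assumes "center c T" "\<epsilon> > 0"
  obtains t where "0 < t" "t < T" "\<And>a b. 0 < a \<Longrightarrow> a \<le> b \<Longrightarrow> b \<le> t \<Longrightarrow> frequency c b - frequency c a < \<epsilon>"
proof -
  have "T > 0" using assms(1) by (simp add: center_def admissible_def)
  let ?F = "frequency c ` {0<..<T}"
  have bdd: "bdd_below ?F" using frequency_ge[OF assms(1)] by (intro bdd_belowI[of _ "3 / 2"]) auto
  have "?F \<noteq> {}" using \<open>T > 0\<close> by simp
  then have "\<exists>y\<in>?F. y < Inf ?F + \<epsilon>" using assms(2) by (intro cInf_lessD) auto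
  then obtain t where t: "0 < t" "t < T" "frequency c t < Inf ?F + \<epsilon>" by auto
  show ?thesis
  proof (rule that[OF t(1,2)])
    fix a b assume ab: "0 < a" "a \<le> b" "b \<le> t"
    have "frequency c b \<le> frequency c t" using ab t by (intro frequency_mono[OF assms(1)]) auto
    moreover have "Inf ?F \<le> frequency c a" using ab t by (intro cInf_lower[OF _ bdd]) auto
    ultimately show "frequency c b - frequency c a < \<epsilon>" using t(3) by linarith
  qed
qed

end

subsection \<open>Radial integrals in the plane\<close>

lemma distr_power2_norm_diff:
  fixes c :: pt
  shows "distr lborel borel (\<lambda>x. (norm (x - c))\<^sup>2) = density lborel (\<lambda>s. ennreal (pi * indicator {0..} s))" (is "?L = ?R")
proof (rule measure_eqI_generator_eq[where E="range atMost" and \<Omega>=UNIV and A="\<lambda>i. {..real i}"])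
  have emeasure_L: "emeasure ?L {..t} = ennreal (pi * max 0 t)" for t
  proof -
    have "emeasure ?L {..t} = emeasure lborel {x. (norm (x - c))\<^sup>2 \<le> t}"
      by (simp add: emeasure_distr vimage_def)
    also have "\<dots> = ennreal (pi * max 0 t)"
    proof (cases "t \<ge> 0")
      case True
      then have "{x. (norm (x - c))\<^sup>2 \<le> t} = cball c (sqrt t)"
        using mem_cball_iff_power2_norm[of "sqrt t" _ c] by (auto simp del: mem_cball)
      then show ?thesis using True emeasure_cball[of "sqrt t" c] unit_ball_vol_2 by simp
    next
      case False
      then have "{x. (norm (x - c))\<^sup>2 \<le> t} = {}" by (auto dest: order_trans[OF zero_le_power2])
      then show ?thesis using False by simp
    qed
    finally show ?thesis .
  qed
  have emeasure_R: "emeasure ?R {..t} = ennreal (pi * max 0 t)" for t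
  proof -
    have "emeasure ?R {..t} = (\<integral>\<^sup>+s. ennreal pi * indicator {0..t} s \<partial>lborel)"
      by (subst emeasure_density) (auto intro!: nn_integral_cong simp: indicator_def)
    also have "\<dots> = ennreal pi * emeasure lborel {0..t}" by (rule nn_integral_cmult_indicator) simp
    also have "\<dots> = ennreal (pi * max 0 t)" by (cases "t \<ge> 0") (simp_all add: ennreal_mult')
    finally show ?thesis .
  qed
  show "emeasure ?L X = emeasure ?R X" if "X \<in> range atMost" for X
    using that emeasure_L emeasure_R by auto
  show "emeasure ?L {..real i} \<noteq> \<infinity>" for i by (simp add: emeasure_L)
  show "Int_stable (range (atMost :: real \<Rightarrow> _))" by (auto simp: Int_stable_def)
  show "(\<Union>i. {..real i}) = UNIV" using real_arch_simple by auto
  show "sets ?L = sigma_sets UNIV (range atMost)" "sets ?R = sigma_sets UNIV (range atMost)"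
    by (simp_all add: borel_eq_atMost)
qed auto

lemma has_bochner_integral_radial:
  fixes f :: "real \<Rightarrow> real" and c :: pt
  assumes [measurable]: "f \<in> borel_measurable borel"
    and f: "has_bochner_integral lborel (\<lambda>s. indicator {0..} s * f s) I"
  shows "has_bochner_integral lborel (\<lambda>x. f ((norm (x - c))\<^sup>2)) (pi * I)"
proof -
  have "has_bochner_integral lborel (\<lambda>s. (pi * indicator {0..} s) *\<^sub>R f s) (pi * I)"
    using has_bochner_integral_mult_right[OF f, of pi] by (simp add: mult.assoc)
  then have "has_bochner_integral (distr lborel borel (\<lambda>x. (norm (x - c))\<^sup>2)) f (pi * I)"
    unfolding distr_power2_norm_diff by (intro has_bochner_integral_density) auto
  then show ?thesis
    unfolding has_bochner_integral_iff by (simp add: integrable_distr_eq integral_distr)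
qed

lemma has_bochner_integral_pos_power_tail:
  assumes "n > 0"
  shows "has_bochner_integral lborel (\<lambda>s. indicator {a<..} s * pos_power n (\<tau> - s)) (pos_power (n + 1) (\<tau> - a) / (n + 1))"
proof (cases "a \<le> \<tau>")
  case True
  have antiderivative: "((\<lambda>s. - ((\<tau> - s) ^ (n + 1) / (n + 1))) has_real_derivative (\<tau> - s) ^ n) (at s)" for s
  proof -
    have "((\<lambda>s. \<tau> - s) has_real_derivative - 1) (at s)" by (auto intro!: derivative_eq_intros)
    from DERIV_minus[OF DERIV_cdivide[OF DERIV_power_Suc[OF this, of n], of "1 + real n"]] show ?thesis
      by (simp add: add.commute)
  qed
  have "has_bochner_integral lborel (\<lambda>s. (\<tau> - s) ^ n * indicator {a..\<tau>} s)
      (- ((\<tau> - \<tau>) ^ (n + 1) / (n + 1)) - - ((\<tau> - a) ^ (n + 1) / (n + 1)))"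
    by (rule has_bochner_integral_FTC_Icc_real[OF True antiderivative]) (auto intro!: continuous_intros)
  moreover have "AE s in lborel. (\<tau> - s) ^ n * indicator {a..\<tau>} s = indicator {a<..} s * pos_power n (\<tau> - s)"
    using AE_lborel_singleton[of a]
    by eventually_elim (auto simp: indicator_def pos_power_eq_power pos_power_eq_0[OF _ assms])
  ultimately show ?thesis
    using True by (subst has_bochner_integral_cong_AE[symmetric]) (auto simp: pos_power_eq_power pos_power_def)
next
  case False
  then have zero: "indicator {a<..} s * pos_power n (\<tau> - s) = 0" for s
    using assms by (cases "a < s") (simp_all add: pos_power_eq_0)
  show ?thesis unfolding zero using False by (simp add: pos_power_eq_0 has_bochner_integral_zero)
qed

lemma has_bochner_integral_ball_kernel_tail:
  fixes c :: pt
  assumes "0 \<le> a" "n > 0"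
  shows "has_bochner_integral lborel (\<lambda>x. indicator {x. a < norm (x - c)} x * ball_kernel n c \<tau> x)
    (pi * (pos_power (n + 1) (\<tau> - a\<^sup>2) / (n + 1)))"
proof -
  have "indicator {x. a < norm (x - c)} x * ball_kernel n c \<tau> x
      = indicator {a\<^sup>2<..} ((norm (x - c))\<^sup>2) * pos_power n (\<tau> - (norm (x - c))\<^sup>2)" for x
    using assms(1) power2_less_imp_less[of a "norm (x - c)"] power_strict_mono[of a "norm (x - c)" 2]
    by (auto simp: ball_kernel_def indicator_def)
  moreover have clip: "indicator {0..} s * (indicator {a\<^sup>2<..} s * pos_power n (\<tau> - s))
      = indicator {a\<^sup>2<..} s * pos_power n (\<tau> - s)" for s
    by (auto simp: indicator_def dest: order_le_less_trans[OF zero_le_power2])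
  have "has_bochner_integral lborel (\<lambda>s. indicator {0..} s * (indicator {a\<^sup>2<..} s * pos_power n (\<tau> - s)))
      (pos_power (n + 1) (\<tau> - a\<^sup>2) / (n + 1))"
    unfolding clip by (rule has_bochner_integral_pos_power_tail[OF assms(2)])
  from has_bochner_integral_radial[OF _ this, of c] have "has_bochner_integral lborel
      (\<lambda>x. indicator {a\<^sup>2<..} ((norm (x - c))\<^sup>2) * pos_power n (\<tau> - (norm (x - c))\<^sup>2))
      (pi * (pos_power (n + 1) (\<tau> - a\<^sup>2) / (n + 1)))"
    by (simp add: pos_power_def)
  ultimately show ?thesis by simp
qed

lemma integrable_pair_mult:
  fixes f :: "'a::euclidean_space \<Rightarrow> real" and g :: "'b::euclidean_space \<Rightarrow> real"
  assumes f: "integrable lborel f" and g: "integrable lborel g"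
  shows "integrable (lborel \<Otimes>\<^sub>M lborel) (\<lambda>(x, y). f x * g y)"
proof (rule lborel_pair.Fubini_integrable)
  have [measurable]: "f \<in> borel_measurable borel" "g \<in> borel_measurable borel"
    using borel_measurable_integrable[OF f] borel_measurable_integrable[OF g] by simp_all
  show "(\<lambda>(x, y). f x * g y) \<in> borel_measurable (lborel \<Otimes>\<^sub>M lborel)" by measurable
qed (use f g in \<open>auto simp: abs_mult intro!: integrable_mult_left integrable_abs\<close>)

lemma has_bochner_integral_ball_integral_kernel:
  fixes F :: "pt \<Rightarrow> real"
  assumes F: "integrable lborel F" and "n > 0"
  shows "has_bochner_integral lborel (\<lambda>x. (LINT y:ball c (norm (x - c))|lborel. F y) * ball_kernel n c \<tau> x)
    (pi / (n + 1) * (\<integral>y. F y * ball_kernel (n + 1) c \<tau> y \<partial>lborel))"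
proof -
  define G where "G x y = (if norm (y - c) < norm (x - c) then 1 else 0) * (ball_kernel n c \<tau> x * F y)" for x y
  have [measurable]: "F \<in> borel_measurable borel" using borel_measurable_integrable[OF F] by simp
  have "integrable lborel (\<lambda>x. 1 * ball_kernel n c \<tau> x)"
    by (rule integrable_mult_ball_kernel[OF locally_integrable_continuous _ \<open>n > 0\<close>]) auto
  then have "integrable (lborel \<Otimes>\<^sub>M lborel) (\<lambda>(x, y). ball_kernel n c \<tau> x * F y)"
    using F by (intro integrable_pair_mult) simp_all
  then have int: "integrable (lborel \<Otimes>\<^sub>M lborel) (\<lambda>(x, y). G x y)"
    unfolding G_def by (rule Bochner_Integration.integrable_bound) (measurable, auto)
  have "(\<integral>y. G x y \<partial>lborel) = (LINT y:ball c (norm (x - c))|lborel. F y) * ball_kernel n c \<tau> x" for x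
  proof -
    have "(\<lambda>y. G x y) = (\<lambda>y. indicator (ball c (norm (x - c))) y *\<^sub>R F y * ball_kernel n c \<tau> x)"
      by (auto simp: fun_eq_iff G_def indicator_def dist_norm norm_minus_commute)
    then show ?thesis by (simp add: set_lebesgue_integral_def)
  qed
  moreover have "(\<integral>x. G x y \<partial>lborel) = pi / (n + 1) * (F y * ball_kernel (n + 1) c \<tau> y)" for y
  proof -
    have "(\<lambda>x. G x y) = (\<lambda>x. F y * (indicator {x. norm (y - c) < norm (x - c)} x * ball_kernel n c \<tau> x))"
      by (auto simp: fun_eq_iff G_def indicator_def)
    then show ?thesis
      using has_bochner_integral_integral_eq[OF
          has_bochner_integral_ball_kernel_tail[OF norm_ge_zero[of "y - c"] \<open>n > 0\<close>, of c \<tau>]]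
      by (simp add: ball_kernel_def)
  qed
  ultimately show ?thesis
    using lborel_pair.integrable_fst'[OF int] lborel_pair.Fubini_integral[OF int]
    by (simp add: has_bochner_integral_iff)
qed

subsection \<open>Averages over circles\<close>

lemma has_bochner_integral_orthogonal:
  fixes f :: "real ^ 'n::{finite, wellorder} \<Rightarrow> real"
    and R :: "real ^ 'n::{finite, wellorder} \<Rightarrow> real ^ 'n::{finite, wellorder}"
  assumes R: "orthogonal_transformation R" and f: "has_bochner_integral lborel f I"
  shows "has_bochner_integral lborel (\<lambda>x. f (R x)) I"
proof -
  have R_measurable [measurable]: "R \<in> borel_measurable borel"
    using R by (intro borel_measurable_continuous_onI linear_continuous_on)
      (simp add: orthogonal_transformation_def linear_conv_bounded_linear)
  have "distr lborel borel R = lborel"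
  proof (rule lborel_eqI[symmetric])
    fix l u :: "real ^ 'n::{finite, wellorder}" assume lu: "\<And>b. b \<in> Basis \<Longrightarrow> l \<bullet> b \<le> u \<bullet> b"
    have inv: "orthogonal_transformation (inv R)" by (rule orthogonal_transformation_inv[OF R])
    have vimage: "R -` box l u = inv R ` box l u"
      by (rule bij_vimage_eq_inv_image[OF orthogonal_transformation_bij[OF R]])
    have "R -` box l u \<in> sets borel" using measurable_sets[OF R_measurable, of "box l u"] by simp
    then have "emeasure (distr lborel borel R) (box l u) = emeasure lebesgue (R -` box l u)"
      by (simp add: emeasure_distr)
    also have "\<dots> = emeasure lebesgue (box l u)"
      unfolding vimage using measurable_orthogonal_image[OF inv] measure_orthogonal_image[OF inv]
      by (simp add: emeasure_eq_measure2 fmeasurableD2)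
    also have "\<dots> = ennreal (prod ((\<bullet>) (u - l)) Basis)" using emeasure_lborel_box[OF lu] by simp
    finally show "emeasure (distr lborel borel R) (box l u) = ennreal (prod ((\<bullet>) (u - l)) Basis)" .
  qed simp
  then have "has_bochner_integral (distr lborel borel R) f I" using f by simp
  moreover have "f \<in> borel_measurable borel" using f by (auto simp: has_bochner_integral_iff)
  ultimately show ?thesis unfolding has_bochner_integral_iff by (simp add: integrable_distr_eq integral_distr)
qed

definition rot :: "real \<Rightarrow> pt \<Rightarrow> pt" where
  "rot \<theta> y = (cos \<theta> * y $ 1 - sin \<theta> * y $ 2) *\<^sub>R axis 1 1 + (sin \<theta> * y $ 1 + cos \<theta> * y $ 2) *\<^sub>R axis 2 1"

lemma rot_nth [simp]: "rot \<theta> y $ 1 = cos \<theta> * y $ 1 - sin \<theta> * y $ 2" "rot \<theta> y $ 2 = sin \<theta> * y $ 1 + cos \<theta> * y $ 2"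
  by (simp_all add: rot_def axis_def)

lemma rot_rot: "rot s (rot t y) = rot (s + t) y"
  by (simp add: vec_eq_iff forall_2 cos_add sin_add algebra_simps)

lemma norm_rot [simp]: "norm (rot \<theta> y) = norm y"
proof -
  have "(cos \<theta> * y $ 1 - sin \<theta> * y $ 2)\<^sup>2 + (sin \<theta> * y $ 1 + cos \<theta> * y $ 2)\<^sup>2
      = ((sin \<theta>)\<^sup>2 + (cos \<theta>)\<^sup>2) * ((y $ 1)\<^sup>2 + (y $ 2)\<^sup>2)"
    by algebra
  then have "(norm (rot \<theta> y))\<^sup>2 = (norm y)\<^sup>2" by (simp add: power2_norm_pt)
  then show ?thesis by simp
qed

lemma orthogonal_transformation_rot: "orthogonal_transformation (rot \<theta>)"
  unfolding orthogonal_transformation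
  by (auto intro!: linearI simp: vec_eq_iff forall_2 algebra_simps)

lemma continuous_on_rot: "continuous_on S (\<lambda>\<theta>. rot \<theta> y)"
  unfolding rot_def by (intro continuous_intros)

lemma rot_measurable [measurable]: "(\<lambda>z. rot (fst z) (snd z)) \<in> borel_measurable (borel \<Otimes>\<^sub>M borel)"
  unfolding rot_def by measurable

lemma polar_coordinates:
  obtains \<alpha> where "0 \<le> \<alpha>" "\<alpha> \<le> 2 * pi" "y = rot \<alpha> (norm y *\<^sub>R axis 1 1)"
proof (cases "y = 0")
  case True
  then show ?thesis using that[of 0] by (simp add: vec_eq_iff forall_2)
next
  case False
  have "(y $ 1 / norm y)\<^sup>2 + (y $ 2 / norm y)\<^sup>2 = 1"
    unfolding power_divide add_divide_distrib[symmetric] power2_norm_pt[symmetric] using False by simp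
  then obtain t where t: "0 \<le> t" "t < 2 * pi" and angle: "y $ 1 / norm y = cos t" "y $ 2 / norm y = sin t"
    by (rule sincos_total_2pi)
  have "y $ 1 = norm y * cos t" "y $ 2 = norm y * sin t" unfolding angle[symmetric] using False by simp_all
  then show ?thesis using t by (intro that[of t]) (simp_all add: vec_eq_iff forall_2 axis_def mult.commute)
qed

lemma integral_periodic_shift:
  fixes F :: "real \<Rightarrow> real"
  assumes cont: "continuous_on UNIV F" and periodic: "\<And>t. F (t + T) = F t" and \<alpha>: "0 \<le> \<alpha>" "\<alpha> \<le> T"
  shows "integral {0..T} (\<lambda>t. F (t + \<alpha>)) = integral {0..T} F"
proof -
  have int: "F integrable_on {a..b}" for a b
    by (rule integrable_continuous_interval[OF continuous_on_subset[OF cont]]) simp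
  have shift: "integral {a..b} (\<lambda>t. F (t + d)) = integral {a + d..b + d} F" for a b d
    using integral_shift[of a d b F] continuous_on_subset[OF cont] by (simp add: o_def)
  have "integral {0..T} (\<lambda>t. F (t + \<alpha>)) = integral {\<alpha>..T + \<alpha>} F" using shift[of 0 T \<alpha>] by simp
  also have "\<dots> = integral {\<alpha>..T} F + integral {T..T + \<alpha>} F"
    by (rule Henstock_Kurzweil_Integration.integral_combine[symmetric]) (use \<alpha> int in auto)
  also have "integral {T..T + \<alpha>} F = integral {0..\<alpha>} F"
    using shift[of 0 \<alpha> T] by (simp add: periodic add.commute)
  also have "integral {\<alpha>..T} F + integral {0..\<alpha>} F = integral {0..T} F"
    using Henstock_Kurzweil_Integration.integral_combine[of 0 \<alpha> T F] \<alpha> int by simp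
  finally show ?thesis .
qed

definition circle_integral :: "(pt \<Rightarrow> real) \<Rightarrow> pt \<Rightarrow> real \<Rightarrow> real" where
  "circle_integral f c r = integral {0..2 * pi} (\<lambda>\<theta>. f (c + rot \<theta> (r *\<^sub>R axis 1 1)))"

lemma continuous_on_circle:
  assumes "continuous_on (sphere c (norm y)) f"
  shows "continuous_on S (\<lambda>\<theta>. f (c + rot \<theta> y))"
  by (rule continuous_on_compose2[OF assms]) (auto intro!: continuous_intros continuous_on_rot simp: dist_norm)

lemma has_bochner_integral_circle:
  assumes f: "continuous_on (sphere c (norm y)) f"
  shows "has_bochner_integral lborel (\<lambda>\<theta>. indicator {0..2 * pi} \<theta> * f (c + rot \<theta> y)) (circle_integral f c (norm y))"
proof -
  let ?e = "norm y *\<^sub>R axis 1 1 :: pt"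
  obtain \<alpha> where \<alpha>: "0 \<le> \<alpha>" "\<alpha> \<le> 2 * pi" "y = rot \<alpha> ?e" by (rule polar_coordinates) blast
  have rot: "rot \<theta> y = rot (\<theta> + \<alpha>) ?e" for \<theta> using \<alpha>(3) rot_rot by metis
  have int: "set_integrable lborel {0..2 * pi} (\<lambda>\<theta>. f (c + rot \<theta> y))"
    unfolding set_integrable_def by (rule borel_integrable_compact[OF compact_Icc continuous_on_circle[OF f]])
  have "integral {0..2 * pi} (\<lambda>\<theta>. f (c + rot \<theta> y)) = circle_integral f c (norm y)"
    unfolding circle_integral_def rot
  proof (rule integral_periodic_shift[OF _ _ \<alpha>(1,2)])
    show "continuous_on UNIV (\<lambda>\<theta>. f (c + rot \<theta> ?e))" by (rule continuous_on_circle) (use f in simp)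
  qed (simp add: rot_def)
  then show ?thesis
    using int set_borel_integral_eq_integral(2)[OF int]
    by (simp add: has_bochner_integral_iff set_integrable_def set_lebesgue_integral_def)
qed

lemma has_bochner_integral_rotation_average:
  assumes V: "integrable lborel V"
  shows "has_bochner_integral lborel (\<lambda>y. \<integral>\<theta>. indicator {0..2 * pi} \<theta> * V (rot \<theta> y) \<partial>lborel) (2 * pi * integral\<^sup>L lborel V)"
proof -
  let ?G = "\<lambda>\<theta> y. indicator {0..2 * pi} \<theta> * V (rot \<theta> y) :: real"
  have [measurable]: "V \<in> borel_measurable borel" using borel_measurable_integrable[OF V] by simp
  have rotated: "integrable lborel (\<lambda>y. V (rot \<theta> y))" "(\<integral>y. V (rot \<theta> y) \<partial>lborel) = integral\<^sup>L lborel V"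
    "(\<integral>y. \<bar>V (rot \<theta> y)\<bar> \<partial>lborel) = (\<integral>y. \<bar>V y\<bar> \<partial>lborel)" for \<theta>
    using has_bochner_integral_orthogonal[OF orthogonal_transformation_rot has_bochner_integral_integrable[OF V]]
      has_bochner_integral_orthogonal[OF orthogonal_transformation_rot
          has_bochner_integral_integrable[OF integrable_abs[OF V]]]
    by (simp_all add: has_bochner_integral_iff)
  have arc: "integrable lborel (indicator {0..2 * pi} :: real \<Rightarrow> real)" by (simp add: integrable_real_indicator)
  have int: "integrable (lborel \<Otimes>\<^sub>M lborel) (\<lambda>(\<theta>, y). ?G \<theta> y)"
  proof (rule lborel_pair.Fubini_integrable)
    have "(\<lambda>z. indicator {0..2 * pi} (fst z) * V (rot (fst z) (snd z))) \<in> borel_measurable (borel \<Otimes>\<^sub>M borel)" by measurable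
    then show "(\<lambda>(\<theta>, y). ?G \<theta> y) \<in> borel_measurable (lborel \<Otimes>\<^sub>M lborel)" by (simp add: case_prod_beta')
  qed (use arc in \<open>simp_all add: abs_mult rotated\<close>)
  have "(\<integral>y. \<integral>\<theta>. ?G \<theta> y \<partial>lborel \<partial>lborel) = (\<integral>\<theta>. \<integral>y. ?G \<theta> y \<partial>lborel \<partial>lborel)"
    by (rule lborel_pair.Fubini_integral[OF int])
  also have "\<dots> = 2 * pi * integral\<^sup>L lborel V" by (simp add: rotated)
  finally show ?thesis
    using lborel_pair.integrable_snd[OF int] by (simp add: has_bochner_integral_iff)
qed

lemma has_bochner_integral_circle_integral_kernel:
  assumes f: "continuous_on (cball c (sqrt \<tau>)) f" and "n > 0"
  shows "has_bochner_integral lborel (\<lambda>x. circle_integral f c (norm (x - c)) * ball_kernel n c \<tau> x)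
    (2 * pi * kernel_integral n f c \<tau>)"
proof -
  let ?V = "\<lambda>y. f (c + y) * ball_kernel n c \<tau> (c + y)"
  have kernel: "ball_kernel n c \<tau> (c + y) = pos_power n (\<tau> - (norm y)\<^sup>2)" for y by (simp add: ball_kernel_def)
  have "has_bochner_integral lborel (\<lambda>x. f x * ball_kernel n c \<tau> x) (kernel_integral n f c \<tau>)"
    by (rule has_bochner_integral_ball_kernel[OF locally_integrable_continuous[OF f] order_refl \<open>n > 0\<close>])
  then have V: "has_bochner_integral lborel ?V (kernel_integral n f c \<tau>)" by (rule has_bochner_integral_lborel_translate)
  have "(\<integral>\<theta>. indicator {0..2 * pi} \<theta> * ?V (rot \<theta> y) \<partial>lborel)
      = circle_integral f c (norm y) * ball_kernel n c \<tau> (c + y)" for y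
  proof (cases "c + y \<in> cball c (sqrt \<tau>)")
    case True
    then have "sphere c (norm y) \<subseteq> cball c (sqrt \<tau>)" by (auto simp: dist_norm)
    from has_bochner_integral_circle[OF continuous_on_subset[OF f this]]
    have "has_bochner_integral lborel (\<lambda>\<theta>. indicator {0..2 * pi} \<theta> * f (c + rot \<theta> y) * ball_kernel n c \<tau> (c + y))
        (circle_integral f c (norm y) * ball_kernel n c \<tau> (c + y))"
      by (rule has_bochner_integral_mult_left)
    from has_bochner_integral_integral_eq[OF this] show ?thesis by (simp add: kernel mult.assoc)
  next
    case False
    then have "ball_kernel n c \<tau> (c + y) = 0" by (rule ball_kernel_eq_0[OF \<open>n > 0\<close> order_refl])
    then show ?thesis by (simp add: kernel)
  qed
  then have "has_bochner_integral lborel (\<lambda>y. circle_integral f c (norm y) * ball_kernel n c \<tau> (c + y))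
      (2 * pi * kernel_integral n f c \<tau>)"
    using has_bochner_integral_rotation_average[of ?V] V by (simp add: has_bochner_integral_iff)
  from has_bochner_integral_lborel_translate[OF this, of "- c"] show ?thesis by simp
qed

subsection \<open>Comparison with the boundary-adjusted energy\<close>

lemma integral_lborel_affine:
  fixes f :: "'a::euclidean_space \<Rightarrow> real"
  assumes [measurable]: "f \<in> borel_measurable borel" and "t \<noteq> 0"
  shows "(\<integral>x. f x \<partial>lborel) = \<bar>t\<bar> ^ DIM('a) * (\<integral>x. f (c + t *\<^sub>R x) \<partial>lborel)"
proof -
  have "(\<integral>x. f x \<partial>lborel) = (\<integral>x. f x \<partial>density (distr lborel borel (\<lambda>x. c + t *\<^sub>R x)) (\<lambda>_. ennreal (\<bar>t\<bar> ^ DIM('a))))"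
    using lborel_affine[OF assms(2), of c] by simp
  also have "\<dots> = (\<integral>x. \<bar>t\<bar> ^ DIM('a) *\<^sub>R f x \<partial>distr lborel borel (\<lambda>x. c + t *\<^sub>R x))"
    by (rule integral_density) auto
  also have "\<dots> = (\<integral>x. \<bar>t\<bar> ^ DIM('a) *\<^sub>R f (c + t *\<^sub>R x) \<partial>lborel)"
    by (rule integral_distr) auto
  finally show ?thesis by simp
qed

definition half_disc_moment :: real where
  "half_disc_moment = (LINT x:ball (0::pt) 1|lebesgue. max (x $ 2) 0)"

lemma half_disc_moment_scaling:
  fixes c :: pt
  assumes t: "t > 0" and c: "c $ 2 = 0"
  shows "(LINT x:ball c t|lborel. max (x $ 2) 0) = t ^ 3 * half_disc_moment"
proof -
  let ?f = "\<lambda>x. indicator (ball c t) x * max (x $ 2) 0"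
  have "?f (c + t *\<^sub>R x) = t * (indicator (ball 0 1) x * max (x $ 2) 0)" for x
    using t c by (auto simp: indicator_def dist_norm max_def zero_le_mult_iff mult_le_0_iff)
  moreover have "?f \<in> borel_measurable borel"
    by (intro borel_measurable_times borel_measurable_indicator borel_measurable_max borel_measurable_vec_nth) simp_all
  ultimately have "(\<integral>x. ?f x \<partial>lborel) = t ^ 3 * (\<integral>x. indicator (ball (0::pt) 1) x * max (x $ 2) 0 \<partial>lborel)"
    using integral_lborel_affine[of ?f t c] t by (simp add: power2_eq_square power3_eq_cube)
  moreover have "half_disc_moment = (LINT x:ball (0::pt) 1|lborel. max (x $ 2) 0)"
    unfolding half_disc_moment_def by (rule set_lebesgue_integral_eq_lborel(1)) (auto intro: borel_measurable_vec_nth)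
  ultimately show ?thesis by (simp add: set_lebesgue_integral_def)
qed

context free_boundary_solution
begin

definition net_density :: "pt \<Rightarrow> real" where
  "net_density x = energy_density x - air_density x"

lemma net_density_locally_integrable: "locally_integrable \<Omega> net_density"
  unfolding net_density_def[abs_def]
  by (intro locally_integrable_diff energy_density_locally_integrable air_density_locally_integrable)

lemma ball_energy_eq:
  assumes sub: "cball c t \<subseteq> \<Omega>" and c: "c $ 2 = 0" and t: "0 < t"
  shows "(LINT x:ball c t|lebesgue. (norm (g x))\<^sup>2 + x $ 2 * chi_pos u x)
    = (LINT x:ball c t|lborel. net_density x) + t ^ 3 * half_disc_moment"
proof -
  have ball: "x \<in> \<Omega>" if "x \<in> ball c t" for x using that sub by auto
  have int: "set_integrable lborel (ball c t) f" if "locally_integrable \<Omega> f" for f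
    by (rule set_integrable_subset[OF locally_integrableD[OF that compact_cball sub]]) auto
  have fluid_part: "x $ 2 * indicator fluid x = max (x $ 2) 0 - air_density x" if "x \<in> \<Omega>" for x
    using that fluid_above[of x] by (auto simp: air_density_def air_eq indicator_def)
  have "(LINT x:ball c t|lebesgue. (norm (g x))\<^sup>2 + x $ 2 * chi_pos u x)
      = (LINT x:ball c t|lborel. net_density x + max (x $ 2) 0)"
  proof (rule set_lebesgue_integral_eq_lborel(1))
    show "AE x in lborel. x \<in> ball c t \<longrightarrow> (norm (g x))\<^sup>2 + x $ 2 * chi_pos u x = net_density x + max (x $ 2) 0"
      using AE_g_eq_grad
    proof eventually_elim
      case (elim x)
      have "chi_pos u x = indicator fluid x" if "x \<in> \<Omega>" using that by (simp add: chi_pos_def fluid_def)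
      then show ?case using elim fluid_part[of x] ball[of x] by (auto simp: net_density_def energy_density_def)
    qed
  qed (auto simp: net_density_def)
  also have "\<dots> = (LINT x:ball c t|lborel. net_density x) + (LINT x:ball c t|lborel. max (x $ 2) 0)"
    by (intro set_integral_add int net_density_locally_integrable locally_integrable_continuous continuous_intros)
  finally show ?thesis by (simp only: half_disc_moment_scaling[OF t c])
qed

lemma circle_term_eq:
  assumes sub: "cball c t \<subseteq> \<Omega>" and t: "0 < t"
  shows "(LBINT s=0..2 * pi. (u (c + t *\<^sub>R vector [cos s, sin s]))\<^sup>2 * t) = t * circle_integral (\<lambda>x. (u_ext x)\<^sup>2) c t"
proof -
  let ?e = "t *\<^sub>R axis 1 1 :: pt"
  have "norm ?e = t" using t by simp
  have point: "c + t *\<^sub>R vector [cos s, sin s] = c + rot s ?e" for s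
    by (simp add: vec_eq_iff forall_2 axis_def)
  have "c + rot s ?e \<in> \<Omega>" for s by (rule subsetD[OF sub]) (use t in \<open>simp add: dist_norm\<close>)
  then have "u (c + rot s ?e) = u_ext (c + rot s ?e)" for s by (simp add: u_ext_def)
  then have "(LBINT s=ereal 0..ereal (2 * pi). (u (c + t *\<^sub>R vector [cos s, sin s]))\<^sup>2 * t)
      = (LBINT s:{0..2 * pi}. (u_ext (c + rot s ?e))\<^sup>2 * t)"
    unfolding point by (subst interval_integral_Icc) simp_all
  also have "\<dots> = t * (\<integral>s. indicator {0..2 * pi} s * (u_ext (c + rot s ?e))\<^sup>2 \<partial>lborel)"
    by (simp add: set_lebesgue_integral_def mult.commute mult.left_commute)
  also have "(\<integral>s. indicator {0..2 * pi} s * (u_ext (c + rot s ?e))\<^sup>2 \<partial>lborel) = circle_integral (\<lambda>x. (u_ext x)\<^sup>2) c t"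
  proof -
    have "sphere c t \<subseteq> \<Omega>" using sub sphere_cball by blast
    then have "continuous_on (sphere c (norm ?e)) (\<lambda>x. (u_ext x)\<^sup>2)"
      unfolding \<open>norm ?e = t\<close> by (intro continuous_intros continuous_on_subset[OF u_ext_continuous_on])
    from has_bochner_integral_integral_eq[OF has_bochner_integral_circle[OF this]] show ?thesis
      unfolding \<open>norm ?e = t\<close> .
  qed
  finally show ?thesis by (simp add: zero_ereal_def)
qed

lemma Phi_bound_eq:
  assumes sub: "cball c t \<subseteq> \<Omega>" and c: "c $ 2 = 0" and t: "0 < t"
  shows "t ^ 3 * (Phi_bound u g c t - half_disc_moment)
    = (LINT x:ball c t|lborel. net_density x) - 3 / 2 * circle_integral (\<lambda>x. (u_ext x)\<^sup>2) c t"
  unfolding Phi_bound_def ball_energy_eq[OF assms] circle_term_eq[OF sub t]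
  using t by (simp add: field_simps eval_nat_numeral)

lemma kernel_integral_net_density:
  assumes "admissible c \<tau>"
  shows "kernel_integral 3 net_density c \<tau> = 6 * (energy c \<tau> - air_energy c \<tau>)"
proof -
  have sub: "cball c (sqrt \<tau>) \<subseteq> \<Omega>" using assms by (simp add: admissible_def)
  have "has_bochner_integral lborel (\<lambda>x. energy_density x * ball_kernel 3 c \<tau> x - air_density x * ball_kernel 3 c \<tau> x)
      (6 * energy c \<tau> - 6 * air_energy c \<tau>)"
    using has_bochner_integral_diff[OF has_bochner_integral_ball_kernel[OF energy_density_locally_integrable sub, of 3]
        has_bochner_integral_ball_kernel[OF air_density_locally_integrable sub, of 3]]
    by (simp add: energy_def air_energy_def)
  from has_bochner_integral_integral_eq[OF this] show ?thesis
    by (simp add: kernel_integral_def net_density_def left_diff_distrib)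
qed

lemma Phi_bound_kernel_eq:
  assumes adm: "admissible c \<tau>" and c: "c $ 2 = 0"
  shows "norm (x - c) ^ 3 * (Phi_bound u g c (norm (x - c)) - half_disc_moment) * ball_kernel 2 c \<tau> x
    = (LINT y:ball c (norm (x - c))|lborel. indicator (cball c (sqrt \<tau>)) y * net_density y) * ball_kernel 2 c \<tau> x
      - 3 / 2 * (circle_integral (\<lambda>x. (u_ext x)\<^sup>2) c (norm (x - c)) * ball_kernel 2 c \<tau> x)"
proof -
  let ?r = "norm (x - c)"
  consider (center) "x = c" | (inside) "x \<in> cball c (sqrt \<tau>)" "x \<noteq> c" | (outside) "x \<notin> cball c (sqrt \<tau>)" by blast
  then show ?thesis
  proof cases
    case center
    have "u_ext c = 0" using fluid_above[of c] c by (intro u_ext_off_fluid) auto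
    then show ?thesis using center by (simp add: circle_integral_def rot_def set_lebesgue_integral_def)
  next
    case inside
    then have ball: "cball c ?r \<subseteq> cball c (sqrt \<tau>)" by (auto simp: dist_norm norm_minus_commute)
    then have "?r ^ 3 * (Phi_bound u g c ?r - half_disc_moment)
        = (LINT y:ball c ?r|lborel. net_density y) - 3 / 2 * circle_integral (\<lambda>x. (u_ext x)\<^sup>2) c ?r"
      using adm c inside(2) by (intro Phi_bound_eq) (auto simp: admissible_def)
    also have "(LINT y:ball c ?r|lborel. net_density y)
        = (LINT y:ball c ?r|lborel. indicator (cball c (sqrt \<tau>)) y * net_density y)"
    proof (intro set_lebesgue_integral_cong)
      have "y \<in> cball c (sqrt \<tau>)" if "y \<in> ball c ?r" for y using that ball ball_subset_cball by blast
      then show "\<forall>y. y \<in> ball c ?r \<longrightarrow> net_density y = indicator (cball c (sqrt \<tau>)) y * net_density y" by simp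
    qed simp
    finally show ?thesis by (simp only: left_diff_distrib mult.assoc)
  next
    case outside
    then have "ball_kernel 2 c \<tau> x = 0" by (rule ball_kernel_eq_0[rotated 2]) auto
    then show ?thesis by simp
  qed
qed

lemma excess_eq_Phi_bound_integral:
  assumes adm: "admissible c \<tau>" and c: "c $ 2 = 0"
  shows "has_bochner_integral lborel
    (\<lambda>x. norm (x - c) ^ 3 * (Phi_bound u g c (norm (x - c)) - half_disc_moment) * ball_kernel 2 c \<tau> x) (2 * pi * excess c \<tau>)"
proof -
  have sub: "cball c (sqrt \<tau>) \<subseteq> \<Omega>" using adm by (simp add: admissible_def)
  let ?F = "\<lambda>y. indicator (cball c (sqrt \<tau>)) y * net_density y"
  have "integrable lborel ?F"
    using locally_integrableD[OF net_density_locally_integrable compact_cball sub] by (simp add: set_integrable_def)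
  moreover have localized: "?F y * ball_kernel 3 c \<tau> y = net_density y * ball_kernel 3 c \<tau> y" for y
    using ball_kernel_eq_0[of 3 \<tau> \<tau> y c] by (cases "y \<in> cball c (sqrt \<tau>)") simp_all
  have "(\<integral>y. ?F y * ball_kernel 3 c \<tau> y \<partial>lborel) = 6 * (energy c \<tau> - air_energy c \<tau>)"
    unfolding localized kernel_integral_net_density[OF adm, symmetric] kernel_integral_def ..
  ultimately have net: "has_bochner_integral lborel
      (\<lambda>x. (LINT y:ball c (norm (x - c))|lborel. ?F y) * ball_kernel 2 c \<tau> x) (pi / 3 * (6 * (energy c \<tau> - air_energy c \<tau>)))"
    using has_bochner_integral_ball_integral_kernel[of ?F 2 c \<tau>] by simp
  have "continuous_on (cball c (sqrt \<tau>)) (\<lambda>x. (u_ext x)\<^sup>2)"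
    by (intro continuous_intros continuous_on_subset[OF u_ext_continuous_on sub])
  then have circle: "has_bochner_integral lborel
      (\<lambda>x. circle_integral (\<lambda>x. (u_ext x)\<^sup>2) c (norm (x - c)) * ball_kernel 2 c \<tau> x) (2 * pi * mass c \<tau>)"
    unfolding mass_def by (rule has_bochner_integral_circle_integral_kernel) simp
  have "pi / 3 * (6 * (energy c \<tau> - air_energy c \<tau>)) - 3 / 2 * (2 * pi * mass c \<tau>) = 2 * pi * excess c \<tau>"
    by (simp add: excess_def algebra_simps)
  then show ?thesis
    using has_bochner_integral_diff[OF net has_bochner_integral_mult_right[OF circle, of "3 / 2"]]
    unfolding Phi_bound_kernel_eq[OF adm c] by (simp only:)
qed

lemma Phi_bound_kernel_bound:
  assumes "0 < \<tau>" "0 \<le> \<epsilon>" and near: "\<And>t. 0 < t \<Longrightarrow> t\<^sup>2 \<le> \<tau> \<Longrightarrow> \<bar>Phi_bound u g c t - half_disc_moment\<bar> \<le> \<epsilon>"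
  shows "\<bar>norm (x - c) ^ 3 * (Phi_bound u g c (norm (x - c)) - half_disc_moment) * ball_kernel 2 c \<tau> x\<bar>
    \<le> \<epsilon> * sqrt \<tau> ^ 3 * ball_kernel 2 c \<tau> x"
proof (cases "x \<in> cball c (sqrt \<tau>) - {c}")
  case True
  then have "norm (x - c) \<le> sqrt \<tau>" "x \<noteq> c" by (auto simp: dist_norm norm_minus_commute)
  moreover from this have "\<bar>Phi_bound u g c (norm (x - c)) - half_disc_moment\<bar> \<le> \<epsilon>"
    using assms(1) power_mono[of "norm (x - c)" "sqrt \<tau>" 2] by (intro near) simp_all
  ultimately show ?thesis
    using assms(1,2) unfolding abs_mult
    by (subst mult.commute[of \<epsilon>]) (intro mult_mono, auto simp: ball_kernel_nonneg intro: power_mono)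
next
  case False
  then consider "x = c" | "ball_kernel 2 c \<tau> x = 0" using ball_kernel_eq_0[of 2 \<tau> \<tau> x c] by auto
  then show ?thesis using assms(1,2) by cases (simp_all add: ball_kernel_nonneg)
qed

lemma excess_bound:
  assumes adm: "admissible c \<tau>" and c: "c $ 2 = 0" and "0 \<le> \<epsilon>"
    and near: "\<And>t. 0 < t \<Longrightarrow> t\<^sup>2 \<le> \<tau> \<Longrightarrow> \<bar>Phi_bound u g c t - half_disc_moment\<bar> \<le> \<epsilon>"
  shows "\<bar>excess c \<tau>\<bar> \<le> \<epsilon> * \<tau> powr (9 / 2)"
proof -
  have \<tau>: "\<tau> > 0" and sub: "cball c (sqrt \<tau>) \<subseteq> UNIV" using adm by (auto simp: admissible_def)
  have const: "locally_integrable UNIV (\<lambda>x::pt. 1)" by (intro locally_integrable_continuous continuous_intros)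
  let ?h = "\<lambda>x. norm (x - c) ^ 3 * (Phi_bound u g c (norm (x - c)) - half_disc_moment) * ball_kernel 2 c \<tau> x"
  have h: "has_bochner_integral lborel ?h (2 * pi * excess c \<tau>)" by (rule excess_eq_Phi_bound_integral[OF adm c])
  have kernel: "integrable lborel (\<lambda>x::pt. 1 * ball_kernel 2 c \<tau> x)" by (rule integrable_mult_ball_kernel[OF const sub]) simp
  have "2 * pi * \<bar>excess c \<tau>\<bar> = \<bar>\<integral>x. ?h x \<partial>lborel\<bar>"
    using has_bochner_integral_integral_eq[OF h] by (simp add: abs_mult)
  also have "\<dots> \<le> (\<integral>x. \<epsilon> * sqrt \<tau> ^ 3 * (1 * ball_kernel 2 c \<tau> x) \<partial>lborel)"
    by (rule order_trans[OF integral_abs_bound integral_mono])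
      (use h kernel Phi_bound_kernel_bound[OF \<tau> \<open>0 \<le> \<epsilon>\<close> near] in \<open>auto simp: has_bochner_integral_iff\<close>)
  also have "\<dots> = \<epsilon> * sqrt \<tau> ^ 3 * kernel_integral 2 (\<lambda>x. 1) c \<tau>" by (simp add: kernel_integral_def)
  also have "\<dots> \<le> \<epsilon> * sqrt \<tau> ^ 3 * (\<tau>\<^sup>2 * (pi * \<tau>))"
    using kernel_integral_le_ball_integral[OF const _ sub, of 2] emeasure_cball[of "sqrt \<tau>" c] \<tau> \<open>0 \<le> \<epsilon>\<close> unit_ball_vol_2
    by (intro mult_left_mono) (auto simp: set_lebesgue_integral_def measure_def)
  also have "\<dots> = pi * (\<epsilon> * \<tau> powr (9 / 2))"
  proof -
    have "sqrt \<tau> ^ 3 = \<tau> powr (3 / 2)" using \<tau> by (simp add: powr_half_sqrt[symmetric] powr_powr flip: powr_realpow)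
    moreover have "\<tau>\<^sup>2 * \<tau> = \<tau> powr 3" using \<tau> by (simp add: power2_eq_square power3_eq_cube powr_numeral)
    moreover have "\<tau> powr (3 / 2) * \<tau> powr 3 = \<tau> powr (9 / 2)" by (simp only: powr_add[symmetric]) simp
    ultimately show ?thesis by (metis mult.assoc mult.left_commute)
  qed
  finally have "pi * (2 * \<bar>excess c \<tau>\<bar>) \<le> pi * (\<epsilon> * \<tau> powr (9 / 2))" by (simp add: mult_ac)
  then show ?thesis by simp
qed

lemma Sigma_imp_center:
  assumes c: "c \<in> Sigma_set \<Omega> u g" and adm: "admissible c T"
  shows "center c T"
proof -
  have "c $ 2 = 0" "c \<in> frontier fluid" and lim: "(Phi_bound u g c \<longlongrightarrow> half_disc_moment) (at_right 0)"
    using c by (auto simp: Sigma_set_def S_set_def fluid_def half_disc_moment_def)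
  have "((\<lambda>\<tau>. excess c \<tau> * \<tau> powr - (9 / 2)) \<longlongrightarrow> 0) (at_right 0)"
  proof (rule tendstoI)
    fix e :: real assume "e > 0"
    then have "\<forall>\<^sub>F r in at_right 0. dist (Phi_bound u g c r) half_disc_moment < e / 2" by (intro tendstoD[OF lim]) simp
    then obtain b where "b > 0" and b: "\<And>r. 0 < r \<Longrightarrow> r < b \<Longrightarrow> dist (Phi_bound u g c r) half_disc_moment < e / 2"
      unfolding eventually_at_right_field by auto
    have "dist (excess c \<tau> * \<tau> powr - (9 / 2)) 0 < e" if \<tau>: "0 < \<tau>" "\<tau> < min T (b\<^sup>2)" for \<tau>
    proof -
      have "\<bar>excess c \<tau>\<bar> \<le> e / 2 * \<tau> powr (9 / 2)"
      proof (rule excess_bound[OF admissible_mono[OF adm] \<open>c $ 2 = 0\<close>])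
        fix t :: real assume t: "0 < t" "t\<^sup>2 \<le> \<tau>"
        then have "t < b" using \<tau>(2) \<open>b > 0\<close> by (intro power2_less_imp_less[of t b]) auto
        then show "\<bar>Phi_bound u g c t - half_disc_moment\<bar> \<le> e / 2" using b[OF t(1)] by (simp add: dist_real_def)
      qed (use \<tau> \<open>e > 0\<close> in auto)
      then have "\<bar>excess c \<tau>\<bar> * \<tau> powr - (9 / 2) \<le> e / 2"
        using \<tau>(1) unfolding powr_minus_divide by (simp add: pos_divide_le_eq)
      then show ?thesis using \<open>e > 0\<close> by (simp add: dist_real_def abs_mult)
    qed
    moreover have "0 < min T (b\<^sup>2)" using adm \<open>b > 0\<close> by (simp add: admissible_def)
    ultimately show "\<forall>\<^sub>F \<tau> in at_right 0. dist (excess c \<tau> * \<tau> powr - (9 / 2)) 0 < e"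
      unfolding eventually_at_right_field by blast
  qed
  from excess_nonneg[OF adm \<open>c $ 2 = 0\<close> this] show ?thesis
    using adm \<open>c $ 2 = 0\<close> \<open>c \<in> frontier fluid\<close> by (simp add: center_def frontier_def)
qed

end

subsection \<open>Limits of centers and decay at small scales\<close>

lemma cball_subset_cball_double:
  fixes c :: "'a::metric_space"
  shows "dist x c \<le> \<rho> \<Longrightarrow> r \<le> \<rho> \<Longrightarrow> cball x r \<subseteq> cball c (2 * \<rho>)"
  by (smt (verit) dist_commute dist_triangle2 mem_cball subsetI)

context free_boundary_solution
begin

lemma admissible_near:
  assumes "cball c (2 * \<rho>) \<subseteq> \<Omega>" "\<rho> > 0" "dist x c \<le> \<rho>"
  shows "admissible x (\<rho>\<^sup>2)"
  using assms cball_subset_cball_double[of x c \<rho> \<rho>] by (auto simp: admissible_def)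

lemma center_limit:
  assumes sub: "cball c (2 * \<rho>) \<subseteq> \<Omega>" and "\<rho> > 0"
    and X: "X \<longlonglongrightarrow> c" "\<And>m. dist (X m) c \<le> \<rho>" "\<And>m. center (X m) (\<rho>\<^sup>2)"
  shows "center c (\<rho>\<^sup>2)"
  unfolding center_def
proof (intro conjI allI impI)
  show "admissible c (\<rho>\<^sup>2)" using \<open>\<rho> > 0\<close> by (intro admissible_near[OF sub]) auto
  have "(\<lambda>m. X m $ 2) \<longlonglongrightarrow> c $ 2" by (intro tendsto_intros X(1))
  moreover have "X m $ 2 = 0" for m using X(3)[of m] by (simp add: center_def)
  ultimately show "c $ 2 = 0" by (simp add: LIMSEQ_const_iff)
  have "X m \<in> closure fluid" for m using X(3)[of m] by (simp add: center_def)
  then show "c \<in> closure fluid" using X(1) closed_sequentially[OF closed_closure] by blast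
  fix \<tau> assume \<tau>: "0 < \<tau>" "\<tau> < \<rho>\<^sup>2"
  then have "cball (X m) (sqrt \<tau>) \<subseteq> cball c (2 * \<rho>)" for m
    using \<open>\<rho> > 0\<close> by (intro cball_subset_cball_double X(2)) (simp add: real_le_lsqrt)
  then have lim: "(\<lambda>m. kernel_integral n f (X m) \<tau>) \<longlonglongrightarrow> kernel_integral n f c \<tau>"
    if "locally_integrable \<Omega> f" "n > 0" for n f
    using \<tau>(1) by (intro kernel_integral_tendsto_center[OF that(1) X(1) _ sub that(2)]) auto
  have "(\<lambda>m. excess (X m) \<tau>) \<longlonglongrightarrow> excess c \<tau>"
    unfolding excess_def energy_def air_energy_def mass_def
    by (intro tendsto_intros lim energy_density_locally_integrable air_density_locally_integrable
        u_ext_square_locally_integrable) auto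
  moreover have "excess (X m) \<tau> \<ge> 0" for m using X(3)[of m] \<tau> by (simp add: center_def)
  ultimately show "0 \<le> excess c \<tau>" by (intro LIMSEQ_le_const) auto
qed

lemma small_scale_mass:
  assumes z: "center z T" and q: "0 < q" "8 * q\<^sup>2 \<le> d\<^sup>2" and d: "0 < d" "d\<^sup>2 < T"
  shows "mass z (8 * q\<^sup>2) \<le> d ^ 4 * (LINT x:cball z d|lborel. (u_ext x)\<^sup>2) * (3 * q / d) ^ 9"
proof -
  let ?V = "LINT x:cball z d|lborel. (u_ext x)\<^sup>2"
  have "mass z (8 * q\<^sup>2) \<le> mass z (d\<^sup>2) * (8 * q\<^sup>2 / d\<^sup>2) powr (9 / 2)"
    by (rule mass_decay[OF z]) (use q d in auto)
  also have "(8 * q\<^sup>2 / d\<^sup>2) powr (9 / 2) \<le> ((3 * q / d) powr 2) powr (9 / 2)"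
    using q d by (intro powr_mono2) (auto simp: power_divide power_mult_distrib powr_numeral divide_right_mono)
  also have "\<dots> = (3 * q / d) ^ 9" unfolding powr_powr using q d by (simp add: powr_numeral)
  also have "mass z (d\<^sup>2) \<le> d ^ 4 * ?V"
  proof -
    have "cball z (sqrt (d\<^sup>2)) \<subseteq> \<Omega>" using center_admissible[OF z, of "d\<^sup>2"] d by (simp add: admissible_def)
    from kernel_integral_le_ball_integral[OF u_ext_square_locally_integrable _ this, of 2] show ?thesis
      using d(1) by (simp add: mass_def power_mult[symmetric])
  qed
  finally show ?thesis using q d by (simp add: mult_left_mono mult_right_mono mass_nonneg)
qed

lemma small_scale_energy:
  assumes z: "center z T" and q: "0 < q" "8 * q\<^sup>2 \<le> d\<^sup>2" and d: "0 < d" "d\<^sup>2 < T"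
  shows "(LINT x:cball z q|lborel. energy_density x)
    \<le> 12 * 3 ^ 6 * (q / d) ^ 3 / d\<^sup>2 * (LINT x:cball z d|lborel. (u_ext x)\<^sup>2)"
proof -
  let ?E = "LINT x:cball z q|lborel. energy_density x" and ?V = "LINT x:cball z d|lborel. (u_ext x)\<^sup>2"
  have "q\<^sup>2 > 0" using q by simp
  then have scales: "4 * q\<^sup>2 < T" "2 * (4 * q\<^sup>2) < T" using q(2) d(2) by linarith+
  have "cball z (sqrt (4 * q\<^sup>2)) \<subseteq> \<Omega>" using center_admissible[OF z, of "4 * q\<^sup>2"] scales q by (simp add: admissible_def)
  then have "(3 * q\<^sup>2) ^ 3 * ?E \<le> kernel_integral 3 energy_density z (4 * q\<^sup>2)"
    using q by (intro ball_integral_le_kernel_integral[OF energy_density_locally_integrable energy_density_nonneg]) auto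
  also have "\<dots> = 6 * energy z (4 * q\<^sup>2)" by (simp add: energy_def)
  also have "\<dots> \<le> 12 * mass z (8 * q\<^sup>2)" using energy_le_mass[OF z _ scales(2)] q by simp
  also have "\<dots> \<le> 12 * (d ^ 4 * ?V * (3 * q / d) ^ 9)" using small_scale_mass[OF assms] by simp
  also have "\<dots> = (3 * q\<^sup>2) ^ 3 * (12 * 3 ^ 6 * (q / d) ^ 3 / d\<^sup>2 * ?V)"
    using d by (simp add: power_mult_distrib power_divide field_simps flip: power_add power_mult)
  finally show ?thesis by (rule mult_left_le_imp_le) (use q in simp)
qed

end

subsection \<open>Cutoff functions and the rotation field\<close>

lemma Ck_on_pos_power: "Ck_on k S f \<Longrightarrow> k < n \<Longrightarrow> Ck_on k S (\<lambda>x. pos_power n (f x))"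
proof (induction k arbitrary: n)
  case 0
  then show ?case by (simp add: continuous_on_pos_power)
next
  case (Suc k)
  show ?case
  proof (rule Ck_on_Suc_compose[OF Suc.prems(1) DERIV_pos_power])
    have "Ck_on k S (\<lambda>x. pos_power (n - 1) (f x))"
      by (rule Suc.IH[OF Ck_on_Suc_imp[OF Suc.prems(1)]]) (use Suc.prems(2) in simp)
    then show "Ck_on k S (\<lambda>x. real n * pos_power (n - 1) (f x))" by (rule Ck_on_mult[OF Ck_on_const])
  qed (use Suc.prems in simp)
qed

lemma Ck_on_power2_norm_diff: "Ck_on k S (\<lambda>y. (norm (y - c))\<^sup>2)"
  unfolding power2_norm_pt vector_minus_component unfolding power2_eq_square
  by (intro Ck_on_add Ck_on_mult Ck_on_diff Ck_on_component Ck_on_const)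

definition smooth_step :: "real \<Rightarrow> real" where
  "smooth_step t = 1 - pos_power 3 (1 - pos_power 3 t)"

definition smooth_step' :: "real \<Rightarrow> real" where
  "smooth_step' t = 9 * pos_power 2 (1 - pos_power 3 t) * pos_power 2 t"

lemma smooth_step_bounds: "0 \<le> smooth_step t" "smooth_step t \<le> 1"
  using pos_power_le_power[of "1 - pos_power 3 t" 1 3] pos_power_nonneg[of 3 t]
  by (auto simp: smooth_step_def pos_power_nonneg)

lemma smooth_step_eq_0: "t \<le> 0 \<Longrightarrow> smooth_step t = 0"
  by (simp add: smooth_step_def pos_power_def)

lemma one_minus_pos_power_le_0: "t \<ge> 1 \<Longrightarrow> 1 - pos_power n t \<le> 0"
  by (simp add: pos_power_eq_power one_le_power)

lemma smooth_step_eq_1: "t \<ge> 1 \<Longrightarrow> smooth_step t = 1"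
  using one_minus_pos_power_le_0[of t 3] by (simp add: smooth_step_def pos_power_eq_0)

lemma smooth_step'_eq_0: "t \<le> 0 \<or> t \<ge> 1 \<Longrightarrow> smooth_step' t = 0"
  using one_minus_pos_power_le_0[of t 3] by (auto simp: smooth_step'_def pos_power_eq_0)

lemma smooth_step'_nonneg: "0 \<le> smooth_step' t"
  by (simp add: smooth_step'_def pos_power_nonneg)

lemma smooth_step'_le: "smooth_step' t \<le> 9"
proof (cases "t \<le> 1")
  case True
  have "pos_power 2 (1 - pos_power 3 t) * pos_power 2 t \<le> 1 ^ 2 * 1 ^ 2"
    using True by (intro mult_mono pos_power_le_power pos_power_nonneg) (simp_all add: pos_power_nonneg)
  then show ?thesis by (simp add: smooth_step'_def)
qed (simp add: smooth_step'_eq_0)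

lemma DERIV_smooth_step: "(smooth_step has_real_derivative smooth_step' t) (at t)"
proof -
  have inner: "((\<lambda>t. 1 - pos_power 3 t) has_real_derivative 0 - 3 * pos_power 2 t) (at t)"
    using DERIV_pos_power[of 3 t] by (intro DERIV_diff DERIV_const) simp
  have outer: "(pos_power 3 has_real_derivative 3 * pos_power 2 s) (at s)" for s
    using DERIV_pos_power[of 3 s] by simp
  show ?thesis
    using DERIV_diff[OF DERIV_const[of 1] DERIV_chain2[OF outer inner]]
    by (simp add: smooth_step_def[abs_def] smooth_step'_def mult_ac)
qed

lemma Ck_on_smooth_step: "Ck_on k S f \<Longrightarrow> k < 3 \<Longrightarrow> Ck_on k S (\<lambda>x. smooth_step (f x))"
  unfolding smooth_step_def by (intro Ck_on_diff Ck_on_const Ck_on_pos_power)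

definition perp :: "pt \<Rightarrow> pt" where
  "perp y = vector [- y $ 2, y $ 1]"

lemma perp_nth [simp]: "perp y $ 1 = - y $ 2" "perp y $ 2 = y $ 1"
  by (simp_all add: perp_def)

lemma norm_perp: "norm (perp y) = norm y"
  unfolding norm_eq_sqrt_inner by (simp add: inner_pt add.commute)

lemma abs_inner_perp_le: "\<bar>x \<bullet> perp y\<bar> \<le> norm x * norm y"
  using Cauchy_Schwarz_ineq2[of x "perp y"] by (simp add: norm_perp)

text \<open>After rescaling, the center is \<open>0\<close> and the other point of \<open>\<Sigma>\<close> is \<open>(\<sigma>, 0)\<close> with \<open>\<sigma> = \<plusminus>1\<close>. The test field is
  \<open>profile \<sigma> s y\<close> times the rotation field \<open>perp y\<close>. On the upper half of the annulus \<open>angular_weight\<close> increases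
  strictly in the direction \<open>perp y\<close>, and it has the sign of \<open>- \<sigma>\<close>, for which the term on the air phase is harmless.\<close>

definition annulus_cutoff :: "real \<Rightarrow> pt \<Rightarrow> real" where
  "annulus_cutoff s y = pos_power 3 (1 - (((norm y)\<^sup>2 - 1) / s)\<^sup>2)"

definition hole_cutoff :: "real \<Rightarrow> real \<Rightarrow> pt \<Rightarrow> real" where
  "hole_cutoff \<sigma> s y = smooth_step ((norm (y - \<sigma> *\<^sub>R axis 1 1))\<^sup>2 / s\<^sup>2 - 9)"

definition angular_weight :: "real \<Rightarrow> pt \<Rightarrow> real" where
  "angular_weight \<sigma> y = y $ 1 * y $ 2 / 2 - y $ 1 - 2 * \<sigma>"

definition profile :: "real \<Rightarrow> real \<Rightarrow> pt \<Rightarrow> real" where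
  "profile \<sigma> s y = annulus_cutoff s y * (hole_cutoff \<sigma> s y * angular_weight \<sigma> y)"

lemma annulus_cutoff_bounds: "0 \<le> annulus_cutoff s y" "annulus_cutoff s y \<le> 1"
  using pos_power_le_power[of "1 - (((norm y)\<^sup>2 - 1) / s)\<^sup>2" 1 3] by (simp_all add: annulus_cutoff_def pos_power_nonneg)

lemma annulus_cutoff_support:
  assumes "annulus_cutoff s y \<noteq> 0" "0 < s"
  shows "\<bar>(norm y)\<^sup>2 - 1\<bar> < s"
proof -
  have "(((norm y)\<^sup>2 - 1) / s)\<^sup>2 < 1"
    using assms(1) pos_power_eq_0[of "1 - (((norm y)\<^sup>2 - 1) / s)\<^sup>2" 3] by (force simp: annulus_cutoff_def)
  then show ?thesis using assms(2) by (simp add: abs_square_less_1)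
qed

lemma annulus_cutoff_eq_0:
  assumes "y \<notin> cball 0 2" "0 < s" "s \<le> 1"
  shows "annulus_cutoff s y = 0"
proof (rule ccontr)
  assume "annulus_cutoff s y \<noteq> 0"
  then have "\<bar>(norm y)\<^sup>2 - 1\<bar> < s" by (rule annulus_cutoff_support[OF _ assms(2)])
  moreover have "2\<^sup>2 \<le> (norm y)\<^sup>2" using assms(1) by (intro power_mono) auto
  ultimately show False using assms(3) by simp
qed

lemma annulus_cutoff_continuous_on [continuous_intros]:
  "continuous_on S f \<Longrightarrow> continuous_on S (\<lambda>x. annulus_cutoff s (f x))"
  unfolding annulus_cutoff_def divide_inverse by (intro continuous_intros)

lemma hole_cutoff_bounds: "0 \<le> hole_cutoff \<sigma> s y" "hole_cutoff \<sigma> s y \<le> 1"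
  by (simp_all add: hole_cutoff_def smooth_step_bounds)

lemma Ck_on_profile: "Ck_on 2 S (profile \<sigma> s)"
proof -
  have norm: "Ck_on 2 S (\<lambda>y. (norm y)\<^sup>2)" using Ck_on_power2_norm_diff[of 2 S 0] by simp
  have square: "Ck_on 2 S (\<lambda>y. (f y)\<^sup>2)" if "Ck_on 2 S f" for f
    unfolding power2_eq_square by (rule Ck_on_mult[OF that that])
  have "Ck_on 2 S (\<lambda>y. profile \<sigma> s y)"
    unfolding profile_def annulus_cutoff_def hole_cutoff_def angular_weight_def divide_inverse
    by (intro norm Ck_on_power2_norm_diff Ck_on_mult Ck_on_diff Ck_on_const Ck_on_pos_power Ck_on_smooth_step
        Ck_on_component square) auto
  then show ?thesis by simp
qed

lemma profile_eq_0: "y \<notin> cball 0 2 \<Longrightarrow> 0 < s \<Longrightarrow> s \<le> 1 \<Longrightarrow> profile \<sigma> s y = 0"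
  using annulus_cutoff_eq_0 by (simp add: profile_def)

lemma abs_coordinates_annulus:
  assumes "0 < s" "s \<le> 1 / 8" "\<bar>(norm y)\<^sup>2 - 1\<bar> < s"
  shows "\<bar>y $ i\<bar> \<le> 1 + s"
proof -
  have "(1 + s)\<^sup>2 = 1 + 2 * s + s\<^sup>2" by algebra
  then have "(norm y)\<^sup>2 \<le> (1 + s)\<^sup>2" using assms zero_le_power2[of s] by linarith
  then have "norm y \<le> 1 + s" by (rule power2_le_imp_le) (use assms in simp)
  then show ?thesis using component_le_norm_cart[of y i] by linarith
qed

lemma angular_weight_bounds:
  assumes \<sigma>: "\<bar>\<sigma>\<bar> = 1" and s: "0 < s" "s \<le> 1 / 8" and y: "\<bar>(norm y)\<^sup>2 - 1\<bar> < s"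
  shows "0 \<le> - \<sigma> * angular_weight \<sigma> y" "- \<sigma> * angular_weight \<sigma> y \<le> 4"
proof -
  have coordinates: "\<bar>y $ 1\<bar> \<le> 9 / 8" "\<bar>y $ 2\<bar> \<le> 9 / 8"
    using abs_coordinates_annulus[OF s y, of 1] abs_coordinates_annulus[OF s y, of 2] s by auto
  then have "\<bar>y $ 1 * y $ 2\<bar> \<le> 9 / 8 * (9 / 8)" unfolding abs_mult by (intro mult_mono) auto
  moreover have "\<sigma> = 1 \<or> \<sigma> = -1" using \<sigma> by linarith
  ultimately show "0 \<le> - \<sigma> * angular_weight \<sigma> y" "- \<sigma> * angular_weight \<sigma> y \<le> 4"
    using coordinates unfolding angular_weight_def by (elim disjE; simp; linarith)+
qed

lemma profile_bounds:
  assumes "\<bar>\<sigma>\<bar> = 1" "0 < s" "s \<le> 1 / 8"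
  shows "0 \<le> - \<sigma> * profile \<sigma> s y" "- \<sigma> * profile \<sigma> s y \<le> 4"
proof -
  let ?w = "- \<sigma> * angular_weight \<sigma> y" and ?\<eta> = "annulus_cutoff s y"
  have eq: "- \<sigma> * profile \<sigma> s y = ?\<eta> * (hole_cutoff \<sigma> s y * ?w)" by (simp add: profile_def)
  show "0 \<le> - \<sigma> * profile \<sigma> s y" "- \<sigma> * profile \<sigma> s y \<le> 4"
  proof (atomize (full), cases "?\<eta> = 0")
    case False
    note w = angular_weight_bounds[OF assms annulus_cutoff_support[OF False assms(2)]]
    have "?\<eta> * (hole_cutoff \<sigma> s y * ?w) \<le> 1 * (1 * 4)"
      by (intro mult_mono annulus_cutoff_bounds hole_cutoff_bounds w mult_nonneg_nonneg) auto
    moreover have "0 \<le> ?\<eta> * (hole_cutoff \<sigma> s y * ?w)"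
      by (intro mult_nonneg_nonneg annulus_cutoff_bounds hole_cutoff_bounds w)
    ultimately show "0 \<le> - \<sigma> * profile \<sigma> s y \<and> - \<sigma> * profile \<sigma> s y \<le> 4" unfolding eq by simp
  qed (simp add: profile_def)
qed

text \<open>Close to the axis, the half of the annulus around \<open>(\<sigma>, 0)\<close> lies in the hole.\<close>

lemma hole_cutoff_height:
  assumes \<sigma>: "\<bar>\<sigma>\<bar> = 1" and s: "0 < s" "s \<le> 1 / 8" and y: "\<bar>(norm y)\<^sup>2 - 1\<bar> < s"
    and "hole_cutoff \<sigma> s y \<noteq> 0" "0 < \<sigma> * y $ 1" "0 < y $ 2"
  shows "s \<le> y $ 2"
proof (rule ccontr)
  assume "\<not> s \<le> y $ 2"
  then have height: "(y $ 2)\<^sup>2 \<le> s\<^sup>2" using assms(7) by (intro power_mono) auto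
  define a where "a = \<sigma> * y $ 1"
  have \<sigma>_square: "\<sigma>\<^sup>2 = 1" using \<sigma> by (metis power2_abs power_one)
  have a_square: "a\<^sup>2 = (norm y)\<^sup>2 - (y $ 2)\<^sup>2" by (simp add: a_def power_mult_distrib \<sigma>_square power2_norm_pt)
  have "s\<^sup>2 \<le> s" using s by (simp add: power2_eq_square mult_left_le_one_le)
  then have "\<bar>a\<^sup>2 - 1\<bar> \<le> 2 * s" using y height zero_le_power2[of "y $ 2"] unfolding a_square by linarith
  moreover have "\<bar>a - 1\<bar> * 1 \<le> \<bar>a - 1\<bar> * (a + 1)" using assms(6) unfolding a_def by (intro mult_left_mono) auto
  moreover have "\<bar>a - 1\<bar> * (a + 1) = \<bar>a\<^sup>2 - 1\<bar>"
  proof -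
    have "a\<^sup>2 - 1 = (a - 1) * (a + 1)" by algebra
    then show ?thesis using assms(6) by (simp add: abs_mult a_def)
  qed
  ultimately have "(a - 1)\<^sup>2 \<le> (2 * s)\<^sup>2" using s abs_le_square_iff[of "a - 1" "2 * s"] by simp
  moreover have "(norm (y - \<sigma> *\<^sub>R axis 1 1))\<^sup>2 = (a - 1)\<^sup>2 + (y $ 2)\<^sup>2"
  proof -
    have "(y $ 1 - \<sigma>)\<^sup>2 = \<sigma>\<^sup>2 * (y $ 1 - \<sigma>)\<^sup>2" by (simp add: \<sigma>_square)
    also have "\<dots> = (a - \<sigma>\<^sup>2)\<^sup>2" unfolding a_def by algebra
    finally show ?thesis by (simp add: power2_norm_pt axis_def \<sigma>_square)
  qed
  ultimately have "(norm (y - \<sigma> *\<^sub>R axis 1 1))\<^sup>2 / s\<^sup>2 \<le> 5" using height s by (simp add: pos_divide_le_eq power_mult_distrib)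
  then show False using assms(5) by (simp add: hole_cutoff_def smooth_step_eq_0)
qed

lemma profile_vertical_bound:
  assumes \<sigma>: "\<bar>\<sigma>\<bar> = 1" and s: "0 < s" "s \<le> 1 / 8" and above: "0 < y $ 2"
  shows "- y $ 1 * profile \<sigma> s y \<le> 5 / s * y $ 2"
proof -
  have "\<sigma> * \<sigma> = 1" using \<sigma> by (metis abs_mult_self_eq mult_1)
  then have eq: "- y $ 1 * profile \<sigma> s y = (\<sigma> * y $ 1) * (- \<sigma> * profile \<sigma> s y)" by algebra
  have nonneg: "0 \<le> 5 / s * y $ 2" using s above by simp
  consider (trivial) "\<sigma> * y $ 1 \<le> 0 \<or> profile \<sigma> s y = 0" | (nontrivial) "0 < \<sigma> * y $ 1" "profile \<sigma> s y \<noteq> 0" by linarith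
  then show ?thesis
  proof cases
    case trivial
    then have "(\<sigma> * y $ 1) * (- \<sigma> * profile \<sigma> s y) \<le> 0"
      using mult_nonpos_nonneg[OF _ profile_bounds(1)[OF \<sigma> s, of y]] by (elim disjE) simp_all
    then show ?thesis using nonneg unfolding eq by linarith
  next
    case nontrivial
    then have y: "\<bar>(norm y)\<^sup>2 - 1\<bar> < s" and "hole_cutoff \<sigma> s y \<noteq> 0"
      using annulus_cutoff_support[OF _ s(1)] by (auto simp: profile_def)
    then have "s \<le> y $ 2" by (intro hole_cutoff_height[OF \<sigma> s y _ nontrivial(1) above])
    have "\<bar>\<sigma> * y $ 1\<bar> \<le> 9 / 8" using abs_coordinates_annulus[OF s y, of 1] \<sigma> s by (simp add: abs_mult)
    then have "(\<sigma> * y $ 1) * (- \<sigma> * profile \<sigma> s y) \<le> 9 / 8 * 4"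
      by (intro mult_mono profile_bounds[OF \<sigma> s]) auto
    also have "\<dots> \<le> 5 / s * s" using s by simp
    also have "\<dots> \<le> 5 / s * y $ 2" using \<open>s \<le> y $ 2\<close> s by (intro mult_left_mono) auto
    finally show ?thesis unfolding eq .
  qed
qed

lemma GDERIV_radial:
  assumes "(f has_real_derivative D) (at ((norm (y - c))\<^sup>2))"
  shows "GDERIV (\<lambda>y. f ((norm (y - c))\<^sup>2)) y :> (2 * D) *\<^sub>R (y - c)"
  using GDERIV_DERIV_compose[OF GDERIV_power2_norm_diff assms] by (simp add: mult.commute)

lemma profile_angular_derivative:
  assumes "s > 0" and G: "GDERIV (profile \<sigma> s) y :> G"
  shows "G \<bullet> perp y = annulus_cutoff s y * (hole_cutoff \<sigma> s y * ((norm y)\<^sup>2 / 2 + y $ 2 - (y $ 2)\<^sup>2)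
    + angular_weight \<sigma> y * (2 * \<sigma> * y $ 2 / s\<^sup>2 * smooth_step' ((norm (y - \<sigma> *\<^sub>R axis 1 1))\<^sup>2 / s\<^sup>2 - 9)))"
proof -
  let ?e = "\<sigma> *\<^sub>R axis 1 1 :: pt"
  let ?step = "smooth_step' ((norm (y - ?e))\<^sup>2 / s\<^sup>2 - 9)"
  have "\<exists>D. ((\<lambda>t. pos_power 3 (1 - ((t - 1) / s)\<^sup>2)) has_real_derivative D) (at t)" for t
  proof -
    have "\<exists>E. ((\<lambda>t. 1 - ((t - 1) / s)\<^sup>2) has_real_derivative E) (at t)"
      using assms(1) by (intro exI) (auto intro!: derivative_eq_intros)
    then show ?thesis using DERIV_chain2[OF DERIV_pos_power[of 3]] by fastforce
  qed
  then obtain k where annulus: "GDERIV (annulus_cutoff s) y :> (2 * k) *\<^sub>R (y - 0)"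
    using GDERIV_radial[of "\<lambda>t. pos_power 3 (1 - ((t - 1) / s)\<^sup>2)" _ y 0]
    unfolding annulus_cutoff_def[abs_def] by fastforce
  have "((\<lambda>t. t / s\<^sup>2 - 9) has_real_derivative 1 / s\<^sup>2) (at t)" for t
    using DERIV_diff[OF DERIV_cdivide[OF DERIV_ident] DERIV_const] by simp
  from GDERIV_radial[OF DERIV_chain2[OF DERIV_smooth_step this], of ?e y]
  have hole: "GDERIV (hole_cutoff \<sigma> s) y :> (2 * (?step * (1 / s\<^sup>2))) *\<^sub>R (y - ?e)"
    by (simp add: hole_cutoff_def[abs_def])
  have weight: "GDERIV (angular_weight \<sigma>) y :> vector [y $ 2 / 2 - 1, y $ 1 / 2]"
    unfolding gderiv_def angular_weight_def[abs_def]
    by (auto intro!: derivative_eq_intros bounded_linear_imp_has_derivative bounded_linear_vec_nth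
        simp: fun_eq_iff inner_pt field_simps)
  have "G = annulus_cutoff s y *\<^sub>R (hole_cutoff \<sigma> s y *\<^sub>R vector [y $ 2 / 2 - 1, y $ 1 / 2]
      + angular_weight \<sigma> y *\<^sub>R (2 * (?step * (1 / s\<^sup>2))) *\<^sub>R (y - ?e))
      + (hole_cutoff \<sigma> s y * angular_weight \<sigma> y) *\<^sub>R (2 * k) *\<^sub>R (y - 0)"
    by (rule GDERIV_unique[OF G])
      (use GDERIV_mult[OF annulus GDERIV_mult[OF hole weight]] in \<open>simp add: profile_def[abs_def]\<close>)
  moreover have "(y - ?e) \<bullet> perp y = \<sigma> * y $ 2" "y \<bullet> perp y = 0"
    "vector [y $ 2 / 2 - 1, y $ 1 / 2] \<bullet> perp y = (norm y)\<^sup>2 / 2 + y $ 2 - (y $ 2)\<^sup>2"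
    unfolding inner_pt power2_norm_pt by (simp_all add: axis_def power2_eq_square field_simps)
  ultimately show ?thesis by (simp add: inner_add_left mult_ac)
qed

lemma angular_weight_increasing:
  assumes s: "0 < s" "s \<le> 1 / 8" and y: "\<bar>(norm y)\<^sup>2 - 1\<bar> < s" and above: "0 \<le> y $ 2"
  shows "1 / 4 \<le> (norm y)\<^sup>2 / 2 + y $ 2 - (y $ 2)\<^sup>2"
proof -
  have "y $ 2 * (y $ 2 - 1) \<le> (1 + s) * s"
  proof (cases "y $ 2 \<le> 1")
    case True
    then have "y $ 2 * (y $ 2 - 1) \<le> 0" using above by (intro mult_nonneg_nonpos) auto
    also have "0 \<le> (1 + s) * s" using s by simp
    finally show ?thesis .
  next
    case False
    then show ?thesis using abs_coordinates_annulus[OF s y, of 2] by (intro mult_mono) auto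
  qed
  also have "\<dots> \<le> (1 + 1 / 8) * (1 / 8)" using s by (intro mult_mono) auto
  finally have "(y $ 2)\<^sup>2 - y $ 2 \<le> 9 / 64" by (simp add: power2_eq_square algebra_simps)
  then show ?thesis using y s by linarith
qed

lemma hole_error_bound:
  assumes \<sigma>: "\<bar>\<sigma>\<bar> = 1" and s: "0 < s" "s \<le> 1 / 8" and y: "\<bar>(norm y)\<^sup>2 - 1\<bar> < s"
    and "y \<in> cball (\<sigma> *\<^sub>R axis 1 1) (4 * s)"
  shows "\<bar>angular_weight \<sigma> y * (2 * \<sigma> * y $ 2 / s\<^sup>2 * smooth_step' t)\<bar> \<le> 288 / s"
proof -
  have "\<bar>y $ 2\<bar> \<le> norm (y - \<sigma> *\<^sub>R axis 1 1)"
    using component_le_norm_cart[of "y - \<sigma> *\<^sub>R axis 1 1" 2] by (simp add: axis_def)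
  also have "\<dots> \<le> 4 * s" using assms(5) by (simp add: dist_norm norm_minus_commute)
  finally have "\<bar>2 * \<sigma> * y $ 2 / s\<^sup>2\<bar> \<le> 2 * (4 * s) / s\<^sup>2" using \<sigma> by (simp add: abs_mult divide_right_mono)
  moreover have "\<bar>angular_weight \<sigma> y\<bar> \<le> 4"
    using angular_weight_bounds[OF \<sigma> s y] \<sigma> by (simp add: abs_if split: if_splits)
  ultimately have "\<bar>angular_weight \<sigma> y * (2 * \<sigma> * y $ 2 / s\<^sup>2 * smooth_step' t)\<bar> \<le> 4 * (2 * (4 * s) / s\<^sup>2 * 9)"
    unfolding abs_mult[of "angular_weight \<sigma> y"] abs_mult[of "2 * \<sigma> * y $ 2 / s\<^sup>2"]
    using smooth_step'_nonneg[of t] smooth_step'_le[of t] s by (intro mult_mono) auto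
  also have "\<dots> = 288 / s" using s by (simp add: power2_eq_square)
  finally show ?thesis .
qed

lemma profile_angular_derivative_lower:
  assumes \<sigma>: "\<bar>\<sigma>\<bar> = 1" and s: "0 < s" "s \<le> 1 / 8" and above: "0 \<le> y $ 2" and G: "GDERIV (profile \<sigma> s) y :> G"
  shows "annulus_cutoff s y / 4 - 400 / s * indicator (cball (\<sigma> *\<^sub>R axis 1 1) (4 * s)) y \<le> G \<bullet> perp y"
proof (cases "annulus_cutoff s y = 0")
  case True
  then show ?thesis using s profile_angular_derivative[OF s(1) G] by simp
next
  case False
  then have y: "\<bar>(norm y)\<^sup>2 - 1\<bar> < s" by (rule annulus_cutoff_support[OF _ s(1)])
  let ?e = "\<sigma> *\<^sub>R axis 1 1 :: pt" and ?\<eta> = "annulus_cutoff s y"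
  let ?t = "(norm (y - ?e))\<^sup>2 / s\<^sup>2 - 9"
  define q where "q = (norm y)\<^sup>2 / 2 + y $ 2 - (y $ 2)\<^sup>2"
  define error where "error = angular_weight \<sigma> y * (2 * \<sigma> * y $ 2 / s\<^sup>2 * smooth_step' ?t)"
  have q: "1 / 4 \<le> q" unfolding q_def by (rule angular_weight_increasing[OF s y above])
  have deriv: "G \<bullet> perp y = ?\<eta> * (hole_cutoff \<sigma> s y * q + error)"
    unfolding q_def error_def by (rule profile_angular_derivative[OF s(1) G])
  show ?thesis
  proof (cases "y \<in> cball ?e (4 * s)")
    case True
    have "\<bar>error\<bar> \<le> 288 / s" unfolding error_def by (rule hole_error_bound[OF \<sigma> s y True])
    then have "- (288 / s) \<le> hole_cutoff \<sigma> s y * q + error"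
      using mult_nonneg_nonneg[OF hole_cutoff_bounds(1)[of \<sigma> s y], of q] q by linarith
    then have "?\<eta> * - (288 / s) \<le> G \<bullet> perp y"
      unfolding deriv by (rule mult_left_mono[OF _ annulus_cutoff_bounds(1)])
    moreover have "?\<eta> * (288 / s) \<le> 1 * (288 / s)"
      using s by (intro mult_right_mono annulus_cutoff_bounds) auto
    moreover have "112 \<le> 112 / s" using s by (simp add: pos_le_divide_eq)
    then have "?\<eta> / 4 \<le> 112 / s" using annulus_cutoff_bounds(2)[of s y] by linarith
    ultimately show ?thesis using True by (simp add: add_divide_distrib[symmetric])
  next
    case False
    then have "(4 * s)\<^sup>2 < (norm (y - ?e))\<^sup>2" using s by (intro power_strict_mono) (auto simp: dist_norm norm_minus_commute)
    then have "16 \<le> (norm (y - ?e))\<^sup>2 / s\<^sup>2" using s by (simp add: power_mult_distrib pos_le_divide_eq)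
    then have "?t \<ge> 1" by simp
    then have "G \<bullet> perp y = ?\<eta> * q"
      using deriv by (simp add: error_def hole_cutoff_def smooth_step_eq_1 smooth_step'_eq_0)
    also have "\<dots> \<ge> ?\<eta> * (1 / 4)" by (intro mult_left_mono q annulus_cutoff_bounds)
    finally show ?thesis using False by simp
  qed
qed

lemma C1_test_gradient:
  assumes f: "Ck_on (Suc k) UNIV f" and K: "compact K" "K \<subseteq> S" and zero: "\<And>x. x \<notin> K \<Longrightarrow> f x = 0"
  shows "C1_test S f (gradient f)"
proof (rule C1_testI[OF K zero])
  note grad = Ck_on_gradient[OF f open_UNIV]
  show "GDERIV f x :> gradient f x" for x by (rule grad) simp
  show "continuous_on UNIV (gradient f)"
  proof (rule continuous_on_componentwise)
    have "Ck_on m UNIV h \<Longrightarrow> continuous_on UNIV h" for m and h :: "pt \<Rightarrow> real"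
      by (induction m) (use Ck_on_Suc_imp in auto)
    then show "continuous_on UNIV (\<lambda>x. gradient f x $ i)" for i using grad(2) by blast
  qed
qed

lemma C1_test_second_gradient:
  assumes f: "Ck_on 2 UNIV f" and K: "compact K" "K \<subseteq> S" and zero: "\<And>x. x \<notin> K \<Longrightarrow> f x = 0"
  shows "C1_test S f (gradient f)"
    and "C1_test S (\<lambda>x. gradient f x $ j) (gradient (\<lambda>x. gradient f x $ j))"
    and "gradient (\<lambda>x. gradient f x $ i) x $ j = gradient (\<lambda>x. gradient f x $ j) x $ i"
proof -
  have f': "Ck_on (Suc (Suc 0)) UNIV f" using f by (simp add: numeral_2_eq_2)
  show test: "C1_test S f (gradient f)" by (rule C1_test_gradient[OF f' K zero])
  have "gradient f x = 0" if "x \<notin> K" for x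
    by (rule gradient_eqI[OF GDERIV_zero_outside_closed[OF compact_imp_closed[OF K(1)] zero that]])
  then have test2: "C1_test S (\<lambda>x. gradient f x $ j) (gradient (\<lambda>x. gradient f x $ j))" for j
    by (intro C1_test_gradient[OF Ck_on_gradient(2)[OF f' open_UNIV] K]) auto
  then show "C1_test S (\<lambda>x. gradient f x $ j) (gradient (\<lambda>x. gradient f x $ j))" .
  show "gradient (\<lambda>x. gradient f x $ i) x $ j = gradient (\<lambda>x. gradient f x $ j) x $ i"
    by (rule mixed_partials_commute[OF open_UNIV UNIV_I C1_test_GDERIV[OF test] C1_test_GDERIV[OF test2]
          C1_test_continuous_on_gradient[OF test2]])
qed

lemma C1_test_profile:
  assumes "0 < s" "s \<le> 1"
  shows "C1_test (cball 0 2) (profile \<sigma> s) (gradient (profile \<sigma> s))"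
    and "C1_test (cball 0 2) (\<lambda>y. gradient (profile \<sigma> s) y $ j) (gradient (\<lambda>y. gradient (profile \<sigma> s) y $ j))"
    and "gradient (\<lambda>y. gradient (profile \<sigma> s) y $ i) y $ j = gradient (\<lambda>y. gradient (profile \<sigma> s) y $ j) y $ i"
  using C1_test_second_gradient[OF Ck_on_profile compact_cball order_refl] profile_eq_0[OF _ assms] by blast+

lemma profile_gradient_bounded:
  assumes "0 < s" "s \<le> 1"
  obtains C where "C > 0" "\<And>\<sigma> y. \<bar>\<sigma>\<bar> = 1 \<Longrightarrow> norm (gradient (profile \<sigma> s) y) \<le> C"
proof -
  have bounded: "\<exists>C>0. \<forall>y. norm (gradient (profile \<sigma> s) y) \<le> C" for \<sigma>
    using C1_test_gradient_bounded[OF C1_test_profile(1)] assms by metis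
  obtain C D where "C > 0" "\<And>y. norm (gradient (profile 1 s) y) \<le> C" "\<And>y. norm (gradient (profile (-1) s) y) \<le> D"
    using bounded[of 1] bounded[of "-1"] by blast
  moreover have "\<sigma> = 1 \<or> \<sigma> = -1" if "\<bar>\<sigma>\<bar> = 1" for \<sigma> :: real using that by linarith
  ultimately show ?thesis by (intro that[of "max C D"]) (auto simp: le_max_iff_disj)
qed

context free_boundary_solution
begin

lemma curl_identity:
  assumes G: "\<And>j. C1_test \<Omega> (\<lambda>x. G x $ j) (H j)" and symmetric: "\<And>x i j. H i x $ j = H j x $ i"
  shows "has_bochner_integral lborel (\<lambda>x. u_ext x * (G x \<bullet> perp (grad x))) 0"
  using has_bochner_integral_mult_right[OF has_bochner_integral_diff[OF
        u_ext_square_by_parts[OF G[of 2], of 1] u_ext_square_by_parts[OF G[of 1], of 2]], of "1 / 2"]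
  by (simp add: symmetric[of 2 _ 1] inner_pt algebra_simps)

lemma GDERIV_perp_diff: "GDERIV (\<lambda>x. perp (x - c) $ i) x :> - perp (axis i 1)"
proof -
  have "perp (x - c) $ i = (x - c) \<bullet> - perp (axis i 1)" for x
    using exhaust_2[of i] by (auto simp: inner_pt axis_def)
  then show ?thesis unfolding gderiv_def by (auto intro!: derivative_eq_intros)
qed

lemma continuous_on_perp_diff: "continuous_on S (\<lambda>x. perp (x - c))"
  by (rule continuous_on_componentwise) (rule GDERIV_continuous_on[OF GDERIV_perp_diff])

lemma C1_test_rotation_field:
  assumes "C1_test S B G"
  shows "C1_test S (\<lambda>x. (B x *\<^sub>R perp (x - c)) $ i) (\<lambda>x. perp (x - c) $ i *\<^sub>R G x + B x *\<^sub>R - perp (axis i 1))"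
  using C1_test_mult_C1[OF assms GDERIV_perp_diff continuous_on_const]
  by (simp only: vector_scaleR_component real_scaleR_def mult.commute)

lemma divergence_rotation_field:
  "divergence (\<lambda>i x. perp (x - c) $ i *\<^sub>R G x + B x *\<^sub>R - perp (axis i 1)) x = G x \<bullet> perp (x - c)"
  by (simp add: divergence_def inner_pt sum_2 axis_def)

lemma stress_rotation_field:
  "stress (\<lambda>i x. perp (x - c) $ i *\<^sub>R G x + B x *\<^sub>R - perp (axis i 1)) x
    = 2 * (radial c x * (G x \<bullet> perp (grad x))) - energy_density x * (G x \<bullet> perp (x - c))"
  unfolding stress_def divergence_rotation_field energy_density_def power2_norm_pt
  by (simp add: inner_pt sum_2 axis_def radial_def power2_eq_square algebra_simps)

lemma rotation_field_identity:
  assumes B: "C1_test \<Omega> B G"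
    and G: "\<And>j. C1_test \<Omega> (\<lambda>x. G x $ j) (H j)" and symmetric: "\<And>x i j. H i x $ j = H j x $ i"
  shows "has_bochner_integral lborel (\<lambda>x. energy_density x * (G x \<bullet> perp (x - c))
    - 2 * (defect c N x * (G x \<bullet> perp (grad x)))
    + indicator air x * (x $ 2 * (G x \<bullet> perp (x - c)) + B x * (x - c) $ 1)) 0"
proof -
  have "has_bochner_integral lborel (\<lambda>x. 2 * N * (u_ext x * (G x \<bullet> perp (grad x))) -
      (stress (\<lambda>i x. perp (x - c) $ i *\<^sub>R G x + B x *\<^sub>R - perp (axis i 1)) x
        - indicator air x * (x $ 2 * divergence (\<lambda>i x. perp (x - c) $ i *\<^sub>R G x + B x *\<^sub>R - perp (axis i 1)) x
          + (B x *\<^sub>R perp (x - c)) $ 2))) (2 * N * 0 - 0)"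
    by (intro has_bochner_integral_diff has_bochner_integral_mult_right curl_identity[OF G symmetric]
        stress_identity[OF C1_test_rotation_field[OF B]])
  then show ?thesis
    unfolding stress_rotation_field divergence_rotation_field by (simp add: defect_def algebra_simps)
qed

lemma Young_defect_gradient:
  assumes "norm G \<le> M" "\<mu> > 0"
  shows "2 * (defect c N x * (G \<bullet> perp (grad x))) \<le> M * (\<mu> * (defect c N x)\<^sup>2 + energy_density x / \<mu>)"
proof -
  let ?e = "\<bar>defect c N x\<bar>" and ?p = "norm (grad x)"
  have "defect c N x * (G \<bullet> perp (grad x)) \<le> ?e * (norm G * ?p)"
    using abs_ge_self[of "defect c N x * (G \<bullet> perp (grad x))"]
      mult_left_mono[OF abs_inner_perp_le[of G "grad x"] abs_ge_zero[of "defect c N x"]]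
    by (simp add: abs_mult)
  also have "\<dots> \<le> ?e * (M * ?p)" using assms(1) by (intro mult_left_mono mult_right_mono) auto
  finally have "2 * (defect c N x * (G \<bullet> perp (grad x))) \<le> M * (2 * (?e * ?p))" by (simp add: mult_ac)
  also have "\<dots> \<le> M * (\<mu> * ?e\<^sup>2 + ?p\<^sup>2 / \<mu>)"
  proof (rule mult_left_mono)
    have "0 \<le> (\<mu> * ?e - ?p)\<^sup>2 / \<mu>" using assms(2) by simp
    also have "\<dots> = \<mu> * ?e\<^sup>2 + ?p\<^sup>2 / \<mu> - 2 * (?e * ?p)" using assms(2) by (simp add: field_simps power2_eq_square)
    finally show "2 * (?e * ?p) \<le> \<mu> * ?e\<^sup>2 + ?p\<^sup>2 / \<mu>" by simp
    show "0 \<le> M" using assms(1) norm_ge_zero order_trans by blast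
  qed
  finally show ?thesis by (simp add: energy_density_def)
qed

lemma rotation_energy_pointwise:
  assumes G: "norm G \<le> M" and x: "norm (x - c) \<le> r" and "\<mu> > 0"
    and vertical: "x \<in> air \<Longrightarrow> - (x - c) $ 1 * b \<le> k * x $ 2"
  shows "energy_density x * (G \<bullet> perp (x - c))
    \<le> energy_density x * (G \<bullet> perp (x - c)) - 2 * (defect c N x * (G \<bullet> perp (grad x)))
      + indicator air x * (x $ 2 * (G \<bullet> perp (x - c)) + b * (x - c) $ 1)
      + ((M * r + k) * air_density x + M * (\<mu> * (defect c N x)\<^sup>2 + energy_density x / \<mu>))"
proof -
  let ?t = "G \<bullet> perp (x - c)"
  have "\<bar>?t\<bar> \<le> norm G * norm (x - c)" by (rule abs_inner_perp_le)
  also have "\<dots> \<le> M * r" using G x order_trans[OF norm_ge_zero G] by (intro mult_mono) auto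
  finally have t: "- ?t \<le> M * r" by simp
  have "- (indicator air x * (x $ 2 * ?t + b * (x - c) $ 1)) \<le> (M * r + k) * air_density x"
  proof (cases "x \<in> air")
    case True
    then have "x $ 2 * - ?t \<le> x $ 2 * (M * r)" by (intro mult_left_mono t) (simp add: air_def)
    then show ?thesis using vertical[OF True] True by (simp add: air_density_def algebra_simps)
  qed (simp add: air_density_def)
  then show ?thesis using Young_defect_gradient[OF G \<open>\<mu> > 0\<close>, of c N x] by simp
qed

lemma rotation_energy_le:
  assumes B: "C1_test (cball c r) B G"
    and G: "\<And>j. C1_test (cball c r) (\<lambda>x. G x $ j) (H j)" and symmetric: "\<And>x i j. H i x $ j = H j x $ i"
    and sub: "cball c r \<subseteq> \<Omega>" and M: "\<And>x. norm (G x) \<le> M" and "\<mu> > 0"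
    and vertical: "\<And>x. 0 < x $ 2 \<Longrightarrow> - (x - c) $ 1 * B x \<le> k * x $ 2"
  shows "(\<integral>x. energy_density x * (G x \<bullet> perp (x - c)) \<partial>lborel)
    \<le> (M * r + k) * (LINT x:cball c r|lborel. air_density x)
      + M * (\<mu> * (LINT x:cball c r|lborel. (defect c N x)\<^sup>2) + (LINT x:cball c r|lborel. energy_density x) / \<mu>)"
proof -
  let ?I = "indicator (cball c r) :: pt \<Rightarrow> real"
  let ?t = "\<lambda>x. G x \<bullet> perp (x - c)"
  let ?null = "\<lambda>x. energy_density x * ?t x - 2 * (defect c N x * (G x \<bullet> perp (grad x)))
    + indicator air x * (x $ 2 * ?t x + B x * (x - c) $ 1)"
  let ?bound = "\<lambda>x. (M * r + k) * (?I x * air_density x) + M * (\<mu> * (?I x * (defect c N x)\<^sup>2) + ?I x * energy_density x / \<mu>)"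
  have null: "has_bochner_integral lborel ?null 0"
    by (rule rotation_field_identity[OF C1_test_mono[OF B sub] C1_test_mono[OF G sub] symmetric])
  have bound: "has_bochner_integral lborel (\<lambda>x. ?null x + ?bound x)
      (0 + ((M * r + k) * (LINT x:cball c r|lborel. air_density x)
        + M * (\<mu> * (LINT x:cball c r|lborel. (defect c N x)\<^sup>2) + (LINT x:cball c r|lborel. energy_density x) / \<mu>)))"
    by (intro has_bochner_integral_add has_bochner_integral_mult_right has_bochner_integral_divide_zero null
        locally_integrable_has_bochner_integral[OF _ compact_cball sub]
        air_density_locally_integrable defect_square_locally_integrable energy_density_locally_integrable)
  have "energy_density x * ?t x \<le> ?null x + ?bound x" for x
  proof (cases "x \<in> cball c r")
    case True
    then have "norm (x - c) \<le> r" by (simp add: dist_norm norm_minus_commute)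
    moreover have "0 < x $ 2" if "x \<in> air" using that by (simp add: air_def)
    ultimately show ?thesis
      using rotation_energy_pointwise[OF M[of x] _ \<open>\<mu> > 0\<close> vertical[of x], of r] True by simp
  next
    case False
    then show ?thesis using C1_test_zero_outside[OF B False] by simp
  qed
  moreover have "integrable lborel (\<lambda>x. energy_density x * ?t x)"
    by (rule integrable_mult_C1_test(2)[OF energy_density_locally_integrable C1_test_mono[OF B sub] continuous_on_perp_diff])
  ultimately show ?thesis
    using integral_mono[OF _ _ , of lborel "\<lambda>x. energy_density x * ?t x" "\<lambda>x. ?null x + ?bound x"] bound
    by (simp add: has_bochner_integral_iff)
qed

end

subsection \<open>Energy and mass of an annulus\<close>

abbreviation zoom :: "pt \<Rightarrow> real \<Rightarrow> pt \<Rightarrow> pt" where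
  "zoom c d x \<equiv> (1 / d) *\<^sub>R (x - c)"

lemma zoom_mem_cball:
  assumes "d > 0"
  shows "zoom c d x \<in> cball y r \<longleftrightarrow> x \<in> cball (c + d *\<^sub>R y) (r * d)"
proof -
  have "c + d *\<^sub>R y - x = d *\<^sub>R (y - zoom c d x)" using assms by (simp add: algebra_simps)
  then have "dist (c + d *\<^sub>R y) x = dist y (zoom c d x) * d" using assms by (simp add: dist_norm)
  then show ?thesis using assms by simp
qed

lemma zoom_continuous_on: "continuous_on S (zoom c d)"
  by (intro continuous_intros)

lemma annulus_cutoff_zoom_eq_0:
  assumes "x \<notin> cball c (2 * d)" "d > 0" "0 < s" "s \<le> 1"
  shows "annulus_cutoff s (zoom c d x) = 0"
  using assms zoom_mem_cball[of d x c 0 2] by (intro annulus_cutoff_eq_0) simp_all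

lemma integrable_mult_annulus_cutoff:
  assumes "locally_integrable S f" "cball c (2 * d) \<subseteq> S" "d > 0" "0 < s" "s \<le> 1"
  shows "integrable lborel (\<lambda>x. f x * annulus_cutoff s (zoom c d x))"
  by (rule integrable_mult_compact_support[OF _ locally_integrableD[OF assms(1) compact_cball assms(2)]])
    (use annulus_cutoff_zoom_eq_0 assms in \<open>auto intro!: annulus_cutoff_continuous_on zoom_continuous_on\<close>)

lemma C1_test_profile_zoom:
  fixes \<sigma> s d :: real and c :: pt
  defines "G \<equiv> \<lambda>x. (1 / d) *\<^sub>R gradient (profile \<sigma> s) (zoom c d x)"
    and "H \<equiv> \<lambda>j x. (1 / d) *\<^sub>R (1 / d) *\<^sub>R gradient (\<lambda>y. gradient (profile \<sigma> s) y $ j) (zoom c d x)"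
  assumes s: "0 < s" "s \<le> 1" and "d > 0"
  shows "C1_test (cball c (2 * d)) (\<lambda>x. profile \<sigma> s (zoom c d x)) G"
    and "C1_test (cball c (2 * d)) (\<lambda>x. G x $ j) (H j)"
    and "H i x $ j = H j x $ i"
proof -
  note profile = C1_test_profile[OF s, where \<sigma>=\<sigma>]
  have sub: "cball c (d * 2) \<subseteq> cball c (2 * d)" by (simp add: mult.commute)
  show "C1_test (cball c (2 * d)) (\<lambda>x. profile \<sigma> s (zoom c d x)) G"
    unfolding G_def by (rule C1_test_rescale[OF profile(1) \<open>d > 0\<close> sub])
  have "C1_test (cball c (2 * d)) (\<lambda>x. (1 / d) * gradient (profile \<sigma> s) (zoom c d x) $ j) (H j)"
    using C1_test_mult_C1[OF C1_test_rescale[OF profile(2) \<open>d > 0\<close> sub] GDERIV_const[of "1 / d"] continuous_on_const]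
    by (simp add: H_def)
  then show "C1_test (cball c (2 * d)) (\<lambda>x. G x $ j) (H j)" by (simp add: G_def)
  show "H i x $ j = H j x $ i" unfolding H_def using profile(3) by simp
qed

lemma profile_zoom_vertical_bound:
  assumes \<sigma>: "\<bar>\<sigma>\<bar> = 1" and s: "0 < s" "s \<le> 1 / 8" and d: "d > 0" and c: "c $ 2 = 0" and x: "0 < x $ 2"
  shows "- (x - c) $ 1 * profile \<sigma> s (zoom c d x) \<le> 5 / s * x $ 2"
proof -
  have "- zoom c d x $ 1 * profile \<sigma> s (zoom c d x) \<le> 5 / s * zoom c d x $ 2"
    using x d c by (intro profile_vertical_bound[OF \<sigma> s]) simp
  moreover have "- (x - c) $ 1 * a = d * (- zoom c d x $ 1 * a)" "5 / s * x $ 2 = d * (5 / s * zoom c d x $ 2)" for a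
    using d c by (simp_all add: left_diff_distrib)
  ultimately show ?thesis using d by (simp only: mult_left_mono less_imp_le)
qed

definition radial_cutoff :: "real \<Rightarrow> pt \<Rightarrow> real" where
  "radial_cutoff s y = 1 - smooth_step (((norm y)\<^sup>2 - 1) / s + 1 / 2)"

definition radial_cutoff_gradient :: "real \<Rightarrow> pt \<Rightarrow> pt" where
  "radial_cutoff_gradient s y = (- 2 * smooth_step' (((norm y)\<^sup>2 - 1) / s + 1 / 2) / s) *\<^sub>R y"

lemma radial_cutoff_bounds: "0 \<le> radial_cutoff s y" "radial_cutoff s y \<le> 1"
  using smooth_step_bounds by (simp_all add: radial_cutoff_def)

lemma radial_cutoff_eq_0:
  assumes "0 < s" "s \<le> 1" "y \<notin> cball 0 2"
  shows "radial_cutoff s y = 0"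
proof -
  have "2\<^sup>2 \<le> (norm y)\<^sup>2" using assms(3) by (intro power_mono) auto
  then have "1 \<le> ((norm y)\<^sup>2 - 1) / s" using assms by (simp add: pos_le_divide_eq)
  then show ?thesis by (simp add: radial_cutoff_def smooth_step_eq_1)
qed

lemma radial_cutoff_eq_1:
  assumes "0 < s" "s \<le> 1" "y \<in> cball 0 (1 / 2)"
  shows "radial_cutoff s y = 1"
proof -
  have "(norm y)\<^sup>2 \<le> (1 / 2)\<^sup>2" using assms(3) by (intro power_mono) auto
  then have "((norm y)\<^sup>2 - 1) / s \<le> - (1 / 2)" using assms by (simp add: pos_divide_le_eq power_divide)
  then show ?thesis by (simp add: radial_cutoff_def smooth_step_eq_0)
qed

lemma C1_test_radial_cutoff:
  assumes "0 < s" "s \<le> 1"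
  shows "C1_test (cball 0 2) (radial_cutoff s) (radial_cutoff_gradient s)"
proof (rule C1_testI[OF compact_cball order_refl radial_cutoff_eq_0[OF assms]])
  have "((\<lambda>t. (t - 1) / s + 1 / 2) has_real_derivative 1 / s) (at t)" for t
    using DERIV_add[OF DERIV_cdivide[OF DERIV_diff[OF DERIV_ident DERIV_const[of 1]]] DERIV_const] by simp
  then have "((\<lambda>t. 1 - smooth_step ((t - 1) / s + 1 / 2)) has_real_derivative
      0 - smooth_step' ((t - 1) / s + 1 / 2) * (1 / s)) (at t)" for t
    by (intro DERIV_diff DERIV_const DERIV_chain2[OF DERIV_smooth_step])
  from GDERIV_radial[OF this, where c=0] show "GDERIV (radial_cutoff s) y :> radial_cutoff_gradient s y" for y
    by (simp add: radial_cutoff_def[abs_def] radial_cutoff_gradient_def)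
  show "continuous_on UNIV (radial_cutoff_gradient s)"
    unfolding radial_cutoff_gradient_def[abs_def] smooth_step'_def divide_inverse by (intro continuous_intros)
qed

lemma radial_cutoff_gradient_le:
  assumes s: "0 < s" "s \<le> 1 / 8"
  shows "- (y \<bullet> radial_cutoff_gradient s y) \<le> 48 / s * annulus_cutoff s y"
proof -
  define t where "t = ((norm y)\<^sup>2 - 1) / s"
  have eq: "- (y \<bullet> radial_cutoff_gradient s y) = 2 * smooth_step' (t + 1 / 2) * (norm y)\<^sup>2 / s"
    by (simp add: radial_cutoff_gradient_def power2_norm_eq_inner t_def)
  have "2 * smooth_step' (t + 1 / 2) * (norm y)\<^sup>2 \<le> 48 * annulus_cutoff s y"
  proof (cases "smooth_step' (t + 1 / 2) = 0")
    case True
    then show ?thesis by (simp add: annulus_cutoff_bounds)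
  next
    case False
    then have t: "\<bar>t\<bar> \<le> 1 / 2" using smooth_step'_eq_0[of "t + 1 / 2"] by linarith
    then have "\<bar>t\<bar>\<^sup>2 \<le> (1 / 2)\<^sup>2" by (intro power_mono) auto
    then have "(3 / 4) ^ 3 \<le> annulus_cutoff s y"
      unfolding annulus_cutoff_def pos_power_def t_def[symmetric] by (intro power_mono) (simp_all add: power_divide)
    moreover have "smooth_step' (t + 1 / 2) * (norm y)\<^sup>2 \<le> 9 * (9 / 8)"
    proof (rule mult_mono[OF smooth_step'_le])
      have "t \<le> 1 / 2" using t by simp
      then have "(norm y)\<^sup>2 - 1 \<le> 1 / 2 * s" using s(1) by (simp add: t_def pos_divide_le_eq)
      then show "(norm y)\<^sup>2 \<le> 9 / 8" using s by linarith
    qed simp_all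
    moreover have "(3 / 4 :: real) ^ 3 = 27 / 64" by (simp add: power_divide)
    ultimately show ?thesis by linarith
  qed
  then show ?thesis unfolding eq using s by (simp add: divide_right_mono)
qed

context free_boundary_solution
begin

lemma profile_energy_lower:
  assumes \<sigma>: "\<bar>\<sigma>\<bar> = 1" and s: "0 < s" "s \<le> 1 / 8" and "d > 0" "c $ 2 = 0"
  shows "energy_density x * annulus_cutoff s (zoom c d x) / 4
    \<le> energy_density x * (((1 / d) *\<^sub>R gradient (profile \<sigma> s) (zoom c d x)) \<bullet> perp (x - c))
      + 400 / s * (indicator (cball (c + (d * \<sigma>) *\<^sub>R axis 1 1) (4 * s * d)) x * energy_density x)"
proof (cases "x $ 2 > 0")
  case False
  then have "grad x = 0" using fluid_above by (intro grad_off_fluid) auto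
  then show ?thesis by (simp add: energy_density_def)
next
  case True
  let ?y = "zoom c d x" and ?z = "c + (d * \<sigma>) *\<^sub>R axis 1 1"
  have "perp (x - c) = d *\<^sub>R perp ?y" using \<open>d > 0\<close> by (simp add: vec_eq_iff forall_2 perp_def)
  then have rescaled: "((1 / d) *\<^sub>R gradient (profile \<sigma> s) ?y) \<bullet> perp (x - c) = gradient (profile \<sigma> s) ?y \<bullet> perp ?y"
    using \<open>d > 0\<close> by simp
  have "?y \<in> cball (\<sigma> *\<^sub>R axis 1 1) (4 * s) \<longleftrightarrow> x \<in> cball ?z (4 * s * d)"
    using zoom_mem_cball[OF \<open>d > 0\<close>, of x c "\<sigma> *\<^sub>R axis 1 1" "4 * s"] by simp
  then have hole: "indicator (cball (\<sigma> *\<^sub>R axis 1 1) (4 * s)) ?y = (indicator (cball ?z (4 * s * d)) x :: real)"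
    by (simp only: indicator_def)
  have "annulus_cutoff s ?y / 4 - 400 / s * indicator (cball (\<sigma> *\<^sub>R axis 1 1) (4 * s)) ?y
      \<le> gradient (profile \<sigma> s) ?y \<bullet> perp ?y"
    using True \<open>d > 0\<close> \<open>c $ 2 = 0\<close> s C1_test_GDERIV[OF C1_test_profile(1)]
    by (intro profile_angular_derivative_lower[OF \<sigma> s]) auto
  from mult_left_mono[OF this energy_density_nonneg[of x]] show ?thesis
    unfolding hole rescaled by (simp add: algebra_simps)
qed

lemma annulus_energy_le:
  assumes \<sigma>: "\<bar>\<sigma>\<bar> = 1" and s: "0 < s" "s \<le> 1 / 8" and C: "\<And>y. norm (gradient (profile \<sigma> s) y) \<le> C"
    and d: "d > 0" and c: "c $ 2 = 0" and sub: "cball c (2 * d) \<subseteq> \<Omega>" and "\<mu> > 0"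
  shows "(\<integral>x. energy_density x * annulus_cutoff s (zoom c d x) \<partial>lborel) / 4
    \<le> 400 / s * (LINT x:cball (c + (d * \<sigma>) *\<^sub>R axis 1 1) (4 * s * d)|lborel. energy_density x)
      + (2 * C + 5 / s) * (LINT x:cball c (2 * d)|lborel. air_density x)
      + C / d * (\<mu> * (LINT x:cball c (2 * d)|lborel. (defect c N x)\<^sup>2)
        + (LINT x:cball c (2 * d)|lborel. energy_density x) / \<mu>)"
proof -
  let ?z = "c + (d * \<sigma>) *\<^sub>R axis 1 1" and ?G = "\<lambda>x. (1 / d) *\<^sub>R gradient (profile \<sigma> s) (zoom c d x)"
  have s_le_1: "s \<le> 1" using s by simp
  note test = C1_test_profile_zoom[OF s(1) s_le_1 d, where \<sigma>=\<sigma> and c=c]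
  have G_bound: "norm (?G x) \<le> C / d" for x using C[of "zoom c d x"] d by (simp add: divide_right_mono)
  have "C / d * (2 * d) + 5 / s = 2 * C + 5 / s" using d by simp
  then have upper: "(\<integral>x. energy_density x * (?G x \<bullet> perp (x - c)) \<partial>lborel)
      \<le> (2 * C + 5 / s) * (LINT x:cball c (2 * d)|lborel. air_density x)
      + C / d * (\<mu> * (LINT x:cball c (2 * d)|lborel. (defect c N x)\<^sup>2)
        + (LINT x:cball c (2 * d)|lborel. energy_density x) / \<mu>)"
    using rotation_energy_le[OF test sub G_bound \<open>\<mu> > 0\<close> profile_zoom_vertical_bound[OF \<sigma> s d c], of N] by simp
  have rotation: "integrable lborel (\<lambda>x. energy_density x * (?G x \<bullet> perp (x - c)))"
    by (rule integrable_mult_C1_test(2)[OF energy_density_locally_integrable C1_test_mono[OF test(1) sub]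
        continuous_on_perp_diff])
  have "?z \<in> cball c d" using \<sigma> d by (simp add: dist_norm abs_mult)
  then have "cball ?z (4 * s * d) \<subseteq> cball c (2 * d)"
    using s d by (intro cball_subset_cball_double) (auto simp: dist_commute)
  then have hole: "has_bochner_integral lborel (\<lambda>x. indicator (cball ?z (4 * s * d)) x * energy_density x)
      (LINT x:cball ?z (4 * s * d)|lborel. energy_density x)"
    using sub
    by (intro locally_integrable_has_bochner_integral[OF energy_density_locally_integrable compact_cball]) auto
  have annulus: "integrable lborel (\<lambda>x. energy_density x * annulus_cutoff s (zoom c d x))"
    by (rule integrable_mult_annulus_cutoff[OF energy_density_locally_integrable sub d s(1) s_le_1])
  have "(\<integral>x. energy_density x * annulus_cutoff s (zoom c d x) \<partial>lborel) / 4
      = (\<integral>x. energy_density x * annulus_cutoff s (zoom c d x) / 4 \<partial>lborel)" by simp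
  also have "\<dots> \<le> (\<integral>x. energy_density x * (?G x \<bullet> perp (x - c))
          + 400 / s * (indicator (cball ?z (4 * s * d)) x * energy_density x) \<partial>lborel)"
    using annulus rotation hole
    by (intro integral_mono profile_energy_lower[OF \<sigma> s d c]) (auto simp: has_bochner_integral_iff)
  also have "\<dots> = (\<integral>x. energy_density x * (?G x \<bullet> perp (x - c)) \<partial>lborel)
      + 400 / s * (LINT x:cball ?z (4 * s * d)|lborel. energy_density x)"
    using rotation hole by (subst Bochner_Integration.integral_add) (auto simp: has_bochner_integral_iff)
  finally show ?thesis using upper by linarith
qed

lemma mass_cutoff_le:
  assumes a: "C1_test \<Omega> a A" "\<And>x. 0 \<le> a x" and "0 \<le> N"
  shows "(\<integral>x. (u_ext x)\<^sup>2 * a x \<partial>lborel)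
    \<le> (\<integral>x. (defect c N x)\<^sup>2 * a x \<partial>lborel) - (\<integral>x. (u_ext x)\<^sup>2 * (A x \<bullet> (x - c)) \<partial>lborel)"
proof -
  let ?null = "\<lambda>x. (u_ext x)\<^sup>2 * ((x - c) \<bullet> A x + 2 * a x) + 2 * (u_ext x * radial c x * a x)"
  have int: "integrable lborel (\<lambda>x. (u_ext x)\<^sup>2 * a x)" "integrable lborel (\<lambda>x. (defect c N x)\<^sup>2 * a x)"
    "integrable lborel (\<lambda>x. (u_ext x)\<^sup>2 * (A x \<bullet> (x - c)))"
    by (intro integrable_mult_C1_test(1)[OF _ a(1)] integrable_mult_C1_test(2)[OF _ a(1)]
        u_ext_square_locally_integrable defect_square_locally_integrable continuous_intros)+
  have null: "integrable lborel ?null" "integral\<^sup>L lborel ?null = 0"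
    using mass_radial_field[OF a(1), of c] by (simp_all add: has_bochner_integral_iff)
  have "(\<integral>x. (u_ext x)\<^sup>2 * a x \<partial>lborel)
      \<le> (\<integral>x. (defect c N x)\<^sup>2 * a x - (u_ext x)\<^sup>2 * (A x \<bullet> (x - c)) + ?null x \<partial>lborel)"
  proof (rule integral_mono[OF int(1)])
    show "integrable lborel (\<lambda>x. (defect c N x)\<^sup>2 * a x - (u_ext x)\<^sup>2 * (A x \<bullet> (x - c)) + ?null x)"
      by (intro Bochner_Integration.integrable_add Bochner_Integration.integrable_diff int null)
    fix x
    have "0 \<le> a x * ((u_ext x + defect c N x)\<^sup>2 + 2 * N * (u_ext x)\<^sup>2)"
      using a(2)[of x] \<open>0 \<le> N\<close> by (intro mult_nonneg_nonneg add_nonneg_nonneg) auto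
    moreover have "(defect c N x)\<^sup>2 * a x - (u_ext x)\<^sup>2 * (A x \<bullet> (x - c)) + ?null x - (u_ext x)\<^sup>2 * a x
        = a x * ((u_ext x + defect c N x)\<^sup>2 + 2 * N * (u_ext x)\<^sup>2)"
      by (simp add: defect_def inner_commute power2_eq_square algebra_simps)
    ultimately show "(u_ext x)\<^sup>2 * a x \<le> (defect c N x)\<^sup>2 * a x - (u_ext x)\<^sup>2 * (A x \<bullet> (x - c)) + ?null x" by linarith
  qed
  also have "\<dots> = (\<integral>x. (defect c N x)\<^sup>2 * a x - (u_ext x)\<^sup>2 * (A x \<bullet> (x - c)) \<partial>lborel) + integral\<^sup>L lborel ?null"
    by (intro Bochner_Integration.integral_add Bochner_Integration.integrable_diff int null)
  also have "\<dots> = (\<integral>x. (defect c N x)\<^sup>2 * a x \<partial>lborel) - (\<integral>x. (u_ext x)\<^sup>2 * (A x \<bullet> (x - c)) \<partial>lborel)"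
    unfolding null(2) using int by simp
  finally show ?thesis .
qed

lemma inner_ball_mass_le_annulus_mass:
  assumes s: "0 < s" "s \<le> 1 / 8" and d: "d > 0" and sub: "cball c (2 * d) \<subseteq> \<Omega>" and "0 \<le> N"
  shows "(LINT x:cball c (d / 2)|lborel. (u_ext x)\<^sup>2)
    \<le> (LINT x:cball c (2 * d)|lborel. (defect c N x)\<^sup>2)
      + 48 / s * (\<integral>x. (u_ext x)\<^sup>2 * annulus_cutoff s (zoom c d x) \<partial>lborel)"
proof -
  let ?a = "\<lambda>x. radial_cutoff s (zoom c d x)" and ?A = "\<lambda>x. (1 / d) *\<^sub>R radial_cutoff_gradient s (zoom c d x)"
  let ?\<eta> = "\<lambda>x. annulus_cutoff s (zoom c d x)"
  have s_le_1: "s \<le> 1" using s by simp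
  have cutoff_ball: "C1_test (cball c (2 * d)) ?a ?A"
    by (rule C1_test_rescale[OF C1_test_radial_cutoff[OF s(1) s_le_1] d]) (simp add: mult.commute)
  then have a: "C1_test \<Omega> ?a ?A" using sub by (rule C1_test_mono)
  have half_sub: "cball c (d / 2) \<subseteq> \<Omega>" using sub d subset_cball[of "d / 2" "2 * d" c] by auto
  have "?a x = 1" if "x \<in> cball c (d / 2)" for x
    using that zoom_mem_cball[OF d, of x c 0 "1 / 2"] by (intro radial_cutoff_eq_1[OF s(1) s_le_1]) simp
  then have inner: "1 * (LINT x:cball c (d / 2)|lborel. (u_ext x)\<^sup>2) \<le> (\<integral>x. (u_ext x)\<^sup>2 * ?a x \<partial>lborel)"
    using locally_integrableD[OF u_ext_square_locally_integrable compact_cball half_sub]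
      integrable_mult_C1_test(1)[OF u_ext_square_locally_integrable a]
    by (intro set_integral_le_weighted_integral) (auto simp: radial_cutoff_bounds)
  have outer: "(\<integral>x. (defect c N x)\<^sup>2 * ?a x \<partial>lborel) \<le> 1 * (LINT x:cball c (2 * d)|lborel. (defect c N x)\<^sup>2)"
    using C1_test_zero_outside(1)[OF cutoff_ball]
    by (intro weighted_integral_le_set_integral radial_cutoff_bounds integrable_mult_C1_test(1)[OF _ a]
        locally_integrableD[OF _ compact_cball sub] defect_square_locally_integrable) auto
  have "(\<integral>x. (u_ext x)\<^sup>2 * - (?A x \<bullet> (x - c)) \<partial>lborel) \<le> (\<integral>x. 48 / s * ((u_ext x)\<^sup>2 * ?\<eta> x) \<partial>lborel)"
  proof (rule integral_mono)
    have "integrable lborel (\<lambda>x. (u_ext x)\<^sup>2 * (?A x \<bullet> (x - c)))"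
      by (intro integrable_mult_C1_test(2)[OF _ a] u_ext_square_locally_integrable continuous_intros)
    then show "integrable lborel (\<lambda>x. (u_ext x)\<^sup>2 * - (?A x \<bullet> (x - c)))" by simp
    show "integrable lborel (\<lambda>x. 48 / s * ((u_ext x)\<^sup>2 * ?\<eta> x))"
      by (intro integrable_mult_right integrable_mult_annulus_cutoff[OF u_ext_square_locally_integrable sub d s(1) s_le_1])
    fix x
    have "?A x \<bullet> (x - c) = zoom c d x \<bullet> radial_cutoff_gradient s (zoom c d x)" by (simp add: inner_commute)
    then have "- (?A x \<bullet> (x - c)) \<le> 48 / s * ?\<eta> x" using radial_cutoff_gradient_le[OF s, of "zoom c d x"] by (simp only:)
    from mult_left_mono[OF this zero_le_power2[of "u_ext x"]]
    show "(u_ext x)\<^sup>2 * - (?A x \<bullet> (x - c)) \<le> 48 / s * ((u_ext x)\<^sup>2 * ?\<eta> x)" by (simp add: mult_ac)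
  qed
  then have "- (\<integral>x. (u_ext x)\<^sup>2 * (?A x \<bullet> (x - c)) \<partial>lborel) \<le> 48 / s * (\<integral>x. (u_ext x)\<^sup>2 * ?\<eta> x \<partial>lborel)" by simp
  then show ?thesis
    using inner outer mass_cutoff_le[OF a radial_cutoff_bounds(1) \<open>0 \<le> N\<close>, of c] by linarith
qed

lemma u_ext_square_le:
  assumes "norm (x - c) \<le> r" and N: "3 / 2 \<le> N"
  shows "(u_ext x)\<^sup>2 \<le> r\<^sup>2 * energy_density x + (defect c N x)\<^sup>2"
proof -
  have "\<bar>radial c x\<bar> \<le> norm (x - c) * norm (grad x)" unfolding radial_def by (rule Cauchy_Schwarz_ineq2)
  also have "\<dots> \<le> r * norm (grad x)" using assms(1) by (rule mult_right_mono) simp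
  finally have "\<bar>radial c x\<bar>\<^sup>2 \<le> (r * norm (grad x))\<^sup>2" by (intro power_mono) auto
  then have radial: "(radial c x)\<^sup>2 \<le> r\<^sup>2 * energy_density x" by (simp add: energy_density_def power_mult_distrib)
  have "(3 / 2)\<^sup>2 \<le> N\<^sup>2" using N by (intro power_mono) auto
  then have "2 * (u_ext x)\<^sup>2 \<le> N\<^sup>2 * (u_ext x)\<^sup>2" by (intro mult_right_mono) (auto simp: power2_eq_square)
  moreover have "0 \<le> (radial c x + defect c N x)\<^sup>2" by simp
  moreover have "(radial c x + defect c N x)\<^sup>2 = 2 * (radial c x)\<^sup>2 + 2 * (defect c N x)\<^sup>2 - N\<^sup>2 * (u_ext x)\<^sup>2"
    unfolding defect_def by algebra
  ultimately show ?thesis using radial by linarith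
qed

lemma annulus_mass_le_energy:
  assumes s: "0 < s" "s \<le> 1" and d: "d > 0" and sub: "cball c (2 * d) \<subseteq> \<Omega>" and N: "3 / 2 \<le> N"
  shows "(\<integral>x. (u_ext x)\<^sup>2 * annulus_cutoff s (zoom c d x) \<partial>lborel)
    \<le> 4 * d\<^sup>2 * (\<integral>x. energy_density x * annulus_cutoff s (zoom c d x) \<partial>lborel)
      + (LINT x:cball c (2 * d)|lborel. (defect c N x)\<^sup>2)"
proof -
  let ?\<eta> = "\<lambda>x. annulus_cutoff s (zoom c d x)"
  have int: "integrable lborel (\<lambda>x. f x * ?\<eta> x)" if "locally_integrable \<Omega> f" for f
    by (rule integrable_mult_annulus_cutoff[OF that sub d s])
  note int = int[OF u_ext_square_locally_integrable] int[OF energy_density_locally_integrable]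
    int[OF defect_square_locally_integrable[of c N]]
  have "(u_ext x)\<^sup>2 \<le> 4 * d\<^sup>2 * energy_density x + (defect c N x)\<^sup>2" if "x \<in> cball c (2 * d)" for x
    using u_ext_square_le[OF _ N, of x c "2 * d"] that by (simp add: dist_norm norm_minus_commute power_mult_distrib)
  then have "(u_ext x)\<^sup>2 * ?\<eta> x \<le> (4 * d\<^sup>2 * energy_density x + (defect c N x)\<^sup>2) * ?\<eta> x" for x
    using annulus_cutoff_zoom_eq_0[OF _ d s, of x c] annulus_cutoff_bounds(1)
    by (cases "x \<in> cball c (2 * d)") (simp_all add: mult_right_mono)
  then have "(\<integral>x. (u_ext x)\<^sup>2 * ?\<eta> x \<partial>lborel) \<le> (\<integral>x. 4 * d\<^sup>2 * (energy_density x * ?\<eta> x) + (defect c N x)\<^sup>2 * ?\<eta> x \<partial>lborel)"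
    unfolding distrib_right mult.assoc
    by (intro integral_mono int Bochner_Integration.integrable_add integrable_mult_right)
  also have "\<dots> = 4 * d\<^sup>2 * (\<integral>x. energy_density x * ?\<eta> x \<partial>lborel) + (\<integral>x. (defect c N x)\<^sup>2 * ?\<eta> x \<partial>lborel)"
    using int by simp
  also have "(\<integral>x. (defect c N x)\<^sup>2 * ?\<eta> x \<partial>lborel) \<le> 1 * (LINT x:cball c (2 * d)|lborel. (defect c N x)\<^sup>2)"
    by (rule weighted_integral_le_set_integral[OF locally_integrableD[OF defect_square_locally_integrable compact_cball sub]
          int(3)])
      (simp_all add: annulus_cutoff_bounds annulus_cutoff_zoom_eq_0[OF _ d s] del: mem_cball)
  finally show ?thesis by simp
qed

end

subsection \<open>The frequency gap\<close>

locale nearly_homogeneous = free_boundary_solution +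
  fixes c :: pt and T d \<tau> \<Lambda> \<delta> :: real
  assumes center: "center c T" and d: "0 < d" and \<tau>: "16 * d\<^sup>2 < \<tau>" "\<tau> < 64 * d\<^sup>2" "\<tau> < T" and \<delta>: "0 < \<delta>" "\<delta> \<le> 1"
    and frequency_le: "frequency c \<tau> \<le> \<Lambda>"
    and homogeneity_defect_le: "homogeneity_defect c \<tau> \<le> \<delta>\<^sup>2 * mass c \<tau>"
    and air_energy_le: "air_energy c \<tau> \<le> \<delta> * mass c \<tau>"
begin

abbreviation energy_ratio :: real where
  "energy_ratio \<equiv> energy c \<tau> / mass c \<tau>"

lemma scale_pos: "0 < \<tau>"
  using \<tau>(1) zero_le_power2[of d] by linarith

lemma scale_admissible: "admissible c \<tau>"
  by (rule center_admissible[OF center scale_pos]) (use \<tau> in simp)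

lemma scale_mass_pos: "mass c \<tau> > 0"
  by (rule mass_pos[OF center scale_pos]) (use \<tau> in simp)

lemma exponent_bound: "3 / 2 \<le> \<Lambda>"
  using frequency_ge[OF center scale_pos \<tau>(3)] frequency_le by linarith

lemma energy_ratio_ge: "3 / 2 \<le> energy_ratio"
  using energy_lower_bound[OF center scale_pos \<tau>(3)] air_energy_nonneg[of c \<tau>] scale_mass_pos
  by (simp add: pos_le_divide_eq)

lemma scale_energy_le: "energy c \<tau> \<le> (\<Lambda> + 1) * mass c \<tau>"
proof -
  have "energy c \<tau> - air_energy c \<tau> \<le> \<Lambda> * mass c \<tau>"
    using frequency_le scale_mass_pos by (simp add: frequency_def pos_divide_le_eq)
  moreover have "\<delta> * mass c \<tau> \<le> 1 * mass c \<tau>" using \<delta> mass_nonneg by (intro mult_right_mono) auto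
  ultimately show ?thesis using air_energy_le by (simp add: distrib_right)
qed

lemma cball_double_subset: "cball c (2 * d) \<subseteq> \<Omega>"
proof -
  have "(2 * d)\<^sup>2 = 4 * d\<^sup>2" by (simp add: power_mult_distrib)
  then have "2 * d \<le> sqrt \<tau>" using \<tau>(1) zero_le_power2[of d] by (intro real_le_rsqrt) linarith
  then show ?thesis using scale_admissible subset_cball[of "2 * d" "sqrt \<tau>" c] by (auto simp: admissible_def)
qed

lemma ball_integral_scale:
  assumes "locally_integrable \<Omega> f" "\<And>x. 0 \<le> f x" "n > 0"
  shows "d ^ (2 * n) * (LINT x:cball c (2 * d)|lborel. f x) \<le> kernel_integral n f c \<tau>"
proof -
  have "(d\<^sup>2) ^ n * (LINT x:cball c (2 * d)|lborel. f x) \<le> kernel_integral n f c \<tau>"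
    using scale_admissible d \<tau>(1)
    by (intro ball_integral_le_kernel_integral[OF assms(1,2) _ assms(3)]) (auto simp: admissible_def power_mult_distrib)
  then show ?thesis by (simp only: power_mult)
qed

lemma ball_defect_le: "d ^ 4 * (LINT x:cball c (2 * d)|lborel. (defect c energy_ratio x)\<^sup>2) \<le> \<delta>\<^sup>2 * mass c \<tau>"
  using ball_integral_scale[OF defect_square_locally_integrable, of c energy_ratio 2] homogeneity_defect_le
  by (simp add: homogeneity_defect_def)

lemma ball_mass_le: "d ^ 4 * (LINT x:cball c (2 * d)|lborel. (u_ext x)\<^sup>2) \<le> mass c \<tau>"
  using ball_integral_scale[OF u_ext_square_locally_integrable, of 2] by (simp add: mass_def)

lemma ball_energy_le: "d ^ 6 * (LINT x:cball c (2 * d)|lborel. energy_density x) \<le> 6 * (\<Lambda> + 1) * mass c \<tau>"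
  using ball_integral_scale[OF energy_density_locally_integrable energy_density_nonneg, of 3] scale_energy_le
  by (simp add: energy_def algebra_simps)

lemma ball_air_energy_le: "d ^ 6 * (LINT x:cball c (2 * d)|lborel. air_density x) \<le> 6 * \<delta> * mass c \<tau>"
  using ball_integral_scale[OF air_density_locally_integrable air_density_nonneg, of 3] air_energy_le
  by (simp add: air_energy_def)

lemma inner_ball_mass_ge:
  "16 * ((1 / 256) powr (3 + \<Lambda>) - 256 * \<delta>) * mass c \<tau> \<le> d ^ 4 * (LINT x:cball c (d / 2)|lborel. (u_ext x)\<^sup>2)"
proof -
  let ?t = "d\<^sup>2 / 4"
  have t: "0 < ?t" "?t < \<tau>" "?t \<le> T" using d \<tau> zero_le_power2[of d] by auto
  have "(1 / 256) powr (3 + \<Lambda>) \<le> (?t / \<tau>) powr (3 + \<Lambda>)"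
    using \<tau>(2) scale_pos exponent_bound by (intro powr_mono2) (auto simp: field_simps)
  moreover have "\<delta> * (\<tau> / ?t) \<le> \<delta> * 256"
    using \<tau>(2) d \<delta>(1) by (intro mult_left_mono) (auto simp: field_simps)
  ultimately have "mass c \<tau> * ((1 / 256) powr (3 + \<Lambda>) - 256 * \<delta>) \<le> mass c \<tau> * ((?t / \<tau>) powr (3 + \<Lambda>) - \<delta> * (\<tau> / ?t))"
    using mass_nonneg by (intro mult_left_mono) auto
  also have "\<dots> \<le> mass c ?t" by (rule mass_doubling[OF center t(1,2) \<tau>(3) frequency_le air_energy_le])
  also have "\<dots> \<le> ?t\<^sup>2 * (LINT x:cball c (sqrt ?t)|lborel. (u_ext x)\<^sup>2)"
    unfolding mass_def using center_admissible[OF center t(1,3)] t(1)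
    by (intro kernel_integral_le_ball_integral[OF u_ext_square_locally_integrable]) (auto simp: admissible_def)
  also have "sqrt ?t = d / 2" using d by (simp add: real_sqrt_divide)
  also have "?t\<^sup>2 = d ^ 4 / 16" by (simp add: power_divide)
  finally show ?thesis by (simp add: mult_ac)
qed

lemma distant_energy_le:
  assumes z: "center z T'" "d\<^sup>2 < T'" "dist c z = d" and s: "0 < s" "s \<le> 1 / 12"
  shows "d ^ 6 * (LINT x:cball z (4 * s * d)|lborel. energy_density x) \<le> 12 * 3 ^ 6 * 64 * s ^ 3 * mass c \<tau>"
proof -
  have "s\<^sup>2 \<le> (1 / 12)\<^sup>2" using s by (intro power_mono) auto
  then have "128 * s\<^sup>2 * d\<^sup>2 \<le> 1 * d\<^sup>2" by (intro mult_right_mono) (simp_all add: power_divide)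
  then have "8 * (4 * s * d)\<^sup>2 \<le> d\<^sup>2" by (simp add: power_mult_distrib)
  from small_scale_energy[OF z(1) _ this d z(2)] s d
  have "(LINT x:cball z (4 * s * d)|lborel. energy_density x)
      \<le> 12 * 3 ^ 6 * (4 * s) ^ 3 / d\<^sup>2 * (LINT x:cball z d|lborel. (u_ext x)\<^sup>2)" by simp
  also have "\<dots> \<le> 12 * 3 ^ 6 * (4 * s) ^ 3 / d\<^sup>2 * (LINT x:cball c (2 * d)|lborel. (u_ext x)\<^sup>2)"
  proof (rule mult_left_mono)
    have "cball z d \<subseteq> cball c (2 * d)" using z(3) by (intro cball_subset_cball_double) (auto simp: dist_commute)
    then show "(LINT x:cball z d|lborel. (u_ext x)\<^sup>2) \<le> (LINT x:cball c (2 * d)|lborel. (u_ext x)\<^sup>2)"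
      by (intro set_integral_mono_subset locally_integrableD[OF u_ext_square_locally_integrable compact_cball
          cball_double_subset]) auto
  qed (use s in simp)
  finally have "d ^ 6 * (LINT x:cball z (4 * s * d)|lborel. energy_density x)
      \<le> d ^ 6 * (12 * 3 ^ 6 * (4 * s) ^ 3 / d\<^sup>2 * (LINT x:cball c (2 * d)|lborel. (u_ext x)\<^sup>2))"
    by (rule mult_left_mono) simp
  also have "\<dots> = 12 * 3 ^ 6 * 64 * s ^ 3 * (d ^ 4 * (LINT x:cball c (2 * d)|lborel. (u_ext x)\<^sup>2))"
    using d by (simp add: power_mult_distrib eval_nat_numeral)
  also have "\<dots> \<le> 12 * 3 ^ 6 * 64 * s ^ 3 * mass c \<tau>" using s by (intro mult_left_mono ball_mass_le) simp
  finally show ?thesis .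
qed

definition annulus_energy_bound :: "real \<Rightarrow> real \<Rightarrow> real" where
  "annulus_energy_bound C s = 400 * (12 * 3 ^ 6 * 64) * s\<^sup>2 + ((2 * C + 5 / s) * 6 + C * (1 + 6 * (\<Lambda> + 1))) * \<delta>"

lemma annulus_energy_small:
  assumes z: "center (c + (d * \<sigma>) *\<^sub>R axis 1 1) T'" "d\<^sup>2 < T'" and \<sigma>: "\<bar>\<sigma>\<bar> = 1" and s: "0 < s" "s \<le> 1 / 12"
    and C: "C > 0" "\<And>y. norm (gradient (profile \<sigma> s) y) \<le> C"
  shows "d ^ 6 * (\<integral>x. energy_density x * annulus_cutoff s (zoom c d x) \<partial>lborel)
    \<le> 4 * annulus_energy_bound C s * mass c \<tau>"
proof -
  let ?z = "c + (d * \<sigma>) *\<^sub>R axis 1 1" and ?m = "mass c \<tau>"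
  define D E A P where "D = (LINT x:cball c (2 * d)|lborel. (defect c energy_ratio x)\<^sup>2)"
    and "E = (LINT x:cball c (2 * d)|lborel. energy_density x)"
    and "A = (LINT x:cball c (2 * d)|lborel. air_density x)"
    and "P = (LINT x:cball ?z (4 * s * d)|lborel. energy_density x)"
  have "c $ 2 = 0" using center by (simp add: center_def)
  have "s \<le> 1 / 8" "0 < 1 / (d * \<delta>)" using s d \<delta> by auto
  from annulus_energy_le[OF \<sigma> s(1) this(1) C(2) d \<open>c $ 2 = 0\<close> cball_double_subset this(2), of energy_ratio]
  have "d ^ 6 * ((\<integral>x. energy_density x * annulus_cutoff s (zoom c d x) \<partial>lborel) / 4)
      \<le> d ^ 6 * (400 / s * P + (2 * C + 5 / s) * A + C / d * (1 / (d * \<delta>) * D + E / (1 / (d * \<delta>))))"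
    unfolding D_def E_def A_def P_def by (intro mult_left_mono) auto
  also have "\<dots> = 400 / s * (d ^ 6 * P) + (2 * C + 5 / s) * (d ^ 6 * A) + C * (d ^ 4 * D / \<delta> + \<delta> * (d ^ 6 * E))"
    using d \<delta>(1) by (simp add: field_simps eval_nat_numeral)
  also have "\<dots> \<le> 400 / s * (12 * 3 ^ 6 * 64 * s ^ 3 * ?m) + (2 * C + 5 / s) * (6 * \<delta> * ?m)
      + C * (\<delta>\<^sup>2 * ?m / \<delta> + \<delta> * (6 * (\<Lambda> + 1) * ?m))"
  proof (intro add_mono mult_left_mono divide_right_mono)
    show "d ^ 6 * P \<le> 12 * 3 ^ 6 * 64 * s ^ 3 * ?m"
      unfolding P_def by (rule distant_energy_le[OF z _ s]) (use \<sigma> d in \<open>simp add: dist_norm abs_mult\<close>)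
    show "d ^ 4 * D \<le> \<delta>\<^sup>2 * ?m" "d ^ 6 * E \<le> 6 * (\<Lambda> + 1) * ?m" "d ^ 6 * A \<le> 6 * \<delta> * ?m"
      unfolding D_def E_def A_def by (rule ball_defect_le ball_energy_le ball_air_energy_le)+
  qed (use s C(1) \<delta> in auto)
  also have "\<dots> = annulus_energy_bound C s * ?m"
    using s(1) \<delta>(1) by (simp add: annulus_energy_bound_def field_simps eval_nat_numeral)
  finally show ?thesis by simp
qed

text \<open>The annulus carries mass of order at least \<open>s\<close> but energy of order at most \<open>s\<^sup>2\<close>.\<close>

lemma annulus_balance:
  assumes z: "center (c + (d * \<sigma>) *\<^sub>R axis 1 1) T'" "d\<^sup>2 < T'" and \<sigma>: "\<bar>\<sigma>\<bar> = 1" and s: "0 < s" "s \<le> 1 / 12"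
    and C: "C > 0" "\<And>y. norm (gradient (profile \<sigma> s) y) \<le> C"
  shows "16 * ((1 / 256) powr (3 + \<Lambda>) - 256 * \<delta>)
    \<le> \<delta>\<^sup>2 + 48 / s * (16 * annulus_energy_bound C s + \<delta>\<^sup>2)"
proof -
  let ?m = "mass c \<tau>" and ?bound = "annulus_energy_bound C s"
    and ?D = "LINT x:cball c (2 * d)|lborel. (defect c energy_ratio x)\<^sup>2"
  let ?V = "\<integral>x. (u_ext x)\<^sup>2 * annulus_cutoff s (zoom c d x) \<partial>lborel"
    and ?X = "\<integral>x. energy_density x * annulus_cutoff s (zoom c d x) \<partial>lborel"
  have s_small: "s \<le> 1 / 8" "s \<le> 1" using s by auto
  have "d ^ 4 * ?V \<le> d ^ 4 * (4 * d\<^sup>2 * ?X + ?D)"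
    by (intro mult_left_mono annulus_mass_le_energy[OF s(1) s_small(2) d cball_double_subset energy_ratio_ge]) simp
  also have "\<dots> = 4 * (d ^ 6 * ?X) + d ^ 4 * ?D" by (simp add: distrib_left eval_nat_numeral)
  also have "\<dots> \<le> 4 * (4 * ?bound * ?m) + \<delta>\<^sup>2 * ?m"
    by (intro add_mono mult_left_mono annulus_energy_small[OF assms] ball_defect_le) simp
  finally have V: "d ^ 4 * ?V \<le> 16 * ?bound * ?m + \<delta>\<^sup>2 * ?m" by simp
  have "16 * ((1 / 256) powr (3 + \<Lambda>) - 256 * \<delta>) * ?m \<le> d ^ 4 * (LINT x:cball c (d / 2)|lborel. (u_ext x)\<^sup>2)"
    by (rule inner_ball_mass_ge)
  also have "\<dots> \<le> d ^ 4 * (?D + 48 / s * ?V)"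
    by (intro mult_left_mono inner_ball_mass_le_annulus_mass[OF s(1) s_small(1) d cball_double_subset]
        order_trans[OF _ energy_ratio_ge]) simp_all
  also have "\<dots> = d ^ 4 * ?D + 48 / s * (d ^ 4 * ?V)" by (simp add: distrib_left mult_ac)
  also have "\<dots> \<le> \<delta>\<^sup>2 * ?m + 48 / s * (16 * ?bound * ?m + \<delta>\<^sup>2 * ?m)"
    using s(1) by (intro add_mono mult_left_mono ball_defect_le V) simp
  also have "\<dots> = (\<delta>\<^sup>2 + 48 / s * (16 * ?bound + \<delta>\<^sup>2)) * ?m" by (simp add: distrib_right distrib_left mult_ac)
  finally show ?thesis using scale_mass_pos by (rule mult_right_le_imp_le)
qed

end

context free_boundary_solution
begin

lemma nearly_homogeneous_scale:
  assumes c: "center c T" and d: "0 < d" "64 * d\<^sup>2 < T" and \<Lambda>: "frequency c (64 * d\<^sup>2) \<le> \<Lambda>" and \<delta>: "0 < \<delta>" "\<delta> \<le> 1"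
    and gap: "frequency c (64 * d\<^sup>2) - frequency c (16 * d\<^sup>2) \<le> 3 / 4 * \<delta>\<^sup>2"
  obtains \<tau> where "nearly_homogeneous \<Omega> u g c T d \<tau> \<Lambda> \<delta>"
proof -
  have d_square_pos: "0 < d\<^sup>2" using d by simp
  let ?gap = "64 * d\<^sup>2 / (64 * d\<^sup>2 - 16 * d\<^sup>2) * (frequency c (64 * d\<^sup>2) - frequency c (16 * d\<^sup>2))"
  obtain \<tau> where \<tau>: "16 * d\<^sup>2 < \<tau>" "\<tau> < 64 * d\<^sup>2"
    and defect: "homogeneity_defect c \<tau> \<le> ?gap * mass c \<tau>" and air: "(air_energy c \<tau>)\<^sup>2 \<le> ?gap * (mass c \<tau>)\<^sup>2"
    by (rule frequency_pinching[OF c, of "16 * d\<^sup>2" "64 * d\<^sup>2"]) (use d_square_pos d in auto)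
  have "?gap \<le> \<delta>\<^sup>2" using gap d_square_pos by simp
  then have gap_mult: "?gap * m \<le> \<delta>\<^sup>2 * m" if "0 \<le> m" for m using that by (rule mult_right_mono)
  have "homogeneity_defect c \<tau> \<le> \<delta>\<^sup>2 * mass c \<tau>" using defect gap_mult[OF mass_nonneg] by (rule order_trans)
  moreover have "air_energy c \<tau> \<le> \<delta> * mass c \<tau>"
  proof (rule power2_le_imp_le)
    show "(air_energy c \<tau>)\<^sup>2 \<le> (\<delta> * mass c \<tau>)\<^sup>2"
      unfolding power_mult_distrib using air gap_mult[OF zero_le_power2] by (rule order_trans)
  qed (use \<delta>(1) mass_nonneg in simp)
  moreover have "0 < \<tau>" using \<tau>(1) d_square_pos by linarith
  then have "frequency c \<tau> \<le> \<Lambda>" using frequency_mono[OF c _ less_imp_le[OF \<tau>(2)] d(2)] \<Lambda> by linarith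
  ultimately have "nearly_homogeneous \<Omega> u g c T d \<tau> \<Lambda> \<delta>"
    using c d \<tau> \<delta> by unfold_locales auto
  then show ?thesis by (rule that)
qed

lemma centers_on_axis:
  assumes "center c T" "center z T'" "z \<noteq> c"
  obtains \<sigma> where "\<bar>\<sigma>\<bar> = 1" "z = c + (dist z c * \<sigma>) *\<^sub>R axis 1 1"
proof
  have "c $ 2 = 0" "z $ 2 = 0" using assms by (auto simp: center_def)
  then have "dist z c = \<bar>z $ 1 - c $ 1\<bar>" by (simp add: dist_norm norm_eq_sqrt_inner inner_pt)
  then show "\<bar>(z $ 1 - c $ 1) / dist z c\<bar> = 1" using assms(3) by (simp add: abs_divide flip: \<open>dist z c = _\<close>)
  show "z = c + (dist z c * ((z $ 1 - c $ 1) / dist z c)) *\<^sub>R axis 1 1"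
    using \<open>c $ 2 = 0\<close> \<open>z $ 2 = 0\<close> assms(3) by (simp add: vec_eq_iff forall_2 axis_def)
qed

lemma frequency_gap:
  obtains \<epsilon> where "\<epsilon> > 0"
    "\<And>c z T T'. \<lbrakk>center c T; center z T'; z \<noteq> c; 64 * (dist z c)\<^sup>2 < T; (dist z c)\<^sup>2 < T';
      frequency c (64 * (dist z c)\<^sup>2) \<le> \<Lambda>\<rbrakk>
      \<Longrightarrow> \<epsilon> \<le> frequency c (64 * (dist z c)\<^sup>2) - frequency c (16 * (dist z c)\<^sup>2)"
proof -
  define \<kappa> where "\<kappa> = (1 / 256 :: real) powr (3 + \<Lambda>)"
  define K where "K = (48 * 16 * (400 * (12 * 3 ^ 6 * 64)) :: real)"
  define s where "s = min (1 / 12) (\<kappa> / K)"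
  have pos: "0 < \<kappa>" "0 < K" by (simp_all add: \<kappa>_def K_def)
  then have s: "0 < s" "s \<le> 1 / 12" "K * s \<le> \<kappa>" by (auto simp: s_def min_def field_simps)
  obtain C where C: "C > 0" "\<And>\<sigma> y. \<bar>\<sigma>\<bar> = 1 \<Longrightarrow> norm (gradient (profile \<sigma> s) y) \<le> C"
    by (rule profile_gradient_bounded[of s]) (use s in auto)
  define L where "L = (2 * C + 5 / s) * 6 + C * (1 + 6 * (\<bar>\<Lambda>\<bar> + 1))"
  define W where "W = 4096 + 1 + 48 / s * (16 * L + 1)"
  define \<delta> where "\<delta> = min 1 (\<kappa> / W)"
  have "L > 0" using C(1) s(1) by (simp add: L_def add_pos_pos)
  then have "W > 0" using s(1) by (simp add: W_def add_pos_pos)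
  then have \<delta>: "0 < \<delta>" "\<delta> \<le> 1" "W * \<delta> \<le> \<kappa>" using pos(1) by (auto simp: \<delta>_def min_def field_simps)
  show ?thesis
  proof (rule that[of "3 / 4 * \<delta>\<^sup>2"])
    show "3 / 4 * \<delta>\<^sup>2 > 0" using \<delta> by simp
    fix c z T T'
    assume c: "center c T" and z: "center z T'" "z \<noteq> c" and scales: "64 * (dist z c)\<^sup>2 < T" "(dist z c)\<^sup>2 < T'"
      and \<Lambda>: "frequency c (64 * (dist z c)\<^sup>2) \<le> \<Lambda>"
    show "3 / 4 * \<delta>\<^sup>2 \<le> frequency c (64 * (dist z c)\<^sup>2) - frequency c (16 * (dist z c)\<^sup>2)"
    proof (rule ccontr)
      assume "\<not> ?thesis"
      then obtain \<tau> where "nearly_homogeneous \<Omega> u g c T (dist z c) \<tau> \<Lambda> \<delta>"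
        using nearly_homogeneous_scale[OF c _ scales(1) \<Lambda> \<delta>(1,2)] z(2) by auto
      then interpret scale: nearly_homogeneous \<Omega> u g c T "dist z c" \<tau> \<Lambda> \<delta> .
      obtain \<sigma> where \<sigma>: "\<bar>\<sigma>\<bar> = 1" "z = c + (dist z c * \<sigma>) *\<^sub>R axis 1 1" by (rule centers_on_axis[OF c z])
      have "\<delta>\<^sup>2 \<le> \<delta>" using \<delta> by (simp add: power2_eq_square mult_left_le)
      have "16 * (\<kappa> - 256 * \<delta>) \<le> \<delta>\<^sup>2 + 48 / s * (16 * scale.annulus_energy_bound C s + \<delta>\<^sup>2)"
        unfolding \<kappa>_def using z(1) \<sigma>(2) by (intro scale.annulus_balance[OF _ scales(2) \<sigma>(1) s(1,2) C(1) C(2)[OF \<sigma>(1)]]) simp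
      also have "scale.annulus_energy_bound C s = 400 * (12 * 3 ^ 6 * 64) * s\<^sup>2 + L * \<delta>"
        using scale.exponent_bound by (simp add: scale.annulus_energy_bound_def L_def)
      also have "\<delta>\<^sup>2 + 48 / s * (16 * (400 * (12 * 3 ^ 6 * 64) * s\<^sup>2 + L * \<delta>) + \<delta>\<^sup>2)
          \<le> \<delta> + 48 / s * (16 * (400 * (12 * 3 ^ 6 * 64) * s\<^sup>2 + L * \<delta>) + \<delta>)"
        using \<open>\<delta>\<^sup>2 \<le> \<delta>\<close> s(1) by (intro add_mono mult_left_mono order_refl) auto
      also have "\<dots> = K * s + W * \<delta> - 4096 * \<delta>"
        using s(1) by (simp add: K_def W_def power2_eq_square field_simps)
      finally show False using s(3) \<delta>(3) pos(1) by simp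
    qed
  qed
qed

lemma centers_isolated:
  assumes c: "center c T"
  obtains r where "r > 0" "\<And>z T'. center z T' \<Longrightarrow> dist z c < r \<Longrightarrow> (dist z c)\<^sup>2 < T' \<Longrightarrow> z = c"
proof -
  have "T > 0" using c by (simp add: center_def admissible_def)
  obtain \<epsilon> where "\<epsilon> > 0" and gap: "\<And>z T'. \<lbrakk>center z T'; z \<noteq> c; 64 * (dist z c)\<^sup>2 < T; (dist z c)\<^sup>2 < T';
      frequency c (64 * (dist z c)\<^sup>2) \<le> frequency c (T / 2)\<rbrakk>
      \<Longrightarrow> \<epsilon> \<le> frequency c (64 * (dist z c)\<^sup>2) - frequency c (16 * (dist z c)\<^sup>2)"
    by (rule frequency_gap[of "frequency c (T / 2)"]) (use c in blast)
  obtain t where t: "0 < t" "t < T" and small: "\<And>a b. 0 < a \<Longrightarrow> a \<le> b \<Longrightarrow> b \<le> t \<Longrightarrow> frequency c b - frequency c a < \<epsilon>"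
    by (rule frequency_small_gap[OF c \<open>\<epsilon> > 0\<close>]) blast
  show ?thesis
  proof (rule that[of "sqrt (min t (T / 2)) / 8"])
    show "sqrt (min t (T / 2)) / 8 > 0" using t \<open>T > 0\<close> by simp
    fix z T' assume z: "center z T'" "dist z c < sqrt (min t (T / 2)) / 8" "(dist z c)\<^sup>2 < T'"
    show "z = c"
    proof (rule ccontr)
      assume "z \<noteq> c"
      then have dist_square_pos: "0 < (dist z c)\<^sup>2" by simp
      have "(8 * dist z c)\<^sup>2 \<le> (sqrt (min t (T / 2)))\<^sup>2" using z(2) by (intro power_mono) auto
      then have scale: "64 * (dist z c)\<^sup>2 \<le> t" "64 * (dist z c)\<^sup>2 \<le> T / 2"
        using t(1) \<open>T > 0\<close> by (simp_all add: power_mult_distrib)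
      then have "frequency c (64 * (dist z c)\<^sup>2) \<le> frequency c (T / 2)"
        using dist_square_pos \<open>T > 0\<close> by (intro frequency_mono[OF c]) auto
      then have "\<epsilon> \<le> frequency c (64 * (dist z c)\<^sup>2) - frequency c (16 * (dist z c)\<^sup>2)"
        using scale(2) \<open>T > 0\<close> \<open>z \<noteq> c\<close> z by (intro gap) auto
      moreover have "frequency c (64 * (dist z c)\<^sup>2) - frequency c (16 * (dist z c)\<^sup>2) < \<epsilon>"
        using dist_square_pos scale(1) by (intro small) auto
      ultimately show False by simp
    qed
  qed
qed

lemma limit_point_Sigma_center:
  assumes "c islimpt Sigma_set \<Omega> u g" and \<rho>: "0 < \<rho>" "cball c (2 * \<rho>) \<subseteq> \<Omega>"
  shows "center c (\<rho>\<^sup>2)"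
proof -
  obtain X where "\<forall>m. X m \<in> Sigma_set \<Omega> u g - {c}" and lim: "X \<longlonglongrightarrow> c"
    using assms(1) unfolding islimpt_sequential by auto
  then have X: "X m \<in> Sigma_set \<Omega> u g" for m by simp
  have "\<forall>\<^sub>F m in sequentially. dist (X m) c < \<rho>" by (rule tendstoD[OF lim \<rho>(1)])
  then obtain m where "\<And>n. dist (X (n + m)) c < \<rho>" unfolding eventually_sequentially by (metis le_add2)
  then have near: "dist (X (n + m)) c \<le> \<rho>" for n by (rule less_imp_le)
  show ?thesis
    by (rule center_limit[OF \<rho>(2,1) LIMSEQ_ignore_initial_segment[OF lim, of m] near
          Sigma_imp_center[OF X admissible_near[OF \<rho>(2,1) near]]])
qed

lemma Sigma_locally_finite:
  assumes K: "compact K" "K \<subseteq> \<Omega>"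
  shows "finite (K \<inter> Sigma_set \<Omega> u g)"
proof (rule ccontr)
  let ?\<Sigma> = "Sigma_set \<Omega> u g"
  assume "infinite (K \<inter> ?\<Sigma>)"
  then obtain c where "c \<in> K" "c islimpt (K \<inter> ?\<Sigma>)"
    using Heine_Borel_imp_Bolzano_Weierstrass[OF K(1)] by blast
  then have "c islimpt ?\<Sigma>" "c \<in> \<Omega>" using K(2) islimpt_subset by blast+
  then obtain R where R: "R > 0" "cball c R \<subseteq> \<Omega>" using open_domain open_contains_cball by blast
  define \<rho> where "\<rho> = R / 2"
  have \<rho>: "0 < \<rho>" "cball c (2 * \<rho>) \<subseteq> \<Omega>" using R by (simp_all add: \<rho>_def)
  obtain r where "r > 0" and isolated: "\<And>z T'. center z T' \<Longrightarrow> dist z c < r \<Longrightarrow> (dist z c)\<^sup>2 < T' \<Longrightarrow> z = c"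
    by (rule centers_isolated[OF limit_point_Sigma_center[OF \<open>c islimpt ?\<Sigma>\<close> \<rho>]]) blast
  obtain z where z: "z \<in> ?\<Sigma>" "z \<noteq> c" "dist z c < min r \<rho>"
    using \<open>c islimpt ?\<Sigma>\<close> \<open>r > 0\<close> \<rho>(1) unfolding islimpt_approachable by (metis min_less_iff_conj)
  then have "center z (\<rho>\<^sup>2)" by (intro Sigma_imp_center admissible_near[OF \<rho>(2,1)]) auto
  moreover have "(dist z c)\<^sup>2 < \<rho>\<^sup>2" using z(3) by (intro power_strict_mono) auto
  ultimately show False using isolated z by simp
qed

end

theorem mainTheorem19:
  fixes \<Omega> :: "(real ^ 2) set" and u :: "real ^ 2 \<Rightarrow> real" and g :: "real ^ 2 \<Rightarrow> real ^ 2"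
  assumes "open \<Omega>" and "connected \<Omega>" and "bounded \<Omega>"
    and "\<exists>x\<in>\<Omega>. x $ 2 = 0"
    and "variational_solution \<Omega> u g"
  shows "\<forall>K. compact K \<and> K \<subseteq> \<Omega> \<longrightarrow> finite (K \<inter> Sigma_set \<Omega> u g)"
proof -
  interpret free_boundary_solution \<Omega> u g using assms(1,5) by unfold_locales
  show ?thesis using Sigma_locally_finite by blast
qed

end
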